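(* Suppose that $\mathbb{B}$ is a complete Boolean algebra and $j:V\to\overline V$ is an elementary embedding, such that there is a filter $F\subseteq j(\mathbb{B})$ that is $\mathrm{ran}(j)$-generic and $\overline V=\{j(f)(b_A) : A\subseteq\mathbb{B}\text{ a maximal antichain},\ f:A\to V\}$, where $b_A$ is the unique member of $F\cap j(A)$. Then $j:V\to\overline V$ is isomorphic to the Boolean ultrapower by $U=j^{-1}F\subseteq\mathbb{B}$. In this case, $F$ is actually $\overline V$-generic and $\overline V[F]$ is isomorphic to $V^{\mathbb{B}}/U$.
   Context: $\overline V$ is a class structure for the language of set theory, not assumed well-founded; $j(\mathbb{B})$, $j(A)$, $j(f)(b)$ are evaluated in $\overline V$, and "$F\subseteq j(\mathbb{B})$" means $F$ is a filter on the Boolean algebra of $\overline V$-elements of $j(\mathbb{B})$ ($F$ itself need not belong to $\overline V$ or $V$). $F$ is $\mathrm{ran}(j)$-generic if $F\cap j(A)\neq\emptyset$ for every maximal antichain $A\subseteq\mathbb{B}$ in $V$; $F$ is $\overline V$-generic if it meets every $D\in\overline V$ that $\overline V$ regards as a dense subset of $j(\mathbb{B})$. $\overline V[F]$ is the forcing extension of $\overline V$ by $F$, whose elements are the values $\mathrm{val}(\tau,F)$ of $j(\mathbb{B})$-names $\tau$ of $\overline V$ (for ill-founded $\overline V$, the quotient of the class of $j(\mathbb{B})$-names of $\overline V$ by the relations $[\![\sigma=\tau]\!]^{j(\mathbb{B})}\in F$ and $[\![\sigma\in\tau]\!]^{j(\mathbb{B})}\in F$). Functions $f$ and antichains $A\subseteq\mathbb{B}$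 are in $V$. $\mathbb{B}$-names (elements of $V^{\mathbb{B}}$) are defined recursively: $\tau$ is a $\mathbb{B}$-name if $\tau$ is a set of pairs $\langle\sigma,b\rangle$ with $\sigma$ a $\mathbb{B}$-name and $b\in\mathbb{B}$. Boolean values: $[\![\tau\in\sigma]\!]=\bigvee_{\langle\eta,b\rangle\in\sigma}[\![\tau=\eta]\!]\wedge b$, $[\![\tau=\sigma]\!]=[\![\tau\subseteq\sigma]\!]\wedge[\![\sigma\subseteq\tau]\!]$, $[\![\tau\subseteq\sigma]\!]=\bigwedge_{\eta\in\mathrm{dom}(\tau)}(\neg[\![\eta\in\tau]\!]\vee[\![\eta\in\sigma]\!])$. $\check x=\{\langle\check y,1\rangle : y\in x\}$; $[\![\tau\in\check V]\!]=\bigvee_{x\in V}[\![\tau=\check x]\!]$. Let $\tau=_U\sigma$ iff $[\![\tau=\sigma]\!]\in U$, $\tau\in_U\sigma$ iff $[\![\tau\in\sigma]\!]\in U$; $[\tau]_U$ is the $=_U$-class of $\tau$ (restricted to members of minimal rank). $V^{\mathbb{B}}/U=\{[\tau]_U : \tau\in V^{\mathbb{B}}\}$ under $\in_U$; the Boolean ultrapower by $U$ is $\check V_U=\{[\tau]_U : [\![\tau\in\check V]\!]\in U\}$ under $\in_U$, with $j_U:V\to\check V_U$, $j_U(x)=[\check x]_U$. "$j$ is isomorphic to the Boolean ultrapower by $U$" means there is an isomorphism $\pi:\check V_U\cong\overline V$ with $\pi\circ j_U=j$. *)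

theory Defs
  imports Main
begin

section \<open>The first-order language of set theory\<close>

text \<open>Variables are de Bruijn indices: \<open>All\<close> binds index 0 and shifts the other indices.\<close>

datatype fm = Mem nat nat | Eq nat nat | Neg fm | Conj fm fm | All fm

primrec sat :: "('a \<Rightarrow> 'a \<Rightarrow> bool) \<Rightarrow> fm \<Rightarrow> (nat \<Rightarrow> 'a) \<Rightarrow> bool" where
  "sat E (Mem i k) e \<longleftrightarrow> E (e i) (e k)"
| "sat E (Eq i k) e \<longleftrightarrow> e i = e k"
| "sat E (Neg \<phi>) e \<longleftrightarrow> \<not> sat E \<phi> e"
| "sat E (Conj \<phi> \<psi>) e \<longleftrightarrow> sat E \<phi> e \<and> sat E \<psi> e"
| "sat E (All \<phi>) e \<longleftrightarrow> (\<forall>x. sat E \<phi> (case_nat x e))"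

definition elementary_embedding ::
    "('v \<Rightarrow> 'v \<Rightarrow> bool) \<Rightarrow> ('w \<Rightarrow> 'w \<Rightarrow> bool) \<Rightarrow> ('v \<Rightarrow> 'w) \<Rightarrow> bool" where
  "elementary_embedding E E' j \<longleftrightarrow> (\<forall>\<phi> e. sat E \<phi> e \<longleftrightarrow> sat E' \<phi> (j \<circ> e))"

definition isomorphism ::
    "'a set \<Rightarrow> ('a \<Rightarrow> 'a \<Rightarrow> bool) \<Rightarrow> 'b set \<Rightarrow> ('b \<Rightarrow> 'b \<Rightarrow> bool) \<Rightarrow> ('a \<Rightarrow> 'b) \<Rightarrow> bool" where
  "isomorphism X R Y S \<pi> \<longleftrightarrow>
     bij_betw \<pi> X Y \<and> (\<forall>x\<in>X. \<forall>y\<in>X. R x y \<longleftrightarrow> S (\<pi> x) (\<pi> y))"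

definition isomorphic ::
    "'a set \<Rightarrow> ('a \<Rightarrow> 'a \<Rightarrow> bool) \<Rightarrow> 'b set \<Rightarrow> ('b \<Rightarrow> 'b \<Rightarrow> bool) \<Rightarrow> bool" where
  "isomorphic X R Y S \<longleftrightarrow> (\<exists>\<pi>. isomorphism X R Y S \<pi>)"


section \<open>Structures for the language of set theory\<close>

text \<open>
  A structure is a type together with an arbitrary binary relation; the relation need not be
  well-founded. Everything in this locale and the next is evaluated inside the structure: all
  functions, relations and ordered pairs below are elements of the structure.
\<close>

locale membership =
  fixes mem :: "'a \<Rightarrow> 'a \<Rightarrow> bool" (infix "\<epsilon>" 50)
begin

definition elts :: "'a \<Rightarrow> 'a set" where
  "elts x = {y. y \<epsilon> x}"

definition is_upair :: "'a \<Rightarrow> 'a \<Rightarrow> 'a \<Rightarrow> bool" where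
  "is_upair x y z \<longleftrightarrow> (\<forall>w. w \<epsilon> z \<longleftrightarrow> w = x \<or> w = y)"

definition is_pair :: "'a \<Rightarrow> 'a \<Rightarrow> 'a \<Rightarrow> bool" where
  "is_pair x y p \<longleftrightarrow> (\<exists>u v. is_upair x x u \<and> is_upair x y v \<and> is_upair u v p)"

definition opair :: "'a \<Rightarrow> 'a \<Rightarrow> 'a" where
  "opair x y = (THE p. is_pair x y p)"

definition pair_in :: "'a \<Rightarrow> 'a \<Rightarrow> 'a \<Rightarrow> bool" where
  "pair_in x y r \<longleftrightarrow> (\<exists>p. is_pair x y p \<and> p \<epsilon> r)"

definition is_prod :: "'a \<Rightarrow> 'a \<Rightarrow> 'a \<Rightarrow> bool" where
  "is_prod X Y D \<longleftrightarrow> (\<forall>p. p \<epsilon> D \<longleftrightarrow> (\<exists>x y. x \<epsilon> X \<and> y \<epsilon> Y \<and> is_pair x y p))"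

definition is_fun :: "'a \<Rightarrow> 'a \<Rightarrow> bool" where
  "is_fun f A \<longleftrightarrow>
     (\<forall>p. p \<epsilon> f \<longrightarrow> (\<exists>x y. x \<epsilon> A \<and> is_pair x y p)) \<and>
     (\<forall>x. x \<epsilon> A \<longrightarrow> (\<exists>!y. pair_in x y f))"

definition app :: "'a \<Rightarrow> 'a \<Rightarrow> 'a" where
  "app f x = (THE y. pair_in x y f)"

definition transitive_set :: "'a \<Rightarrow> bool" where
  "transitive_set T \<longleftrightarrow> (\<forall>x y. x \<epsilon> T \<and> y \<epsilon> x \<longrightarrow> y \<epsilon> T)"

definition extensionality_ax :: bool where
  "extensionality_ax \<longleftrightarrow>
     (\<forall>x y. (\<forall>z. z \<epsilon> x \<longleftrightarrow> z \<epsilon> y) \<longrightarrow> x = y)"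

definition foundation_ax :: bool where
  "foundation_ax \<longleftrightarrow>
     (\<forall>x. (\<exists>y. y \<epsilon> x) \<longrightarrow> (\<exists>y. y \<epsilon> x \<and> \<not> (\<exists>z. z \<epsilon> x \<and> z \<epsilon> y)))"

definition pairing_ax :: bool where
  "pairing_ax \<longleftrightarrow>
     (\<forall>x y. \<exists>z. is_upair x y z)"

definition union_ax :: bool where
  "union_ax \<longleftrightarrow>
     (\<forall>x. \<exists>u. \<forall>z. z \<epsilon> u \<longleftrightarrow> (\<exists>y. y \<epsilon> x \<and> z \<epsilon> y))"

definition power_set_ax :: bool where
  "power_set_ax \<longleftrightarrow>
     (\<forall>x. \<exists>p. \<forall>z. z \<epsilon> p \<longleftrightarrow> (\<forall>w. w \<epsilon> z \<longrightarrow> w \<epsilon> x))"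

definition infinity_ax :: bool where
  "infinity_ax \<longleftrightarrow>
     (\<exists>x. (\<exists>z. z \<epsilon> x \<and> (\<forall>w. \<not> w \<epsilon> z)) \<and>
          (\<forall>y. y \<epsilon> x \<longrightarrow> (\<exists>s. s \<epsilon> x \<and> (\<forall>w. w \<epsilon> s \<longleftrightarrow> w \<epsilon> y \<or> w = y))))"

text \<open>In the two schemes, the assignment \<open>e\<close> supplies the parameters.\<close>

definition separation_ax :: bool where
  "separation_ax \<longleftrightarrow>
     (\<forall>\<phi> e x. \<exists>y. \<forall>z. z \<epsilon> y \<longleftrightarrow> z \<epsilon> x \<and> sat mem \<phi> (case_nat z e))"

definition replacement_ax :: bool where
  "replacement_ax \<longleftrightarrow>
     (\<forall>\<phi> e x. (\<forall>y. y \<epsilon> x \<longrightarrow> (\<exists>!z. sat mem \<phi> (case_nat y (case_nat z e)))) \<longrightarrow>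
        (\<exists>w. \<forall>z. z \<epsilon> w \<longleftrightarrow> (\<exists>y. y \<epsilon> x \<and> sat mem \<phi> (case_nat y (case_nat z e)))))"

definition choice_ax :: bool where
  "choice_ax \<longleftrightarrow>
     (\<forall>x. (\<forall>y. y \<epsilon> x \<longrightarrow> (\<exists>z. z \<epsilon> y)) \<and>
          (\<forall>y z w. y \<epsilon> x \<and> z \<epsilon> x \<and> w \<epsilon> y \<and> w \<epsilon> z \<longrightarrow> y = z) \<longrightarrow>
          (\<exists>c. \<forall>y. y \<epsilon> x \<longrightarrow> (\<exists>!z. z \<epsilon> c \<and> z \<epsilon> y)))"

definition ZFC :: bool where
  "ZFC \<longleftrightarrow>
     extensionality_ax \<and> foundation_ax \<and> pairing_ax \<and>
     union_ax \<and> power_set_ax \<and> infinity_ax \<and>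
     separation_ax \<and> replacement_ax \<and> choice_ax"

end


section \<open>Boolean algebras, names and Boolean values inside a structure\<close>

text \<open>
  A Boolean algebra in the structure is given by two elements of the structure: its underlying
  set \<open>B\<close> and its order \<open>L\<close>, a set of ordered pairs. The Boolean operations are derived from
  the order. An elementary embedding \<open>j\<close> sends the algebra \<open>(B, L)\<close> to \<open>(j B, j L)\<close>.
\<close>

locale internal_algebra = membership mem
  for mem :: "'a \<Rightarrow> 'a \<Rightarrow> bool" (infix "\<epsilon>" 50) +
  fixes B L :: 'a
begin

definition le :: "'a \<Rightarrow> 'a \<Rightarrow> bool" (infix "\<preceq>" 50) where
  "a \<preceq> b \<longleftrightarrow> pair_in a b L"

definition is_lub :: "'a set \<Rightarrow> 'a \<Rightarrow> bool" where
  "is_lub S s \<longleftrightarrow> s \<epsilon> B \<and> (\<forall>a\<in>S. a \<preceq> s) \<and> (\<forall>u. u \<epsilon> B \<and> (\<forall>a\<in>S. a \<preceq> u) \<longrightarrow> s \<preceq> u)"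

definition is_glb :: "'a set \<Rightarrow> 'a \<Rightarrow> bool" where
  "is_glb S s \<longleftrightarrow> s \<epsilon> B \<and> (\<forall>a\<in>S. s \<preceq> a) \<and> (\<forall>u. u \<epsilon> B \<and> (\<forall>a\<in>S. u \<preceq> a) \<longrightarrow> u \<preceq> s)"

definition bsup :: "'a set \<Rightarrow> 'a" where
  "bsup S = (THE s. is_lub S s)"

definition binf :: "'a set \<Rightarrow> 'a" where
  "binf S = (THE s. is_glb S s)"

definition zero :: 'a where "zero = bsup {}"

definition one :: 'a where "one = binf {}"

definition join :: "'a \<Rightarrow> 'a \<Rightarrow> 'a" (infixl "\<squnion>" 65) where
  "a \<squnion> b = bsup {a, b}"

definition meet :: "'a \<Rightarrow> 'a \<Rightarrow> 'a" (infixl "\<sqinter>" 70) where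
  "a \<sqinter> b = binf {a, b}"

definition compl :: "'a \<Rightarrow> 'a" where
  "compl a = (THE c. c \<epsilon> B \<and> a \<sqinter> c = zero \<and> a \<squnion> c = one)"

definition boolean_algebra :: bool where
  "boolean_algebra \<longleftrightarrow>
     (\<forall>a\<in>elts B. a \<preceq> a) \<and>
     (\<forall>a\<in>elts B. \<forall>b\<in>elts B. a \<preceq> b \<and> b \<preceq> a \<longrightarrow> a = b) \<and>
     (\<forall>a\<in>elts B. \<forall>b\<in>elts B. \<forall>c\<in>elts B. a \<preceq> b \<and> b \<preceq> c \<longrightarrow> a \<preceq> c) \<and>
     (\<exists>s. is_lub {} s) \<and> (\<exists>s. is_glb {} s) \<and>
     (\<forall>a\<in>elts B. \<forall>b\<in>elts B. (\<exists>s. is_lub {a, b} s) \<and> (\<exists>s. is_glb {a, b} s)) \<and>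
     (\<forall>a\<in>elts B. \<forall>b\<in>elts B. \<forall>c\<in>elts B. a \<sqinter> (b \<squnion> c) = (a \<sqinter> b) \<squnion> (a \<sqinter> c)) \<and>
     (\<forall>a\<in>elts B. \<exists>c\<in>elts B. a \<sqinter> c = zero \<and> a \<squnion> c = one)"

text \<open>Completeness is internal: it concerns the subsets of \<open>B\<close> that belong to the structure.\<close>

definition complete_boolean_algebra :: bool where
  "complete_boolean_algebra \<longleftrightarrow>
     boolean_algebra \<and> (\<forall>X. elts X \<subseteq> elts B \<longrightarrow> (\<exists>s. is_lub (elts X) s))"

definition antichain :: "'a \<Rightarrow> bool" where
  "antichain A \<longleftrightarrow>
     (\<forall>a\<in>elts A. a \<epsilon> B \<and> a \<noteq> zero) \<and>
     (\<forall>a\<in>elts A. \<forall>b\<in>elts A. a \<noteq> b \<longrightarrow> a \<sqinter> b = zero)"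

definition maximal_antichain :: "'a \<Rightarrow> bool" where
  "maximal_antichain A \<longleftrightarrow>
     antichain A \<and> (\<forall>A'. antichain A' \<and> elts A \<subseteq> elts A' \<longrightarrow> A' = A)"

definition dense :: "'a \<Rightarrow> bool" where
  "dense D \<longleftrightarrow>
     elts D \<subseteq> elts B \<and> (\<forall>b\<in>elts B. b \<noteq> zero \<longrightarrow> (\<exists>d\<in>elts D. d \<noteq> zero \<and> d \<preceq> b))"

text \<open>
  Filters are proper and external: they are sets of elements of the structure that need not be
  coded by an element of the structure.
\<close>

definition is_filter :: "'a set \<Rightarrow> bool" where
  "is_filter F \<longleftrightarrow>
     F \<subseteq> elts B \<and> one \<in> F \<and> zero \<notin> F \<and>
     (\<forall>a\<in>F. \<forall>b\<in>F. a \<sqinter> b \<in> F) \<and>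
     (\<forall>a\<in>F. \<forall>b\<in>elts B. a \<preceq> b \<longrightarrow> b \<in> F)"

definition generic :: "'a set \<Rightarrow> bool" where
  "generic F \<longleftrightarrow> (\<forall>D. dense D \<longrightarrow> F \<inter> elts D \<noteq> {})"

text \<open>
  Each of the following recursions is carried out inside the structure, as is necessary when the
  structure is ill-founded: an object defined by recursion on names or sets is one that is
  provided by a set of the structure which is closed under passing to the components and on which
  the recursion equations hold.
\<close>

definition names_set :: "'a \<Rightarrow> bool" where
  "names_set T \<longleftrightarrow>
     (\<forall>\<tau>. \<tau> \<epsilon> T \<longrightarrow> (\<forall>p. p \<epsilon> \<tau> \<longrightarrow> (\<exists>\<sigma> b. \<sigma> \<epsilon> T \<and> b \<epsilon> B \<and> is_pair \<sigma> b p)))"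

definition names :: "'a set" where
  "names = {\<tau>. \<exists>T. names_set T \<and> \<tau> \<epsilon> T}"

text \<open>
  \<open>mem_val\<close> and \<open>sub_val\<close> are the clauses for the values of \<open>\<tau> \<in> \<sigma>\<close> and \<open>\<tau> \<subseteq> \<sigma>\<close>, as functions of
  the values \<open>G \<eta> \<theta>\<close> of the equalities \<open>\<eta> = \<theta>\<close>.
\<close>

definition mem_val :: "('a \<Rightarrow> 'a \<Rightarrow> 'a) \<Rightarrow> 'a \<Rightarrow> 'a \<Rightarrow> 'a" where
  "mem_val G \<tau> \<sigma> = bsup {G \<tau> \<eta> \<sqinter> b | \<eta> b. pair_in \<eta> b \<sigma>}"

definition sub_val :: "('a \<Rightarrow> 'a \<Rightarrow> 'a) \<Rightarrow> 'a \<Rightarrow> 'a \<Rightarrow> 'a" where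
  "sub_val G \<tau> \<sigma> = binf {compl (mem_val G \<eta> \<tau>) \<squnion> mem_val G \<eta> \<sigma> | \<eta>. \<exists>b. pair_in \<eta> b \<tau>}"

definition eq_recursion :: "'a \<Rightarrow> 'a \<Rightarrow> bool" where
  "eq_recursion T g \<longleftrightarrow>
     names_set T \<and> (\<exists>D. is_prod T T D \<and> is_fun g D) \<and>
     (let G = (\<lambda>\<tau> \<sigma>. app g (opair \<tau> \<sigma>)) in
        \<forall>\<tau>\<in>elts T. \<forall>\<sigma>\<in>elts T. G \<tau> \<sigma> = sub_val G \<tau> \<sigma> \<sqinter> sub_val G \<sigma> \<tau>)"

definition eq_value :: "'a \<Rightarrow> 'a \<Rightarrow> 'a" ("\<lbrakk>_ =\<^sub>B _\<rbrakk>") where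
  "\<lbrakk>\<tau> =\<^sub>B \<sigma>\<rbrakk> =
     (THE b. \<exists>T g. eq_recursion T g \<and> \<tau> \<epsilon> T \<and> \<sigma> \<epsilon> T \<and> b = app g (opair \<tau> \<sigma>))"

definition mem_value :: "'a \<Rightarrow> 'a \<Rightarrow> 'a" ("\<lbrakk>_ \<in>\<^sub>B _\<rbrakk>") where
  "\<lbrakk>\<tau> \<in>\<^sub>B \<sigma>\<rbrakk> = mem_val eq_value \<tau> \<sigma>"

definition check_recursion :: "'a \<Rightarrow> 'a \<Rightarrow> bool" where
  "check_recursion T c \<longleftrightarrow>
     transitive_set T \<and> is_fun c T \<and>
     (\<forall>x. x \<epsilon> T \<longrightarrow> (\<forall>p. p \<epsilon> app c x \<longleftrightarrow> (\<exists>y. y \<epsilon> x \<and> is_pair (app c y) one p)))"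

definition check :: "'a \<Rightarrow> 'a" where
  "check x = (THE z. \<exists>T c. check_recursion T c \<and> x \<epsilon> T \<and> z = app c x)"

definition ground_value :: "'a \<Rightarrow> 'a" ("\<lbrakk>_ \<in>\<^sub>B V\<rbrakk>") where
  "\<lbrakk>\<tau> \<in>\<^sub>B V\<rbrakk> = bsup {\<lbrakk>\<tau> =\<^sub>B check x\<rbrakk> | x. True}"


subsection \<open>Quotients\<close>

text \<open>
  The full equivalence classes are used as elements of the quotient, without the restriction to
  members of minimal rank: the classes are external sets, so no set-sized representation is
  needed.
\<close>

definition name_class :: "'a set \<Rightarrow> 'a \<Rightarrow> 'a set" where
  "name_class U \<tau> = {\<sigma> \<in> names. \<lbrakk>\<sigma> =\<^sub>B \<tau>\<rbrakk> \<in> U}"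

definition mem_class :: "'a set \<Rightarrow> 'a set \<Rightarrow> 'a set \<Rightarrow> bool" where
  "mem_class U X Y \<longleftrightarrow> (\<exists>\<tau>\<in>X. \<exists>\<sigma>\<in>Y. \<lbrakk>\<tau> \<in>\<^sub>B \<sigma>\<rbrakk> \<in> U)"

text \<open>
  Under \<open>mem_class U\<close>, this is the quotient of the Boolean-valued model by \<open>U\<close>, and in
  particular the forcing extension of the structure if \<open>U\<close> is a generic filter.
\<close>

definition quotient_model :: "'a set \<Rightarrow> 'a set set" where
  "quotient_model U = {name_class U \<tau> | \<tau>. \<tau> \<in> names}"

definition boolean_ultrapower :: "'a set \<Rightarrow> 'a set set" where
  "boolean_ultrapower U = {name_class U \<tau> | \<tau>. \<tau> \<in> names \<and> \<lbrakk>\<tau> \<in>\<^sub>B V\<rbrakk> \<in> U}"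

definition ultrapower_map :: "'a set \<Rightarrow> 'a \<Rightarrow> 'a set" where
  "ultrapower_map U x = name_class U (check x)"

text \<open>
  \<open>val\<close> evaluates the names by \<open>F\<close> in the sense of the recursion
  \<open>val \<tau> = {val \<sigma> | \<langle>\<sigma>, b\<rangle> \<in> \<tau>, b \<in> F}\<close>, where the values are regarded as sets with membership \<open>R\<close>.
  For a well-founded structure this determines the values up to isomorphism.
\<close>

definition valuation :: "'a set \<Rightarrow> ('a \<Rightarrow> 'b) \<Rightarrow> ('b \<Rightarrow> 'b \<Rightarrow> bool) \<Rightarrow> bool" where
  "valuation F val R \<longleftrightarrow>
     (\<forall>\<tau>\<in>names. \<forall>x\<in>val ` names.
        R x (val \<tau>) \<longleftrightarrow> (\<exists>\<sigma> b. pair_in \<sigma> b \<tau> \<and> b \<in> F \<and> x = val \<sigma>)) \<and>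
     (\<forall>x\<in>val ` names. \<forall>y\<in>val ` names.
        (\<forall>z\<in>val ` names. R z x \<longleftrightarrow> R z y) \<longrightarrow> x = y)"

end


definition ran_generic ::
    "('v \<Rightarrow> 'v \<Rightarrow> bool) \<Rightarrow> ('w \<Rightarrow> 'w \<Rightarrow> bool) \<Rightarrow> ('v \<Rightarrow> 'w) \<Rightarrow> 'v \<Rightarrow> 'v \<Rightarrow> 'w set \<Rightarrow> bool" where
  "ran_generic E E' j B L F \<longleftrightarrow>
     (\<forall>A. internal_algebra.maximal_antichain E B L A \<longrightarrow> F \<inter> membership.elts E' (j A) \<noteq> {})"

definition selected :: "('w \<Rightarrow> 'w \<Rightarrow> bool) \<Rightarrow> ('v \<Rightarrow> 'w) \<Rightarrow> 'w set \<Rightarrow> 'v \<Rightarrow> 'w" where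
  "selected E' j F A = (THE b. b \<in> F \<inter> membership.elts E' (j A))"

end

theory Submission
  imports Defs
begin

text \<open>
  Write \<open>V\<close> and \<open>W\<close> for the structures \<open>(UNIV, E)\<close> and \<open>(UNIV, E')\<close>. Each element of \<open>W\<close> has the
  form \<open>j(f)(b\<^sub>A)\<close>, and three consequences of this give the theorem.

  First, \<open>F\<close> is generic over \<open>W\<close> (\<open>generic\<close>). Let \<open>D = j(f)(b\<^sub>A)\<close> be dense. In \<open>V\<close>, the conditions \<open>d\<close>
  that lie below some \<open>a \<in> A\<close> and belong to \<open>f(a)\<close> whenever \<open>f(a)\<close> is dense are themselves dense, so
  there is a maximal antichain \<open>A'\<close> of them (\<open>antichain_below_dense\<close>). The element of \<open>F\<close> selected from
  \<open>j(A')\<close> lies below some \<open>a \<in> j(A)\<close>, which is then in \<open>F\<close> and equals \<open>b\<^sub>A\<close>, and so it is in \<open>D\<close>.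

  Secondly, each name \<open>\<sigma>\<close> of \<open>W\<close> is equal, up to \<open>F\<close>, to \<open>j \<tau>\<close> for a name \<open>\<tau>\<close> of \<open>V\<close>
  (\<open>name_representation\<close>). If \<open>\<sigma> = j(f)(b\<^sub>A)\<close>, mix the names among the values of \<open>f\<close> along \<open>A\<close> to a name
  \<open>\<tau>\<close> such that \<open>a\<close> is below the value of \<open>\<tau> = f(a)\<close> for all \<open>a \<in> A\<close> (\<open>mixing\<close>); by elementarity \<open>b\<^sub>A\<close> is
  below the value of \<open>j \<tau> = \<sigma>\<close>. As \<open>j\<close> preserves Boolean values and \<open>U = j\<^sup>-\<^sup>1 F\<close>, the map \<open>\<tau> \<mapsto> j \<tau>\<close>
  induces an isomorphism between the quotient of \<open>V\<close>'s Boolean-valued model by \<open>U\<close> and that of \<open>W\<close>'s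
  by \<open>F\<close>. If \<open>W\<close> is well-founded, the truth lemma for atomic formulas (\<open>valuation_eq_iff\<close>) identifies the
  latter with the evaluated names.

  Thirdly, if the value of \<open>\<tau> \<in> V\<close> is in \<open>U\<close>, genericity of \<open>F\<close> gives an \<open>x\<close> in \<open>W\<close> for which the value
  of \<open>j \<tau> = check x\<close> is in \<open>F\<close>; it is unique because an equality of two different check names has
  value zero. Mapping the class of \<open>\<tau>\<close> to \<open>x\<close> is the isomorphism from the Boolean ultrapower
  (\<open>ultrapower_iso\<close>): it is onto by the second fact applied to \<open>check x\<close>, and it sends the class of \<open>check x\<close>
  to \<open>j x\<close> because \<open>j\<close> commutes with \<open>check\<close>.

  Most of the work is to carry out the Boolean-valued model inside an arbitrary model of ZFC, which
  may be ill-founded: induction is available only for definable predicates, and recursions have to be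
  solved by elements of the model. To be preserved by \<open>j\<close>, every notion must also be expressed by a
  formula. The relation \<open>codefinable\<close> says that a predicate on \<open>V\<close> and a predicate on \<open>W\<close> are given by
  the same formula, with parameters related by \<open>j\<close>. It is closed under the logical operations, so that
  instances are derived by following the syntax of the predicates, and it serves both for definability
  within one model (\<open>E' = E\<close> and \<open>j\<close> the identity) and for elementarity. Definite descriptions are
  opaque to this method, because a description without a unique witness has an unspecified value; the
  Boolean operations and values are therefore accompanied by relations (\<open>eq_rel\<close>, \<open>check_rel\<close>, \<dots>)
  that are first-order and agree with them wherever the descriptions are proper.
\<close>

section \<open>Definability and elementarity\<close>

primrec rename :: "(nat \<Rightarrow> nat) \<Rightarrow> fm \<Rightarrow> fm" where
  "rename \<rho> (Mem i k) = Mem (\<rho> i) (\<rho> k)"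
| "rename \<rho> (Eq i k) = Eq (\<rho> i) (\<rho> k)"
| "rename \<rho> (Neg \<phi>) = Neg (rename \<rho> \<phi>)"
| "rename \<rho> (Conj \<phi> \<psi>) = Conj (rename \<rho> \<phi>) (rename \<rho> \<psi>)"
| "rename \<rho> (All \<phi>) = All (rename (case_nat 0 (Suc \<circ> \<rho>)) \<phi>)"

lemma sat_rename: "sat E (rename \<rho> \<phi>) e \<longleftrightarrow> sat E \<phi> (e \<circ> \<rho>)"
proof (induction \<phi> arbitrary: \<rho> e)
  case (All \<phi>)
  have "case_nat x e \<circ> case_nat 0 (Suc \<circ> \<rho>) = case_nat x (e \<circ> \<rho>)" for x
    by (rule ext) (simp split: nat.split)
  then show ?case by (simp only: rename.simps sat.simps All.IH)
qed auto

text \<open>An environment \<open>e\<close> for the arguments and a sequence \<open>s\<close> of parameters are combined into a single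
  environment, so that any two sequences of parameters can again be combined into one.\<close>
definition weave :: "(nat \<Rightarrow> 'a) \<Rightarrow> (nat \<Rightarrow> 'a) \<Rightarrow> nat \<Rightarrow> 'a" where
  "weave e s n = (if even n then e (n div 2) else s (n div 2))"

lemma weave_simps: "weave e s (2 * n) = e n" "weave e s (Suc (2 * n)) = s n"
  "weave e s (Suc (4 * n)) = s (2 * n)" "weave e s (Suc (Suc (Suc (4 * n)))) = s (Suc (2 * n))"
proof -
  have *: "Suc (4 * n) = Suc (2 * (2 * n))" "Suc (Suc (Suc (4 * n))) = Suc (2 * Suc (2 * n))"
    by simp_all
  show "weave e s (2 * n) = e n" "weave e s (Suc (2 * n)) = s n"
    by (simp_all add: weave_def)
  show "weave e s (Suc (4 * n)) = s (2 * n)" "weave e s (Suc (Suc (Suc (4 * n)))) = s (Suc (2 * n))"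
    unfolding * by (simp_all add: weave_def del: mult_Suc_right)
qed

lemma weave_eqI:
  assumes "\<And>n. f (2 * n) = e n" "\<And>n. f (Suc (2 * n)) = s n"
  shows "f = weave e s"
proof
  fix m show "f m = weave e s m"
  proof (cases "even m")
    case True then show ?thesis by (auto elim!: evenE simp: assms weave_simps)
  next
    case False
    then obtain l where "m = Suc (2 * l)" by (auto elim: oddE)
    then show ?thesis by (simp add: assms weave_simps)
  qed
qed

text \<open>With \<open>E' = E\<close>, \<open>j = (\<lambda>x. x)\<close> and \<open>P' = P\<close> this is definability of \<open>P\<close> from parameters.\<close>
definition codefinable ::
    "('v \<Rightarrow> 'v \<Rightarrow> bool) \<Rightarrow> ('w \<Rightarrow> 'w \<Rightarrow> bool) \<Rightarrow> ('v \<Rightarrow> 'w) \<Rightarrow>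
     ((nat \<Rightarrow> 'v) \<Rightarrow> bool) \<Rightarrow> ((nat \<Rightarrow> 'w) \<Rightarrow> bool) \<Rightarrow> bool" where
  "codefinable E E' j P P' \<longleftrightarrow>
     (\<exists>\<phi> s. (\<forall>e. P e \<longleftrightarrow> sat E \<phi> (weave e s)) \<and> (\<forall>e. P' e \<longleftrightarrow> sat E' \<phi> (weave e (j \<circ> s))))"

text \<open>The terms of the language are the variables and the parameters; a parameter \<open>c\<close> on the side of \<open>V\<close>
  becomes \<open>j c\<close> on the side of \<open>W\<close>.\<close>
definition coterm :: "('v \<Rightarrow> 'w) \<Rightarrow> ((nat \<Rightarrow> 'v) \<Rightarrow> 'v) \<Rightarrow> ((nat \<Rightarrow> 'w) \<Rightarrow> 'w) \<Rightarrow> bool" where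
  "coterm j t t' \<longleftrightarrow>
     (\<exists>i. t = (\<lambda>e. e i) \<and> t' = (\<lambda>e. e i)) \<or> (\<exists>c. t = (\<lambda>_. c) \<and> t' = (\<lambda>_. j c))"

named_theorems codef

lemma coterm_var [codef]: "coterm j (\<lambda>e. e i) (\<lambda>e. e i)"
  by (auto simp: coterm_def)

lemma coterm_const [codef]: "coterm j (\<lambda>_. c) (\<lambda>_. j c)"
  by (auto simp: coterm_def)

lemma codef_elementary:
  assumes "codefinable E E' j P P'" "elementary_embedding E E' j"
  shows "P e \<longleftrightarrow> P' (j \<circ> e)"
proof -
  from assms(1) obtain \<phi> s where 1: "\<And>e. P e \<longleftrightarrow> sat E \<phi> (weave e s)"
    and 2: "\<And>e. P' e \<longleftrightarrow> sat E' \<phi> (weave e (j \<circ> s))"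
    by (auto simp: codefinable_def)
  have "j \<circ> weave e s = weave (j \<circ> e) (j \<circ> s)" by (auto simp: weave_def)
  then show ?thesis
    using assms(2) by (simp add: 1 2 elementary_embedding_def)
qed

text \<open>The form in which elementarity is used: the two sides are closed statements with parameters.\<close>
lemma codef_closed:
  assumes "elementary_embedding E E' j" "codefinable E E' j (\<lambda>_. P) (\<lambda>_. P')"
  shows "P \<longleftrightarrow> P'"
  using codef_elementary[OF assms(2,1)] .

text \<open>Substitution of terms for the variables is a renaming of the formula, since substituted parameters
  can be added to the sequence of parameters. The versions with a fixed number of arguments below
  reduce the definability of a notion to the case where its arguments are distinct variables, so that
  \<open>intro codef\<close> can follow the syntax of its definition.\<close>
lemma codef_subst:
  assumes P: "codefinable E E' j P P'" and t: "\<And>n. coterm j (t n) (t' n)"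
  shows "codefinable E E' j (\<lambda>e. P (\<lambda>n. t n e)) (\<lambda>e. P' (\<lambda>n. t' n e))"
proof -
  from P obtain \<phi> s where 1: "\<And>e. P e \<longleftrightarrow> sat E \<phi> (weave e s)"
    and 2: "\<And>e. P' e \<longleftrightarrow> sat E' \<phi> (weave e (j \<circ> s))"
    by (auto simp: codefinable_def)
  have "\<exists>b i c. t n = (if b then (\<lambda>e. e i) else (\<lambda>_. c)) \<and>
      t' n = (if b then (\<lambda>e. e i) else (\<lambda>_. j c))" for n
  proof -
    from t[of n] consider i where "t n = (\<lambda>e. e i)" "t' n = (\<lambda>e. e i)"
      | c where "t n = (\<lambda>_. c)" "t' n = (\<lambda>_. j c)"
      by (auto simp: coterm_def)
    then show ?thesis
    proof cases
      case 1 then show ?thesis by (intro exI[of _ True]) auto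
    next
      case 2 then show ?thesis by (intro exI[of _ False]) auto
    qed
  qed
  then obtain b i c where t: "\<And>n. t n = (if b n then (\<lambda>e. e (i n)) else (\<lambda>_. c n))"
      "\<And>n. t' n = (if b n then (\<lambda>e. e (i n)) else (\<lambda>_. j (c n)))"
    by metis
  \<comment> \<open>An argument becomes a variable or one of the new parameters \<open>c\<close>; the old parameters \<open>s\<close> are at the
    even places of \<open>weave s c\<close>.\<close>
  let ?\<rho> = "\<lambda>m::nat. if even m then (if b (m div 2) then 2 * i (m div 2) else Suc (2 * Suc (2 * (m div 2))))
     else Suc (2 * (2 * (m div 2)))"
  have 3: "weave e (weave s c) \<circ> ?\<rho> = weave (\<lambda>n. t n e) s" for e
    by (rule weave_eqI) (simp_all add: weave_simps t)
  have 4: "weave e (j \<circ> weave s c) \<circ> ?\<rho> = weave (\<lambda>n. t' n e) (j \<circ> s)" for e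
    by (rule weave_eqI) (simp_all add: weave_simps t)
  show ?thesis
    unfolding codefinable_def
    by (intro exI[of _ "rename ?\<rho> \<phi>"] exI[of _ "weave s c"])
      (simp add: sat_rename 1 2 3 4)
qed

lemma codef_subst1:
  assumes "codefinable E E' j (\<lambda>e. P (e 0)) (\<lambda>e. P' (e 0))" "coterm j t t'"
  shows "codefinable E E' j (\<lambda>e. P (t e)) (\<lambda>e. P' (t' e))"
  using codef_subst[OF assms(1), of "\<lambda>_. t" "\<lambda>_. t'"] assms(2) by simp

lemma codef_subst2:
  assumes "codefinable E E' j (\<lambda>e. P (e 0) (e 1)) (\<lambda>e. P' (e 0) (e 1))" "coterm j t t'" "coterm j u u'"
  shows "codefinable E E' j (\<lambda>e. P (t e) (u e)) (\<lambda>e. P' (t' e) (u' e))"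
  using codef_subst[OF assms(1), of "\<lambda>n. if n = 0 then t else u" "\<lambda>n. if n = 0 then t' else u'"]
    assms(2,3) by simp

lemma codef_subst3:
  assumes "codefinable E E' j (\<lambda>e. P (e 0) (e 1) (e 2)) (\<lambda>e. P' (e 0) (e 1) (e 2))"
    "coterm j t t'" "coterm j u u'" "coterm j v v'"
  shows "codefinable E E' j (\<lambda>e. P (t e) (u e) (v e)) (\<lambda>e. P' (t' e) (u' e) (v' e))"
  using codef_subst[OF assms(1), of "\<lambda>n. if n = 0 then t else if n = 1 then u else v"
      "\<lambda>n. if n = 0 then t' else if n = 1 then u' else v'"]
    assms(2-) by simp

lemma codef_subst4:
  assumes "codefinable E E' j (\<lambda>e. P (e 0) (e 1) (e 2) (e 3)) (\<lambda>e. P' (e 0) (e 1) (e 2) (e 3))"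
    "coterm j t t'" "coterm j u u'" "coterm j v v'" "coterm j w w'"
  shows "codefinable E E' j (\<lambda>e. P (t e) (u e) (v e) (w e)) (\<lambda>e. P' (t' e) (u' e) (v' e) (w' e))"
  using codef_subst[OF assms(1), of "\<lambda>n. if n = 0 then t else if n = 1 then u else if n = 2 then v else w"
      "\<lambda>n. if n = 0 then t' else if n = 1 then u' else if n = 2 then v' else w'"]
    assms(2-) by simp

lemma codef_mem [codef]:
  assumes "coterm j t t'" "coterm j u u'"
  shows "codefinable E E' j (\<lambda>e. E (t e) (u e)) (\<lambda>e. E' (t' e) (u' e))"
proof (rule codef_subst2[OF _ assms])
  show "codefinable E E' j (\<lambda>e. E (e 0) (e 1)) (\<lambda>e. E' (e 0) (e 1))"
    unfolding codefinable_def by (intro exI[of _ "Mem 0 2"]) (simp add: weave_def)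
qed

lemma codef_eq [codef]:
  assumes "coterm j t t'" "coterm j u u'"
  shows "codefinable E E' j (\<lambda>e. t e = u e) (\<lambda>e. t' e = u' e)"
proof (rule codef_subst2[OF _ assms])
  show "codefinable E E' j (\<lambda>e. e 0 = e 1) (\<lambda>e. e 0 = e 1)"
    unfolding codefinable_def by (intro exI[of _ "Eq 0 2"]) (simp add: weave_def)
qed

lemma codef_not [codef]:
  assumes "codefinable E E' j P P'"
  shows "codefinable E E' j (\<lambda>e. \<not> P e) (\<lambda>e. \<not> P' e)"
proof -
  from assms obtain \<phi> s where "\<And>e. P e \<longleftrightarrow> sat E \<phi> (weave e s)"
    "\<And>e. P' e \<longleftrightarrow> sat E' \<phi> (weave e (j \<circ> s))"
    by (auto simp: codefinable_def)
  then show ?thesis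
    unfolding codefinable_def by (intro exI[of _ "Neg \<phi>"] exI[of _ s]) simp
qed

lemma codef_conj [codef]:
  assumes "codefinable E E' j P P'" "codefinable E E' j Q Q'"
  shows "codefinable E E' j (\<lambda>e. P e \<and> Q e) (\<lambda>e. P' e \<and> Q' e)"
proof -
  from assms(1) obtain \<phi> s where 1: "\<And>e. P e \<longleftrightarrow> sat E \<phi> (weave e s)"
    "\<And>e. P' e \<longleftrightarrow> sat E' \<phi> (weave e (j \<circ> s))"
    by (auto simp: codefinable_def)
  from assms(2) obtain \<psi> r where 2: "\<And>e. Q e \<longleftrightarrow> sat E \<psi> (weave e r)"
    "\<And>e. Q' e \<longleftrightarrow> sat E' \<psi> (weave e (j \<circ> r))"
    by (auto simp: codefinable_def)
  let ?a = "\<lambda>m::nat. if even m then m else Suc (2 * (2 * (m div 2)))"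
  let ?b = "\<lambda>m::nat. if even m then m else Suc (2 * Suc (2 * (m div 2)))"
  have 3: "weave e (weave s r) \<circ> ?a = weave e s" "weave e (weave s r) \<circ> ?b = weave e r"
    "weave e' (j \<circ> weave s r) \<circ> ?a = weave e' (j \<circ> s)"
    "weave e' (j \<circ> weave s r) \<circ> ?b = weave e' (j \<circ> r)" for e e'
    by (rule weave_eqI, simp_all add: weave_simps)+
  show ?thesis
    unfolding codefinable_def
    by (intro exI[of _ "Conj (rename ?a \<phi>) (rename ?b \<psi>)"] exI[of _ "weave s r"])
      (simp add: sat_rename 1 2 3)
qed

text \<open>The quantifier of the formula puts the new variable in front of the woven environment, the quantifier of
  the predicate puts it in front of the arguments before weaving; a renaming exchanges the two.\<close>
lemma codef_all [codef]:
  assumes "codefinable E E' j (\<lambda>e. P (e 0) (\<lambda>n. e (Suc n))) (\<lambda>e. P' (e 0) (\<lambda>n. e (Suc n)))"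
  shows "codefinable E E' j (\<lambda>e. \<forall>x. P x e) (\<lambda>e. \<forall>x. P' x e)"
proof -
  from assms obtain \<phi> s where 1: "\<And>e. P (e 0) (\<lambda>n. e (Suc n)) \<longleftrightarrow> sat E \<phi> (weave e s)"
    "\<And>e. P' (e 0) (\<lambda>n. e (Suc n)) \<longleftrightarrow> sat E' \<phi> (weave e (j \<circ> s))"
    by (auto simp: codefinable_def)
  let ?\<rho> = "\<lambda>m::nat. if m = 0 then 0 else if even m then m - 1 else Suc m"
  have 2: "case_nat x (weave e s) \<circ> ?\<rho> = weave (case_nat x e) s" for x e and s :: "nat \<Rightarrow> 'z"
  proof (rule weave_eqI)
    show "(case_nat x (weave e s) \<circ> ?\<rho>) (2 * n) = case_nat x e n" for n
      by (cases n) (simp_all add: weave_simps)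
  qed (simp add: weave_simps)
  have 3: "P x e \<longleftrightarrow> sat E \<phi> (weave (case_nat x e) s)" for x e
    using 1(1)[of "case_nat x e"] by simp
  have 4: "P' x e \<longleftrightarrow> sat E' \<phi> (weave (case_nat x e) (j \<circ> s))" for x e
    using 1(2)[of "case_nat x e"] by simp
  show ?thesis
    unfolding codefinable_def
    by (intro exI[of _ "All (rename ?\<rho> \<phi>)"] exI[of _ s])
      (simp add: sat_rename 2 3 4)
qed

lemma codef_disj [codef]:
  assumes "codefinable E E' j P P'" "codefinable E E' j Q Q'"
  shows "codefinable E E' j (\<lambda>e. P e \<or> Q e) (\<lambda>e. P' e \<or> Q' e)"
proof -
  have "codefinable E E' j (\<lambda>e. \<not> (\<not> P e \<and> \<not> Q e)) (\<lambda>e. \<not> (\<not> P' e \<and> \<not> Q' e))"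
    by (intro codef_not codef_conj assms)
  then show ?thesis by simp
qed

lemma codef_imp [codef]:
  assumes "codefinable E E' j P P'" "codefinable E E' j Q Q'"
  shows "codefinable E E' j (\<lambda>e. P e \<longrightarrow> Q e) (\<lambda>e. P' e \<longrightarrow> Q' e)"
  unfolding imp_conv_disj by (intro codef_not codef_disj assms)

lemma codef_iff [codef]:
  assumes "codefinable E E' j P P'" "codefinable E E' j Q Q'"
  shows "codefinable E E' j (\<lambda>e. P e \<longleftrightarrow> Q e) (\<lambda>e. P' e \<longleftrightarrow> Q' e)"
  unfolding iff_conv_conj_imp by (intro codef_imp codef_conj assms)

lemma codef_ex [codef]:
  assumes "codefinable E E' j (\<lambda>e. P (e 0) (\<lambda>n. e (Suc n))) (\<lambda>e. P' (e 0) (\<lambda>n. e (Suc n)))"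
  shows "codefinable E E' j (\<lambda>e. \<exists>x. P x e) (\<lambda>e. \<exists>x. P' x e)"
proof -
  have "codefinable E E' j (\<lambda>e. \<not> (\<forall>x. \<not> P x e)) (\<lambda>e. \<not> (\<forall>x. \<not> P' x e))"
    by (intro codef_not codef_all assms)
  then show ?thesis by simp
qed

lemma codef_ex1 [codef]:
  assumes "codefinable E E' j (\<lambda>e. P (e 0) (\<lambda>n. e (Suc n))) (\<lambda>e. P' (e 0) (\<lambda>n. e (Suc n)))"
    "codefinable E E' j (\<lambda>e. P (e 0) (\<lambda>n. e (Suc (Suc n)))) (\<lambda>e. P' (e 0) (\<lambda>n. e (Suc (Suc n))))"
  shows "codefinable E E' j (\<lambda>e. \<exists>!x. P x e) (\<lambda>e. \<exists>!x. P' x e)"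
  unfolding Ex1_def by (intro codef assms)

lemma codef_False [codef]: "codefinable E E' j (\<lambda>_. False) (\<lambda>_. False)"
  unfolding codefinable_def by (intro exI[of _ "Neg (Eq 0 0)"]) simp

text \<open>The first-order notions of the structure are codefinable with themselves.\<close>
lemma codef_is_upair [codef]:
  assumes "coterm j t t'" "coterm j u u'" "coterm j v v'"
  shows "codefinable E E' j (\<lambda>e. membership.is_upair E (t e) (u e) (v e))
    (\<lambda>e. membership.is_upair E' (t' e) (u' e) (v' e))"
  by (rule codef_subst3[OF _ assms]) (unfold membership.is_upair_def, intro codef)

lemma codef_is_pair [codef]:
  assumes "coterm j t t'" "coterm j u u'" "coterm j v v'"
  shows "codefinable E E' j (\<lambda>e. membership.is_pair E (t e) (u e) (v e))
    (\<lambda>e. membership.is_pair E' (t' e) (u' e) (v' e))"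
  by (rule codef_subst3[OF _ assms]) (unfold membership.is_pair_def, intro codef)

lemma codef_pair_in [codef]:
  assumes "coterm j t t'" "coterm j u u'" "coterm j v v'"
  shows "codefinable E E' j (\<lambda>e. membership.pair_in E (t e) (u e) (v e))
    (\<lambda>e. membership.pair_in E' (t' e) (u' e) (v' e))"
  by (rule codef_subst3[OF _ assms]) (unfold membership.pair_in_def, intro codef)

lemma codef_is_prod [codef]:
  assumes "coterm j t t'" "coterm j u u'" "coterm j v v'"
  shows "codefinable E E' j (\<lambda>e. membership.is_prod E (t e) (u e) (v e))
    (\<lambda>e. membership.is_prod E' (t' e) (u' e) (v' e))"
  by (rule codef_subst3[OF _ assms]) (unfold membership.is_prod_def, intro codef)

lemma codef_is_fun [codef]:
  assumes "coterm j t t'" "coterm j u u'"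
  shows "codefinable E E' j (\<lambda>e. membership.is_fun E (t e) (u e))
    (\<lambda>e. membership.is_fun E' (t' e) (u' e))"
  by (rule codef_subst2[OF _ assms]) (unfold membership.is_fun_def, intro codef)

lemma codef_transitive_set [codef]:
  assumes "coterm j t t'"
  shows "codefinable E E' j (\<lambda>e. membership.transitive_set E (t e))
    (\<lambda>e. membership.transitive_set E' (t' e))"
  by (rule codef_subst1[OF _ assms]) (unfold membership.transitive_set_def, intro codef)

section \<open>Models of ZFC under elementary embeddings\<close>

text \<open>An upper bound for the free variables, used to close formulas universally.\<close>
primrec bound :: "fm \<Rightarrow> nat" where
  "bound (Mem i k) = Suc (max i k)"
| "bound (Eq i k) = Suc (max i k)"
| "bound (Neg \<phi>) = bound \<phi>"
| "bound (Conj \<phi> \<psi>) = max (bound \<phi>) (bound \<psi>)"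
| "bound (All \<phi>) = bound \<phi>"

lemma sat_cong:
  assumes "\<forall>k < bound \<phi>. e k = e' k" shows "sat E \<phi> e \<longleftrightarrow> sat E \<phi> e'"
  using assms
proof (induction \<phi> arbitrary: e e')
  case (All \<phi>)
  have "sat E \<phi> (case_nat x e) = sat E \<phi> (case_nat x e')" for x
    by (rule All.IH) (use All.prems in \<open>auto split: nat.split\<close>)
  then show ?case by simp
next
  case (Conj \<phi> \<psi>)
  have "sat E \<phi> e = sat E \<phi> e'" by (rule Conj.IH(1)) (use Conj.prems in auto)
  moreover have "sat E \<psi> e = sat E \<psi> e'" by (rule Conj.IH(2)) (use Conj.prems in auto)
  ultimately show ?case by simp
qed simp_all

lemma sat_Alls:
  "sat E ((All ^^ n) \<phi>) e \<longleftrightarrow> (\<forall>xs. length xs = n \<longrightarrow> sat E \<phi> (\<lambda>k. if k < n then xs ! k else e (k - n)))"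
proof (induction n arbitrary: e)
  case (Suc n)
  have eq: "(\<lambda>k. if k < n then xs ! k else case_nat x e (k - n)) =
      (\<lambda>k. if k < Suc n then (xs @ [x]) ! k else e (k - Suc n))" if "length xs = n" for xs x
  proof
    fix k show "(if k < n then xs ! k else case_nat x e (k - n)) =
      (if k < Suc n then (xs @ [x]) ! k else e (k - Suc n))"
      using that by (cases "k < n"; cases "k - n") (auto simp: nth_append diff_Suc)
  qed
  have "sat E ((All ^^ Suc n) \<phi>) e \<longleftrightarrow> (\<forall>x xs. length xs = n \<longrightarrow>
       sat E \<phi> (\<lambda>k. if k < Suc n then (xs @ [x]) ! k else e (k - Suc n)))"
    using Suc eq by simp
  also have "\<dots> \<longleftrightarrow> (\<forall>xs. length xs = Suc n \<longrightarrow> sat E \<phi> (\<lambda>k. if k < Suc n then xs ! k else e (k - Suc n)))"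
  proof safe
    fix xs :: "'a list" assume "length xs = Suc n" and
      *: "\<forall>x xs. length xs = n \<longrightarrow> sat E \<phi> (\<lambda>k. if k < Suc n then (xs @ [x]) ! k else e (k - Suc n))"
    then obtain ys y where "xs = ys @ [y]" "length ys = n"
      by (cases xs rule: rev_cases) auto
    then show "sat E \<phi> (\<lambda>k. if k < Suc n then xs ! k else e (k - Suc n))" using * by blast
  qed simp
  finally show ?case .
qed simp

text \<open>Elementarity concerns assignments in the range of \<open>j\<close>. Validity under all assignments is
  nevertheless preserved, because it is the truth of the universal closure.\<close>
lemma sat_valid_transfer:
  assumes "elementary_embedding E E' j" "\<And>e. sat E \<phi> e"
  shows "sat E' \<phi> e'"
proof -
  let ?n = "bound \<phi>"
  have "sat E ((All ^^ ?n) \<phi>) (\<lambda>_. undefined)" by (simp add: sat_Alls assms(2))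
  then have "sat E' ((All ^^ ?n) \<phi>) (j \<circ> (\<lambda>_. undefined))"
    using assms(1) by (simp add: elementary_embedding_def)
  then have "sat E' \<phi> (\<lambda>k. if k < ?n then map e' [0..<?n] ! k else (j \<circ> (\<lambda>_. undefined)) (k - ?n))"
    unfolding sat_Alls by (rule allE[of _ "map e' [0..<?n]"]) simp
  then show ?thesis
    by (rule sat_cong[THEN iffD1, rotated]) auto
qed

definition ex_fm :: "fm \<Rightarrow> fm" where "ex_fm \<phi> = Neg (All (Neg \<phi>))"
definition imp_fm :: "fm \<Rightarrow> fm \<Rightarrow> fm" where "imp_fm \<phi> \<psi> = Neg (Conj \<phi> (Neg \<psi>))"
definition iff_fm :: "fm \<Rightarrow> fm \<Rightarrow> fm" where "iff_fm \<phi> \<psi> = Conj (imp_fm \<phi> \<psi>) (imp_fm \<psi> \<phi>)"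

lemma sat_connectives:
  "sat E (ex_fm \<phi>) e \<longleftrightarrow> (\<exists>x. sat E \<phi> (case_nat x e))"
  "sat E (imp_fm \<phi> \<psi>) e \<longleftrightarrow> (sat E \<phi> e \<longrightarrow> sat E \<psi> e)"
  "sat E (iff_fm \<phi> \<psi>) e \<longleftrightarrow> (sat E \<phi> e \<longleftrightarrow> sat E \<psi> e)"
  by (auto simp: ex_fm_def imp_fm_def iff_fm_def)

lemma env_comp:
  "e \<circ> case_nat i \<rho> = case_nat (e i) (e \<circ> \<rho>)"
  "case_nat w (case_nat z (case_nat y (case_nat x e))) \<circ> (\<lambda>k. k + 4) = e"
  "case_nat z (case_nat y (case_nat x e)) \<circ> (\<lambda>k. k + 3) = e"
proof -
  show "e \<circ> case_nat i \<rho> = case_nat (e i) (e \<circ> \<rho>)"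
  proof
    fix n show "(e \<circ> case_nat i \<rho>) n = case_nat (e i) (e \<circ> \<rho>) n" by (cases n) simp_all
  qed
qed (simp_all add: eval_nat_numeral comp_def)

lemma env_eq: "case_nat (e 0) (\<lambda>k. e (Suc k)) = e"
  by (rule ext) (simp split: nat.split)

text \<open>Every single instance of a schema is a formula. It is built explicitly, because its parameters are
  arbitrary elements of \<open>W\<close> and not only those in the range of \<open>j\<close>.\<close>
lemma separation_transfer:
  assumes el: "elementary_embedding E E' j" and sep: "membership.separation_ax E"
  shows "membership.separation_ax E'"
  unfolding membership.separation_ax_def
proof (intro allI)
  fix \<phi> and e :: "nat \<Rightarrow> 'b" and x
  let ?\<psi> = "ex_fm (All (iff_fm (Mem 0 1) (Conj (Mem 0 2) (rename (case_nat 0 (\<lambda>k. k + 3)) \<phi>))))"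
  have 1: "case_nat z (case_nat y (case_nat x e)) \<circ> case_nat 0 (\<lambda>k. k + 3) = case_nat z e"
    for x y z :: 'c and e
    unfolding env_comp by simp
  have *: "sat G ?\<psi> (case_nat x e) \<longleftrightarrow> (\<exists>y. \<forall>z. G z y \<longleftrightarrow> G z x \<and> sat G \<phi> (case_nat z e))"
    for G :: "'c \<Rightarrow> 'c \<Rightarrow> bool" and x e
    unfolding sat_connectives sat.simps sat_rename 1 by (simp add: numeral_eq_Suc)
  have "sat E ?\<psi> e" for e
    using *[of E "e 0" "\<lambda>k. e (Suc k)"] sep[unfolded membership.separation_ax_def]
    unfolding env_eq by blast
  from sat_valid_transfer[OF el this]
  have "sat E' ?\<psi> (case_nat x e)" .
  then show "\<exists>y. \<forall>z. E' z y \<longleftrightarrow> E' z x \<and> sat E' \<phi> (case_nat z e)" unfolding * .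
qed

lemma replacement_transfer:
  assumes el: "elementary_embedding E E' j" and rep: "membership.replacement_ax E"
  shows "membership.replacement_ax E'"
  unfolding membership.replacement_ax_def
proof (intro allI)
  fix \<phi> and e :: "nat \<Rightarrow> 'b" and x
  \<comment> \<open>Where \<open>?u\<close> is placed, the argument \<open>y\<close> is variable 0 and the set \<open>x\<close> is variable 1; each quantifier shifts them
    by one.\<close>
  let ?u = "ex_fm (Conj (rename (case_nat 1 (case_nat 0 (\<lambda>k. k + 3))) \<phi>)
       (All (imp_fm (rename (case_nat 2 (case_nat 0 (\<lambda>k. k + 4))) \<phi>) (Eq 0 1))))"
  let ?w = "ex_fm (All (iff_fm (Mem 0 1) (ex_fm (Conj (Mem 0 3)
       (rename (case_nat 0 (case_nat 1 (\<lambda>k. k + 4))) \<phi>)))))"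
  let ?\<psi> = "imp_fm (All (imp_fm (Mem 0 1) ?u)) ?w"
  have 1: "case_nat z (case_nat y (case_nat x e)) \<circ> case_nat 1 (case_nat 0 (\<lambda>k. k + 3)) = case_nat y (case_nat z e)"
    "case_nat w (case_nat z (case_nat y (case_nat x e))) \<circ> case_nat 2 (case_nat 0 (\<lambda>k. k + 4)) = case_nat y (case_nat w e)"
    "case_nat w (case_nat z (case_nat y (case_nat x e))) \<circ> case_nat 0 (case_nat 1 (\<lambda>k. k + 4)) = case_nat w (case_nat z e)"
    for w x y z :: 'c and e
    unfolding env_comp by (simp_all add: eval_nat_numeral)
  have 2: "sat G ?\<psi> (case_nat x e) \<longleftrightarrow>
     ((\<forall>y. G y x \<longrightarrow> (\<exists>!z. sat G \<phi> (case_nat y (case_nat z e)))) \<longrightarrow>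
        (\<exists>w. \<forall>z. G z w \<longleftrightarrow> (\<exists>y. G y x \<and> sat G \<phi> (case_nat y (case_nat z e)))))"
    for G :: "'c \<Rightarrow> 'c \<Rightarrow> bool" and x e
    unfolding sat_connectives sat.simps sat_rename 1 Ex1_def by (simp add: eval_nat_numeral)
  have "sat E ?\<psi> e" for e
    using 2[of E "e 0" "\<lambda>k. e (Suc k)"] rep[unfolded membership.replacement_ax_def]
    unfolding env_eq by blast
  from sat_valid_transfer[OF el this]
  have "sat E' ?\<psi> (case_nat x e)" .
  then show "(\<forall>y. E' y x \<longrightarrow> (\<exists>!z. sat E' \<phi> (case_nat y (case_nat z e)))) \<longrightarrow>
        (\<exists>w. \<forall>z. E' z w \<longleftrightarrow> (\<exists>y. E' y x \<and> sat E' \<phi> (case_nat y (case_nat z e))))"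
    unfolding 2 .
qed

lemma ZFC_transfer:
  assumes el: "elementary_embedding E E' j" and Z: "membership.ZFC E"
  shows "membership.ZFC E'"
proof -
  note defs = membership.extensionality_ax_def membership.foundation_ax_def membership.pairing_ax_def
    membership.union_ax_def membership.power_set_ax_def membership.infinity_ax_def membership.choice_ax_def
  have "membership.extensionality_ax E \<longleftrightarrow> membership.extensionality_ax E'"
    by (rule codef_closed[OF el]) (unfold defs, intro codef)
  moreover have "membership.foundation_ax E \<longleftrightarrow> membership.foundation_ax E'"
    by (rule codef_closed[OF el]) (unfold defs, intro codef)
  moreover have "membership.pairing_ax E \<longleftrightarrow> membership.pairing_ax E'"
    by (rule codef_closed[OF el]) (unfold defs, intro codef)
  moreover have "membership.union_ax E \<longleftrightarrow> membership.union_ax E'"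
    by (rule codef_closed[OF el]) (unfold defs, intro codef)
  moreover have "membership.power_set_ax E \<longleftrightarrow> membership.power_set_ax E'"
    by (rule codef_closed[OF el]) (unfold defs, intro codef)
  moreover have "membership.infinity_ax E \<longleftrightarrow> membership.infinity_ax E'"
    by (rule codef_closed[OF el]) (unfold defs, intro codef)
  moreover have "membership.choice_ax E \<longleftrightarrow> membership.choice_ax E'"
    by (rule codef_closed[OF el]) (unfold defs, intro codef)
  ultimately show ?thesis
    using Z separation_transfer[OF el] replacement_transfer[OF el] by (simp add: membership.ZFC_def)
qed

section \<open>Sets and classes of a model of ZFC\<close>

locale zfc_model = membership mem for mem :: "'a \<Rightarrow> 'a \<Rightarrow> bool" (infix "\<epsilon>" 50) +
  assumes ZFC: ZFC
begin

abbreviation definable :: "((nat \<Rightarrow> 'a) \<Rightarrow> bool) \<Rightarrow> bool" where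
  "definable P \<equiv> codefinable mem mem (\<lambda>x. x) P P"

text \<open>The classes that are coded by an element of the model.\<close>
definition small :: "'a set \<Rightarrow> bool" where
  "small S \<longleftrightarrow> (\<exists>x. elts x = S)"

lemma small_elts: "small (elts x)" by (auto simp: small_def)

lemma elts_iff: "y \<in> elts x \<longleftrightarrow> y \<epsilon> x" by (simp add: elts_def)

lemma smallE:
  assumes "small S" obtains x where "elts x = S" "\<And>z. z \<epsilon> x \<longleftrightarrow> z \<in> S"
  using assms by (auto simp: small_def elts_def)

lemma smallI: "(\<And>z. z \<epsilon> y \<longleftrightarrow> P z) \<Longrightarrow> small {z. P z}"
  unfolding small_def elts_def by blast

lemma extensionality: "(\<And>z. z \<epsilon> x \<longleftrightarrow> z \<epsilon> y) \<Longrightarrow> x = y"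
  using ZFC by (auto simp: ZFC_def extensionality_ax_def)

lemma separation:
  assumes "definable (\<lambda>e. P (e 0))"
  shows "small {z. z \<epsilon> x \<and> P z}"
proof -
  from assms obtain \<phi> s where 1: "\<And>e. P (e 0) \<longleftrightarrow> sat mem \<phi> (weave e s)"
    by (auto simp: codefinable_def)
  let ?\<rho> = "\<lambda>m::nat. if even m then 0 else Suc (m div 2)"
  have 2: "case_nat z s \<circ> ?\<rho> = weave (\<lambda>_. z) s" for z
    by (rule weave_eqI) simp_all
  have "P z \<longleftrightarrow> sat mem (rename ?\<rho> \<phi>) (case_nat z s)" for z
    using 1[of "\<lambda>_. z"] by (simp add: sat_rename 2)
  moreover have "\<exists>y. \<forall>z. z \<epsilon> y \<longleftrightarrow> z \<epsilon> x \<and> sat mem (rename ?\<rho> \<phi>) (case_nat z s)"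
    using ZFC unfolding ZFC_def separation_ax_def by blast
  ultimately obtain y where "\<And>z. z \<epsilon> y \<longleftrightarrow> z \<epsilon> x \<and> P z" by blast
  then show ?thesis by (rule smallI)
qed

lemma smallD: "small {z. P z} \<Longrightarrow> \<exists>y. \<forall>z. z \<epsilon> y \<longleftrightarrow> P z"
  unfolding small_def elts_def by blast

lemma replacement:
  assumes def: "definable (\<lambda>e. P (e 0) (e 1))"
    and fn: "\<And>y z z'. y \<epsilon> x \<Longrightarrow> P y z \<Longrightarrow> P y z' \<Longrightarrow> z = z'"
  shows "small {z. \<exists>y. y \<epsilon> x \<and> P y z}"
proof -
  from def obtain \<phi> s where 1: "\<And>e. P (e 0) (e 1) \<longleftrightarrow> sat mem \<phi> (weave e s)"
    by (auto simp: codefinable_def)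
  let ?\<rho> = "\<lambda>m::nat. if even m then (if m = 0 then 0 else 1) else Suc (Suc (m div 2))"
  have 2: "case_nat y (case_nat z s) \<circ> ?\<rho> = weave (\<lambda>n. if n = 0 then y else z) s" for y z
    by (rule weave_eqI) simp_all
  have P: "P y z \<longleftrightarrow> sat mem (rename ?\<rho> \<phi>) (case_nat y (case_nat z s))" for y z
    using 1[of "\<lambda>n. if n = 0 then y else z"] by (simp add: sat_rename 2)
  have "definable (\<lambda>e. \<exists>z. P (e 0) z)"
    by (intro codef codef_subst2[OF def])
  then obtain x' where x': "elts x' = {y. y \<epsilon> x \<and> (\<exists>z. P y z)}"
    using separation[of "\<lambda>y. \<exists>z. P y z" x] by (auto simp: small_def)
  have "\<forall>y. y \<epsilon> x' \<longrightarrow> (\<exists>!z. P y z)"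
    using x' fn unfolding elts_def by blast
  then have "\<exists>w. \<forall>z. z \<epsilon> w \<longleftrightarrow> (\<exists>y. y \<epsilon> x' \<and> P y z)"
    using ZFC unfolding ZFC_def replacement_ax_def P by blast
  then obtain w where "\<And>z. z \<epsilon> w \<longleftrightarrow> (\<exists>y. y \<epsilon> x' \<and> P y z)" by blast
  moreover have "y \<epsilon> x' \<longleftrightarrow> y \<epsilon> x \<and> (\<exists>z. P y z)" for y
    using x' unfolding elts_def by blast
  ultimately have "z \<epsilon> w \<longleftrightarrow> (\<exists>y. y \<epsilon> x \<and> P y z)" for z by blast
  then show ?thesis by (rule smallI)
qed

lemma small_subset:
  assumes "S \<subseteq> elts x" "definable (\<lambda>e. e 0 \<in> S)"
  shows "small S"
proof -
  have "{z. z \<epsilon> x \<and> z \<in> S} = S" using assms(1) by (auto simp: elts_def)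
  then show ?thesis using separation[OF assms(2), of x] by simp
qed

lemma small_doubleton: "small {x, y}"
proof -
  obtain z where "is_upair x y z" using ZFC by (auto simp: ZFC_def pairing_ax_def)
  then have "elts z = {x, y}" by (auto simp: is_upair_def elts_def)
  then show ?thesis by (auto simp: small_def)
qed

lemma small_Union: "small {z. \<exists>y. y \<epsilon> x \<and> z \<epsilon> y}"
proof -
  have union_ax using ZFC by (simp add: ZFC_def)
  then obtain u where "\<And>z. z \<epsilon> u \<longleftrightarrow> (\<exists>y. y \<epsilon> x \<and> z \<epsilon> y)" unfolding union_ax_def by metis
  then show ?thesis by (rule smallI)
qed

lemma small_Pow: "small {z. elts z \<subseteq> elts x}"
proof -
  have power_set_ax using ZFC by (simp add: ZFC_def)
  then obtain u where "\<And>z. z \<epsilon> u \<longleftrightarrow> (\<forall>w. w \<epsilon> z \<longrightarrow> w \<epsilon> x)" unfolding power_set_ax_def by metis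
  then have "z \<epsilon> u \<longleftrightarrow> elts z \<subseteq> elts x" for z unfolding elts_def by blast
  then show ?thesis by (rule smallI)
qed

lemma small_Un:
  assumes "small S" "small T" shows "small (S \<union> T)"
proof -
  obtain x y where xy: "\<And>z. z \<epsilon> x \<longleftrightarrow> z \<in> S" "\<And>z. z \<epsilon> y \<longleftrightarrow> z \<in> T" using assms by (metis smallE)
  obtain p where p: "\<And>z. z \<epsilon> p \<longleftrightarrow> z \<in> {x, y}" using small_doubleton[of x y] by (metis smallE)
  have "(\<exists>y. y \<epsilon> p \<and> z \<epsilon> y) \<longleftrightarrow> z \<in> S \<union> T" for z
    unfolding p using xy[of z] by auto
  then have "{z. \<exists>y. y \<epsilon> p \<and> z \<epsilon> y} = S \<union> T" by blast
  then show ?thesis using small_Union[of p] by simp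
qed

lemma small_singleton: "small {x}"
  using small_doubleton[of x x] by simp

lemma small_insert: "small S \<Longrightarrow> small (insert x S)"
  using small_Un[OF small_singleton[of x]] by simp

lemma adjoin: "\<exists>t. \<forall>z. z \<epsilon> t \<longleftrightarrow> z = x \<or> z \<epsilon> y"
proof -
  obtain t where "\<And>z. z \<epsilon> t \<longleftrightarrow> z \<in> insert x (elts y)"
    using small_insert[OF small_elts[of y], of x] smallE by metis
  then show ?thesis by (auto simp: elts_iff)
qed

section \<open>Ordered pairs and functions\<close>

lemma is_upair_unique: "is_upair x y z \<Longrightarrow> is_upair x y z' \<Longrightarrow> z = z'"
  by (rule extensionality) (auto simp: is_upair_def)

lemma is_upair_exists: "\<exists>z. is_upair x y z"
  using ZFC by (auto simp: ZFC_def pairing_ax_def)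

lemma is_pair_unique: "is_pair x y p \<Longrightarrow> is_pair x y q \<Longrightarrow> p = q"
  unfolding is_pair_def using is_upair_unique by metis

lemma is_pair_opair: "is_pair x y (opair x y)"
proof -
  have "\<exists>p. is_pair x y p" unfolding is_pair_def using is_upair_exists by metis
  then show ?thesis unfolding opair_def
    by (metis is_pair_unique theI)
qed

lemma is_pair_iff: "is_pair x y p \<longleftrightarrow> p = opair x y"
  using is_pair_opair is_pair_unique by metis

lemma is_upair_inject: "is_upair x y z \<Longrightarrow> is_upair a b z \<Longrightarrow> (x = a \<and> y = b) \<or> (x = b \<and> y = a)"
  unfolding is_upair_def by metis

lemma opair_inject: "opair x y = opair a b \<longleftrightarrow> x = a \<and> y = b"
proof
  assume eq: "opair x y = opair a b"
  have "is_pair x y (opair x y)" "is_pair a b (opair x y)"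
    using is_pair_opair[of x y] is_pair_opair[of a b] eq by auto
  then obtain u v u' v' where *: "is_upair x x u" "is_upair x y v" "is_upair u v (opair x y)"
    "is_upair a a u'" "is_upair a b v'" "is_upair u' v' (opair x y)"
    unfolding is_pair_def by blast
  then have uv: "(u = u' \<and> v = v') \<or> (u = v' \<and> v = u')" using is_upair_inject by blast
  then show "x = a \<and> y = b"
  proof
    assume "u = u' \<and> v = v'" with * show ?thesis using is_upair_inject by metis
  next
    assume "u = v' \<and> v = u'" with * show ?thesis using is_upair_inject by metis
  qed
qed simp

lemma pair_in_iff: "pair_in x y r \<longleftrightarrow> opair x y \<epsilon> r"
  by (auto simp: pair_in_def is_pair_iff)

lemma pair_components:
  "\<exists>u v. u \<epsilon> opair x y \<and> x \<epsilon> u \<and> v \<epsilon> opair x y \<and> y \<epsilon> v"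
  proof -
  obtain u v where "is_upair x x u" "is_upair x y v" "is_upair u v (opair x y)"
    using is_pair_opair[of x y] unfolding is_pair_def by blast
  then show ?thesis unfolding is_upair_def by blast
qed

lemma small_UNION2: "small {z. \<exists>p u. p \<epsilon> r \<and> u \<epsilon> p \<and> z \<epsilon> u}"
proof -
  obtain s where s: "\<And>u. u \<epsilon> s \<longleftrightarrow> (\<exists>p. p \<epsilon> r \<and> u \<epsilon> p)" using smallD[OF small_Union[of r]] by blast
  have "{z. \<exists>u. u \<epsilon> s \<and> z \<epsilon> u} = {z. \<exists>p u. p \<epsilon> r \<and> u \<epsilon> p \<and> z \<epsilon> u}" using s by auto
  then show ?thesis using small_Union[of s] by simp
qed

text \<open>Every definable class of components of the pairs in a given element is small: the components lie two
  levels below the pairs.\<close>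
lemma small_field:
  assumes "S \<subseteq> {x. \<exists>y. pair_in x y r \<or> pair_in y x r}" "definable (\<lambda>e. e 0 \<in> S)"
  shows "small S"
proof -
  obtain s where s: "elts s = {z. \<exists>p u. p \<epsilon> r \<and> u \<epsilon> p \<and> z \<epsilon> u}"
    by (rule smallE[OF small_UNION2[of r]])
  show ?thesis
  proof (rule small_subset[OF _ assms(2)])
    show "S \<subseteq> elts s"
    proof
      fix x assume "x \<in> S"
      then obtain y where "opair x y \<epsilon> r \<or> opair y x \<epsilon> r" using assms(1) unfolding pair_in_iff by blast
      then show "x \<in> elts s" unfolding s using pair_components[of x y] pair_components[of y x] by blast
    qed
  qed
qed

lemma prod_exists: "\<exists>D. is_prod X Y D"
proof -
  obtain XY where XY: "elts XY = elts X \<union> elts Y" by (rule smallE[OF small_Un[OF small_elts[of X] small_elts[of Y]]])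
  obtain P where P: "elts P = {z. elts z \<subseteq> elts XY}" by (rule smallE[OF small_Pow])
  obtain Q where Q: "elts Q = {z. elts z \<subseteq> elts P}" by (rule smallE[OF small_Pow])
  let ?S = "{p. \<exists>x y. x \<epsilon> X \<and> y \<epsilon> Y \<and> is_pair x y p}"
  have "small ?S"
  proof (rule small_subset)
    show "?S \<subseteq> elts Q"
    proof
      fix p assume "p \<in> ?S"
      then obtain x y u v where 1: "x \<epsilon> X" "y \<epsilon> Y" "is_upair x x u" "is_upair x y v" "is_upair u v p"
        unfolding is_pair_def by blast
      then have "elts u \<subseteq> elts XY" "elts v \<subseteq> elts XY" unfolding XY is_upair_def by (auto simp: elts_def)
      then have "elts p \<subseteq> elts P" using 1(5) unfolding P using 1(5) by (auto simp: elts_def is_upair_def)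
      then show "p \<in> elts Q" unfolding Q by simp
    qed
    show "definable (\<lambda>e. e 0 \<in> ?S)" unfolding mem_Collect_eq by (intro codef)
  qed
  then show ?thesis unfolding is_prod_def by (rule smallD)
qed

lemma app_eq:
  assumes "is_fun f A" "x \<epsilon> A" shows "pair_in x y f \<longleftrightarrow> app f x = y"
proof -
  have ex1: "\<exists>!y. pair_in x y f" using assms unfolding is_fun_def by blast
  have "pair_in x (app f x) f" unfolding app_def by (rule theI'[OF ex1])
  then show ?thesis using ex1 by blast
qed

lemma pair_in_app: "is_fun f A \<Longrightarrow> x \<epsilon> A \<Longrightarrow> pair_in x (app f x) f"
  using app_eq by blast

lemma is_fun_dom: "is_fun f A \<Longrightarrow> pair_in x y f \<Longrightarrow> x \<epsilon> A"
  unfolding is_fun_def pair_in_iff is_pair_iff by (metis opair_inject)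

section \<open>Recursion and induction inside a model\<close>

text \<open>Well-foundedness in the sense of the model: only elements of the model are tested.\<close>
definition founded_on :: "'a \<Rightarrow> ('a \<Rightarrow> 'a \<Rightarrow> bool) \<Rightarrow> bool" where
  "founded_on X R \<longleftrightarrow> (\<forall>S. (\<exists>x. x \<epsilon> S) \<and> (\<forall>x. x \<epsilon> S \<longrightarrow> x \<epsilon> X) \<longrightarrow>
     (\<exists>m. m \<epsilon> S \<and> (\<forall>y. y \<epsilon> S \<longrightarrow> \<not> R y m)))"

lemma founded_induct:
  assumes wf: "founded_on X R" and def: "definable (\<lambda>e. P (e 0))"
    and step: "\<And>x. x \<epsilon> X \<Longrightarrow> (\<And>y. y \<epsilon> X \<Longrightarrow> R y x \<Longrightarrow> P y) \<Longrightarrow> P x"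
    and x: "x \<epsilon> X"
  shows "P x"
proof (rule ccontr)
  assume "\<not> P x"
  have "definable (\<lambda>e. \<not> P (e 0))" by (intro codef def)
  then obtain S where S: "\<And>z. z \<epsilon> S \<longleftrightarrow> z \<epsilon> X \<and> \<not> P z"
    using smallD[OF separation[of "\<lambda>z. \<not> P z" X]] by blast
  then obtain m where "m \<epsilon> S" "\<And>y. y \<epsilon> S \<Longrightarrow> \<not> R y m"
    using wf x \<open>\<not> P x\<close> unfolding founded_on_def by metis
  then show False using step[of m] S by blast
qed

text \<open>Well-founded recursion inside the model. The step \<open>H x g y\<close> says that \<open>y\<close> is the value at \<open>x\<close> determined
  by the function \<open>g\<close>, of which it may use only the values at predecessors of \<open>x\<close>. The solution is the
  union of all partial solutions whose domain is closed under predecessors. These agree with each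
  other by induction, so the union is a set by replacement; and it is total, because a least missing
  argument could be added.\<close>
theorem recursion:
  assumes wf: "founded_on X R" and R: "definable (\<lambda>e. R (e 0) (e 1))"
    and H: "definable (\<lambda>e. H (e 0) (e 1) (e 2))"
    and total: "\<And>x g. x \<epsilon> X \<Longrightarrow> \<exists>!y. H x g y"
    and local: "\<And>x g g' y. x \<epsilon> X \<Longrightarrow> (\<And>z u. z \<epsilon> X \<Longrightarrow> R z x \<Longrightarrow> pair_in z u g \<longleftrightarrow> pair_in z u g') \<Longrightarrow>
      H x g y \<Longrightarrow> H x g' y"
  shows "\<exists>g. is_fun g X \<and> (\<forall>x y. pair_in x y g \<longrightarrow> H x g y)"
proof -
  define approx where "approx g \<longleftrightarrow> (\<forall>p. p \<epsilon> g \<longrightarrow> (\<exists>x y. x \<epsilon> X \<and> is_pair x y p)) \<and>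
    (\<forall>x y y'. pair_in x y g \<and> pair_in x y' g \<longrightarrow> y = y') \<and>
    (\<forall>x y. pair_in x y g \<longrightarrow> H x g y \<and> (\<forall>z. z \<epsilon> X \<and> R z x \<longrightarrow> (\<exists>u. pair_in z u g)))" for g
  have def_approx: "definable (\<lambda>e. approx (e 0))"
    unfolding approx_def by (intro codef codef_subst2[OF R] codef_subst3[OF H])
  have in_X: "x \<epsilon> X" if "approx g" "pair_in x y g" for g x y
    using that unfolding approx_def pair_in_iff is_pair_iff by (metis opair_inject)
  have compat: "\<forall>y y'. pair_in x y g \<and> pair_in x y' g' \<longrightarrow> y = y'"
    if g: "approx g" "approx g'" and "x \<epsilon> X" for g g' x
  proof (rule founded_induct[where P = "\<lambda>x. \<forall>y y'. pair_in x y g \<and> pair_in x y' g' \<longrightarrow> y = y'", OF wf _ _ \<open>x \<epsilon> X\<close>])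
    show "definable (\<lambda>e. \<forall>y y'. pair_in (e 0) y g \<and> pair_in (e 0) y' g' \<longrightarrow> y = y')"
      by (intro codef)
    fix x assume x: "x \<epsilon> X" and IH: "\<And>z. z \<epsilon> X \<Longrightarrow> R z x \<Longrightarrow> \<forall>y y'. pair_in z y g \<and> pair_in z y' g' \<longrightarrow> y = y'"
    show "\<forall>y y'. pair_in x y g \<and> pair_in x y' g' \<longrightarrow> y = y'"
    proof (intro allI impI)
      fix y y' assume y: "pair_in x y g \<and> pair_in x y' g'"
      have "pair_in z u g \<longleftrightarrow> pair_in z u g'" if z: "z \<epsilon> X" "R z x" for z u
      proof -
        obtain u1 u2 where "pair_in z u1 g" "pair_in z u2 g'"
          using y z g unfolding approx_def by blast
        then show ?thesis using IH[OF z] g unfolding approx_def by blast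
      qed
      moreover have "H x g y" "H x g' y'" using y g unfolding approx_def by blast+
      ultimately have "H x g' y" using local[OF x] by blast
      with \<open>H x g' y'\<close> show "y = y'" using total[OF x] by blast
    qed
  qed
  define val where "val x y \<longleftrightarrow> (\<exists>g. approx g \<and> pair_in x y g)" for x y
  have valI: "val x y" if "approx g" "pair_in x y g" for x y g using that unfolding val_def by blast
  have def_val: "definable (\<lambda>e. val (e 0) (e 1))"
    unfolding val_def by (intro codef codef_subst1[OF def_approx])
  have val_unique: "y = y'" if "val x y" "val x y'" for x y y'
    using that compat in_X unfolding val_def by blast
  have "small {p. \<exists>x. x \<epsilon> X \<and> (\<exists>y. val x y \<and> is_pair x y p)}"
    by (rule replacement) (intro codef codef_subst2[OF def_val], metis val_unique is_pair_unique)
  then obtain G where G: "\<And>p. p \<epsilon> G \<longleftrightarrow> (\<exists>x. x \<epsilon> X \<and> (\<exists>y. val x y \<and> is_pair x y p))"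
    using smallD by blast
  have G_val: "pair_in x y G \<longleftrightarrow> val x y" for x y
    unfolding pair_in_iff G is_pair_iff opair_inject using in_X val_def by blast
  have G_H: "H x G y \<and> (\<forall>z. z \<epsilon> X \<and> R z x \<longrightarrow> (\<exists>u. val z u))" if v: "val x y" for x y
  proof -
    obtain g where g: "approx g" "pair_in x y g" using v unfolding val_def by blast
    have "pair_in z u g \<longleftrightarrow> pair_in z u G" if z: "z \<epsilon> X" "R z x" for z u
    proof -
      obtain u' where u': "pair_in z u' g" using g z unfolding approx_def by blast
      show ?thesis
      proof
        assume "pair_in z u g" then show "pair_in z u G" unfolding G_val by (rule valI[OF g(1)])
      next
        assume "pair_in z u G" then have "u = u'" unfolding G_val using val_unique valI[OF g(1) u'] by blast
        with u' show "pair_in z u g" by simp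
      qed
    qed
    moreover have "H x g y" using g unfolding approx_def by blast
    ultimately have "H x G y" using local[OF in_X[OF g]] by blast
    moreover have "\<exists>u. val z u" if z: "z \<epsilon> X" "R z x" for z
    proof -
      obtain u where "pair_in z u g" using g z unfolding approx_def by blast
      then show ?thesis using valI[OF g(1)] by blast
    qed
    ultimately show ?thesis by blast
  qed
  have "\<exists>y. val x y" if "x \<epsilon> X" for x
  proof (rule founded_induct[where P = "\<lambda>x. \<exists>y. val x y", OF wf _ _ that])
    show "definable (\<lambda>e. \<exists>y. val (e 0) y)" by (intro codef codef_subst2[OF def_val])
    fix x assume x: "x \<epsilon> X" and IH: "\<And>z. z \<epsilon> X \<Longrightarrow> R z x \<Longrightarrow> \<exists>y. val z y"
    show "\<exists>y. val x y"
    proof (rule ccontr)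
      assume no: "\<nexists>y. val x y"
      obtain y where y: "H x G y" using total[OF x] by blast
      \<comment> \<open>All predecessors of \<open>x\<close> are in the domain of \<open>G\<close> and \<open>x\<close> is not, so adding a value at \<open>x\<close> changes
        nothing that the step uses.\<close>
      obtain G' where G': "\<And>p. p \<epsilon> G' \<longleftrightarrow> p = opair x y \<or> p \<epsilon> G"
        using adjoin[of "opair x y" G] by blast
      have G'_val: "pair_in a b G' \<longleftrightarrow> (a = x \<and> b = y) \<or> val a b" for a b
        using G_val unfolding pair_in_iff G' opair_inject by blast
      have agree: "pair_in z u G \<longleftrightarrow> pair_in z u G'" if "\<exists>v. val z v" for z u
        using that no unfolding G_val G'_val by blast
      have "approx G'"
        unfolding approx_def
      proof (intro conjI allI impI)
        fix p assume "p \<epsilon> G'" then show "\<exists>x y. x \<epsilon> X \<and> is_pair x y p"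
          unfolding G' G using x is_pair_opair by blast
      next
        fix a b b' assume "pair_in a b G' \<and> pair_in a b' G'"
        then show "b = b'" unfolding G'_val using no val_unique by blast
      next
        fix a b assume "pair_in a b G'"
        then consider "a = x" "b = y" | "val a b" unfolding G'_val by blast
        then show "H a G' b"
        proof cases
          case 1 then show ?thesis using local[OF x _ y] agree IH by blast
        next
          case 2
          then have "a \<epsilon> X" using in_X unfolding val_def by blast
          then show ?thesis using local[OF _ _ G_H[OF 2, THEN conjunct1]] agree G_H[OF 2] by blast
        qed
      next
        fix a b z assume "pair_in a b G'" "z \<epsilon> X \<and> R z a"
        then show "\<exists>u. pair_in z u G'" unfolding G'_val using IH G_H by blast
      qed
      then have "val x y" by (rule valI) (simp add: G'_val)
      then show False using no by blast
    qed
  qed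
  then have "is_fun G X" unfolding is_fun_def G_val using G val_unique by blast
  moreover have "\<forall>x y. pair_in x y G \<longrightarrow> H x G y" using G_val G_H by blast
  ultimately show ?thesis by blast
qed

lemma founded_on_mem: "founded_on X (\<epsilon>)"
  using ZFC unfolding founded_on_def ZFC_def foundation_ax_def by blast

text \<open>The sets below \<open>x\<close> are collected in stages indexed by a set \<open>I\<close> that is closed under successor. Stage \<open>n\<close> consists
  of \<open>x\<close> and of all members of elements of the stages \<open>m \<in> n\<close>, so members of elements of stage \<open>n\<close> are in the stage
  of the successor of \<open>n\<close>, and the union of the stages is transitive.\<close>
lemma transitive_closure_exists: "\<exists>T. transitive_set T \<and> x \<epsilon> T"
proof -
  obtain I z0 where z0: "z0 \<epsilon> I" and I: "\<And>y. y \<epsilon> I \<Longrightarrow> \<exists>s. s \<epsilon> I \<and> (\<forall>w. w \<epsilon> s \<longleftrightarrow> w \<epsilon> y \<or> w = y)"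
    using ZFC unfolding ZFC_def infinity_ax_def by blast
  define H where "H n g y \<longleftrightarrow> (\<forall>z. z \<epsilon> y \<longleftrightarrow> z = x \<or> (\<exists>m u w. m \<epsilon> n \<and> m \<epsilon> I \<and> pair_in m u g \<and> w \<epsilon> u \<and> z \<epsilon> w))" for n g y
  have "\<exists>g. is_fun g I \<and> (\<forall>x y. pair_in x y g \<longrightarrow> H x g y)"
  proof (rule recursion[where R = "(\<epsilon>)"])
    show "founded_on I (\<epsilon>)" by (rule founded_on_mem)
    show "definable (\<lambda>e. e 0 \<epsilon> e 1)" by (intro codef)
    show "definable (\<lambda>e. H (e 0) (e 1) (e 2))" unfolding H_def by (intro codef)
    show "\<exists>!y. H n g y" for n g
    proof -
      have "small {u. \<exists>m. m \<epsilon> n \<and> m \<epsilon> I \<and> pair_in m u g}"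
        by (rule small_field[of _ g]) (blast, unfold mem_Collect_eq, intro codef)
      then obtain s where s: "\<And>u. u \<epsilon> s \<longleftrightarrow> (\<exists>m. m \<epsilon> n \<and> m \<epsilon> I \<and> pair_in m u g)"
        using smallD by blast
      obtain y0 where y0: "\<And>z. z \<epsilon> y0 \<longleftrightarrow> (\<exists>p u. p \<epsilon> s \<and> u \<epsilon> p \<and> z \<epsilon> u)"
        using smallD[OF small_UNION2[of s]] by blast
      obtain y where y: "\<And>z. z \<epsilon> y \<longleftrightarrow> z = x \<or> z \<epsilon> y0" using adjoin by blast
      have "H n g y" unfolding H_def y y0 s by blast
      moreover have "y = y'" if "H n g y" "H n g y'" for y y'
        by (rule extensionality) (use that H_def in blast)
      ultimately show ?thesis by blast
    qed
    show "H n g' y" if "n \<epsilon> I" "\<And>z u. z \<epsilon> I \<Longrightarrow> z \<epsilon> n \<Longrightarrow> pair_in z u g \<longleftrightarrow> pair_in z u g'" "H n g y" for n g g' y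
      using that unfolding H_def by blast
  qed
  then obtain g where g: "is_fun g I" and Hg: "\<And>n y. pair_in n y g \<Longrightarrow> H n g y" by blast
  have "small {y. \<exists>n. n \<epsilon> I \<and> pair_in n y g}"
    by (rule small_field[of _ g]) (blast, unfold mem_Collect_eq, intro codef)
  then obtain s where s: "\<And>u. u \<epsilon> s \<longleftrightarrow> (\<exists>m. m \<epsilon> I \<and> pair_in m u g)"
    using smallD by blast
  obtain T where T: "\<And>z. z \<epsilon> T \<longleftrightarrow> (\<exists>u. u \<epsilon> s \<and> z \<epsilon> u)"
    using smallD[OF small_Union[of s]] by blast
  have T: "z \<epsilon> T \<longleftrightarrow> (\<exists>n y. n \<epsilon> I \<and> pair_in n y g \<and> z \<epsilon> y)" for z
    using T s by blast
  have "x \<epsilon> T" unfolding T using g z0 Hg unfolding is_fun_def H_def by blast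
  moreover have "transitive_set T"
    unfolding transitive_set_def
  proof (intro allI impI)
    fix a b assume "a \<epsilon> T \<and> b \<epsilon> a"
    then obtain n y where n: "n \<epsilon> I" "pair_in n y g" "a \<epsilon> y" "b \<epsilon> a" unfolding T by blast
    obtain m where m: "m \<epsilon> I" "n \<epsilon> m" using I[OF n(1)] by blast
    obtain y' where y': "pair_in m y' g" using g m unfolding is_fun_def by blast
    then have "b \<epsilon> y'" using Hg[OF y'] n m unfolding H_def by blast
    then show "b \<epsilon> T" unfolding T using m y' by blast
  qed
  ultimately show ?thesis by blast
qed

text \<open>Foundation speaks of sets; transitive closures extend it to definable classes.\<close>
lemma mem_induct:
  assumes def: "definable (\<lambda>e. P (e 0))" and step: "\<And>x. (\<And>y. y \<epsilon> x \<Longrightarrow> P y) \<Longrightarrow> P x"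
  shows "P x"
proof -
  obtain T where T: "transitive_set T" "x \<epsilon> T" using transitive_closure_exists by blast
  show ?thesis
  proof (rule founded_induct[where P = P, OF founded_on_mem def _ T(2)])
    show "P x" if "x \<epsilon> T" "\<And>y. y \<epsilon> T \<Longrightarrow> y \<epsilon> x \<Longrightarrow> P y" for x
      using that step T(1) unfolding transitive_set_def by blast
  qed
qed

text \<open>The names in the domain of a name lie three levels below it, as \<open>\<eta> \<in> {\<eta>} \<in> \<langle>\<eta>, b\<rangle> \<in> \<tau>\<close>. The
  induction is carried along these levels.\<close>
lemma dom_induct:
  assumes def: "definable (\<lambda>e. P (e 0))" and step: "\<And>x. (\<And>y b. pair_in y b x \<Longrightarrow> P y) \<Longrightarrow> P x"
  shows "P x"
proof -
  have "P x \<and> (\<forall>y. y \<epsilon> x \<longrightarrow> P y) \<and> (\<forall>y z. y \<epsilon> x \<and> z \<epsilon> y \<longrightarrow> P z)"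
  proof (rule mem_induct[where P = "\<lambda>x. P x \<and> (\<forall>y. y \<epsilon> x \<longrightarrow> P y) \<and> (\<forall>y z. y \<epsilon> x \<and> z \<epsilon> y \<longrightarrow> P z)"])
    show "definable (\<lambda>e. P (e 0) \<and> (\<forall>y. y \<epsilon> e 0 \<longrightarrow> P y) \<and> (\<forall>y z. y \<epsilon> e 0 \<and> z \<epsilon> y \<longrightarrow> P z))"
      by (intro codef codef_subst1[OF def])
    fix x assume IH: "\<And>y. y \<epsilon> x \<Longrightarrow> P y \<and> (\<forall>z. z \<epsilon> y \<longrightarrow> P z) \<and> (\<forall>z w. z \<epsilon> y \<and> w \<epsilon> z \<longrightarrow> P w)"
    have "P x"
    proof (rule step)
      fix y b assume "pair_in y b x"
      then show "P y" using pair_components[of y b] IH unfolding pair_in_iff by blast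
    qed
    then show "P x \<and> (\<forall>y. y \<epsilon> x \<longrightarrow> P y) \<and> (\<forall>y z. y \<epsilon> x \<and> z \<epsilon> y \<longrightarrow> P z)" using IH by blast
  qed
  then show ?thesis by blast
qed

text \<open>The recursion for the Boolean value of \<open>\<tau> = \<sigma>\<close> calls itself on pairs of names from
  \<open>dom \<tau> \<union> dom \<sigma>\<close>, so also on two names from the same domain. It would suffice to compare ranks, but ranks
  are avoided by two nested inductions. Call \<open>\<tau>\<close> diagonal (\<open>D\<close>) if \<open>P\<close> holds for all pairs from its own
  domain, and \<open>HD\<close> if it is so hereditarily. For names with \<open>HD\<close>, only pairs from
  \<open>dom \<tau> \<times> dom \<sigma>\<close> and \<open>dom \<sigma> \<times> dom \<tau>\<close> remain, and induction on \<open>\<tau>\<close> proves \<open>P\<close> for them; then induction on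
  \<open>\<tau>\<close> proves \<open>HD\<close>.\<close>
lemma dom_pair_induct:
  assumes def: "definable (\<lambda>e. P (e 0) (e 1))"
    and step: "\<And>\<tau> \<sigma>. (\<And>\<eta> \<theta> b c. pair_in \<eta> b \<tau> \<or> pair_in \<eta> b \<sigma> \<Longrightarrow> pair_in \<theta> c \<tau> \<or> pair_in \<theta> c \<sigma> \<Longrightarrow> P \<eta> \<theta>) \<Longrightarrow> P \<tau> \<sigma>"
  shows "P \<tau> \<sigma>"
proof -
  define D where "D \<tau> \<longleftrightarrow> (\<forall>\<eta> \<theta> b c. pair_in \<eta> b \<tau> \<and> pair_in \<theta> c \<tau> \<longrightarrow> P \<eta> \<theta>)" for \<tau>
  define HD where "HD \<tau> \<longleftrightarrow> (\<exists>T. \<tau> \<epsilon> T \<and> (\<forall>z. z \<epsilon> T \<longrightarrow> D z \<and> (\<forall>\<eta> b. pair_in \<eta> b z \<longrightarrow> \<eta> \<epsilon> T)))" for \<tau>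
  have def_D: "definable (\<lambda>e. D (e 0))" unfolding D_def by (intro codef codef_subst2[OF def])
  have def_HD: "definable (\<lambda>e. HD (e 0))" unfolding HD_def by (intro codef codef_subst1[OF def_D])
  have HD_D: "D \<tau>" if "HD \<tau>" for \<tau> using that unfolding HD_def by blast
  have HD_dom: "HD \<eta>" if "HD \<tau>" "pair_in \<eta> b \<tau>" for \<tau> \<eta> b
    using that unfolding HD_def by blast
  have inner: "\<forall>\<sigma>. HD \<tau> \<and> HD \<sigma> \<longrightarrow> P \<tau> \<sigma> \<and> P \<sigma> \<tau>" for \<tau>
  proof (rule dom_induct[where P = "\<lambda>\<tau>. \<forall>\<sigma>. HD \<tau> \<and> HD \<sigma> \<longrightarrow> P \<tau> \<sigma> \<and> P \<sigma> \<tau>"])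
    show "definable (\<lambda>e. \<forall>\<sigma>. HD (e 0) \<and> HD \<sigma> \<longrightarrow> P (e 0) \<sigma> \<and> P \<sigma> (e 0))"
      by (intro codef codef_subst1[OF def_HD] codef_subst2[OF def])
    fix \<tau> assume IH: "\<And>y b. pair_in y b \<tau> \<Longrightarrow> \<forall>\<sigma>. HD y \<and> HD \<sigma> \<longrightarrow> P y \<sigma> \<and> P \<sigma> y"
    show "\<forall>\<sigma>. HD \<tau> \<and> HD \<sigma> \<longrightarrow> P \<tau> \<sigma> \<and> P \<sigma> \<tau>"
    proof (intro allI impI)
      fix \<sigma> assume hd: "HD \<tau> \<and> HD \<sigma>"
      have "P \<eta> \<theta>" if "pair_in \<eta> b \<tau> \<or> pair_in \<eta> b \<sigma>" "pair_in \<theta> c \<tau> \<or> pair_in \<theta> c \<sigma>" for \<eta> \<theta> b c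
        using that IH HD_dom hd HD_D unfolding D_def by blast
      then show "P \<tau> \<sigma> \<and> P \<sigma> \<tau>" using step[of \<tau> \<sigma>] step[of \<sigma> \<tau>] by blast
    qed
  qed
  have "HD \<tau>" for \<tau>
  proof (rule dom_induct[where P = HD, OF def_HD])
    fix \<tau> assume IH: "\<And>y b. pair_in y b \<tau> \<Longrightarrow> HD y"
    then have "D \<tau>" unfolding D_def using inner by blast
    obtain t where t: "transitive_set t" "\<tau> \<epsilon> t" using transitive_closure_exists by blast
    obtain T0 where T0: "\<And>z. z \<epsilon> T0 \<longleftrightarrow> z \<epsilon> t \<and> HD z"
      using smallD[OF separation[OF def_HD, of t]] by blast
    obtain T where T: "\<And>z. z \<epsilon> T \<longleftrightarrow> z = \<tau> \<or> (z \<epsilon> t \<and> HD z)"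
      using adjoin[of \<tau> T0] unfolding T0 by blast
    have "\<eta> \<epsilon> t" if "pair_in \<eta> b z" "z \<epsilon> t" for \<eta> b z
      using that pair_components[of \<eta> b] t(1) unfolding pair_in_iff transitive_set_def by blast
    then have "D z \<and> (\<forall>\<eta> b. pair_in \<eta> b z \<longrightarrow> \<eta> \<epsilon> T)" if "z \<epsilon> T" for z
      using that \<open>D \<tau>\<close> IH HD_D HD_dom t(2) unfolding T by blast
    then show "HD \<tau>" unfolding HD_def using T by blast
  qed
  then show ?thesis using inner by blast
qed

end

section \<open>Definability of suprema and infima\<close>

lemma coterm_shift: "coterm j t t' \<Longrightarrow> coterm j (\<lambda>e. t (\<lambda>n. e (Suc n))) (\<lambda>e. t' (\<lambda>n. e (Suc n)))"
  by (auto simp: coterm_def)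

text \<open>A formula that has been put under one more quantifier.\<close>
lemma codef_shift:
  assumes "codefinable E E' j (\<lambda>e. P (e 0) (\<lambda>n. e (Suc n))) (\<lambda>e. P' (e 0) (\<lambda>n. e (Suc n)))"
  shows "codefinable E E' j (\<lambda>e. P (e 0) (\<lambda>n. e (Suc (Suc n)))) (\<lambda>e. P' (e 0) (\<lambda>n. e (Suc (Suc n))))"
proof -
  have "coterm j (\<lambda>e. if n = 0 then e 0 else e (Suc n)) (\<lambda>e. if n = 0 then e 0 else e (Suc n))"
    for n :: nat
    by (cases "n = 0") (simp_all add: coterm_var)
  from codef_subst[where t = "\<lambda>n e. if n = 0 then e 0 else e (Suc n)"
      and t' = "\<lambda>n e. if n = 0 then e 0 else e (Suc n)", OF assms this]
  show ?thesis by simp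
qed

lemma codef_le [codef]:
  assumes "coterm j t t'" "coterm j u u'"
  shows "codefinable E E' j (\<lambda>e. internal_algebra.le E L (t e) (u e))
    (\<lambda>e. internal_algebra.le E' (j L) (t' e) (u' e))"
  unfolding internal_algebra.le_def by (intro codef assms)

lemma codef_is_lub [codef]:
  assumes S: "codefinable E E' j (\<lambda>e. S (e 0) (\<lambda>n. e (Suc n))) (\<lambda>e. S' (e 0) (\<lambda>n. e (Suc n)))"
    and t: "coterm j t t'"
  shows "codefinable E E' j (\<lambda>e. internal_algebra.is_lub E B L {s. S s e} (t e))
    (\<lambda>e. internal_algebra.is_lub E' (j B) (j L) {s. S' s e} (t' e))"
  unfolding internal_algebra.is_lub_def Ball_def mem_Collect_eq
  by (intro codef codef_shift[OF S] S coterm_shift[OF t] t)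

lemma codef_is_glb [codef]:
  assumes S: "codefinable E E' j (\<lambda>e. S (e 0) (\<lambda>n. e (Suc n))) (\<lambda>e. S' (e 0) (\<lambda>n. e (Suc n)))"
    and t: "coterm j t t'"
  shows "codefinable E E' j (\<lambda>e. internal_algebra.is_glb E B L {s. S s e} (t e))
    (\<lambda>e. internal_algebra.is_glb E' (j B) (j L) {s. S' s e} (t' e))"
  unfolding internal_algebra.is_glb_def Ball_def mem_Collect_eq
  by (intro codef codef_shift[OF S] S coterm_shift[OF t] t)

lemma codef_is_lub2 [codef]:
  assumes "coterm j t t'" "coterm j u u'" "coterm j v v'"
  shows "codefinable E E' j (\<lambda>e. internal_algebra.is_lub E B L {t e, u e} (v e))
    (\<lambda>e. internal_algebra.is_lub E' (j B) (j L) {t' e, u' e} (v' e))"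
proof -
  have *: "{a, b} = {s. s = a \<or> s = b}" for a b :: 'x by auto
  show ?thesis unfolding * by (intro codef assms coterm_shift)
qed

lemma codef_is_glb2 [codef]:
  assumes "coterm j t t'" "coterm j u u'" "coterm j v v'"
  shows "codefinable E E' j (\<lambda>e. internal_algebra.is_glb E B L {t e, u e} (v e))
    (\<lambda>e. internal_algebra.is_glb E' (j B) (j L) {t' e, u' e} (v' e))"
proof -
  have *: "{a, b} = {s. s = a \<or> s = b}" for a b :: 'x by auto
  show ?thesis unfolding * by (intro codef assms coterm_shift)
qed

lemma codef_is_lub0 [codef]:
  assumes "coterm j v v'"
  shows "codefinable E E' j (\<lambda>e. internal_algebra.is_lub E B L {} (v e))
    (\<lambda>e. internal_algebra.is_lub E' (j B) (j L) {} (v' e))"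
  unfolding empty_def by (intro codef assms)

lemma codef_is_glb0 [codef]:
  assumes "coterm j v v'"
  shows "codefinable E E' j (\<lambda>e. internal_algebra.is_glb E B L {} (v e))
    (\<lambda>e. internal_algebra.is_glb E' (j B) (j L) {} (v' e))"
  unfolding empty_def by (intro codef assms)

section \<open>Maximal independent sets\<close>

context zfc_model begin

text \<open>The axiom of choice is stated for disjoint families, so it is applied to the sets \<open>{S} \<times> S\<close>.\<close>
lemma choice_function:
  "\<exists>c. \<forall>S. (\<exists>d. d \<epsilon> S) \<and> (\<forall>d. d \<epsilon> S \<longrightarrow> d \<epsilon> D) \<longrightarrow> (\<exists>!d. d \<epsilon> S \<and> pair_in S d c)"
proof -
  define Q where "Q S y \<longleftrightarrow> (\<forall>p. p \<epsilon> y \<longleftrightarrow> (\<exists>d. d \<epsilon> S \<and> is_pair S d p))" for S y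
  have Q_unique: "y = y'" if "Q S y" "Q S y'" for S y y'
    by (rule extensionality) (use that in \<open>simp add: Q_def\<close>)
  have Q_exists: "\<exists>y. Q S y" for S
  proof -
    have "small {p. \<exists>d. d \<epsilon> S \<and> is_pair S d p}"
      by (rule replacement[where P = "\<lambda>d p. is_pair S d p"]) (intro codef, rule is_pair_unique)
    then show ?thesis unfolding Q_def by (rule smallD)
  qed
  obtain P0 where P0: "\<And>S. S \<epsilon> P0 \<longleftrightarrow> elts S \<subseteq> elts D" using smallD[OF small_Pow[of D]] by blast
  have "definable (\<lambda>e. \<exists>d. d \<epsilon> e 0)" by (intro codef)
  then obtain P where P: "\<And>S. S \<epsilon> P \<longleftrightarrow> S \<epsilon> P0 \<and> (\<exists>d. d \<epsilon> S)"
    using smallD[OF separation[of "\<lambda>S. \<exists>d. d \<epsilon> S" P0]] by blast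
  have "small {y. \<exists>S. S \<epsilon> P \<and> Q S y}"
  proof (rule replacement)
    show "definable (\<lambda>e. Q (e 0) (e 1))" unfolding Q_def by (intro codef)
  qed (rule Q_unique)
  then obtain x where x: "\<And>y. y \<epsilon> x \<longleftrightarrow> (\<exists>S. S \<epsilon> P \<and> Q S y)" using smallD by blast
  have ne: "\<exists>z. z \<epsilon> y" if "y \<epsilon> x" for y
  proof -
    from \<open>y \<epsilon> x\<close> obtain S d where "Q S y" "d \<epsilon> S" unfolding x P by blast
    then have "opair S d \<epsilon> y" unfolding Q_def is_pair_iff by blast
    then show ?thesis by blast
  qed
  have disj: "y = z" if yz: "y \<epsilon> x" "z \<epsilon> x" "w \<epsilon> y" "w \<epsilon> z" for y z w
  proof -
    from yz(1,2) obtain S S' where S: "Q S y" "Q S' z" unfolding x by blast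
    then obtain d d' where "w = opair S d" "w = opair S' d'" using yz(3,4) unfolding Q_def is_pair_iff by blast
    then have "S = S'" by (simp add: opair_inject)
    then show ?thesis using S Q_unique by blast
  qed
  have ch: choice_ax using ZFC by (simp add: ZFC_def)
  have pre: "(\<forall>y. y \<epsilon> x \<longrightarrow> (\<exists>z. z \<epsilon> y)) \<and>
      (\<forall>y z w. y \<epsilon> x \<and> z \<epsilon> x \<and> w \<epsilon> y \<and> w \<epsilon> z \<longrightarrow> y = z)"
    using ne disj by (intro conjI allI impI; (elim conjE)?)
  have "\<exists>c. \<forall>y. y \<epsilon> x \<longrightarrow> (\<exists>!z. z \<epsilon> c \<and> z \<epsilon> y)"
    by (rule mp[OF spec[OF ch[unfolded choice_ax_def], of x] pre])
  then obtain c where c: "\<And>y. y \<epsilon> x \<Longrightarrow> \<exists>!z. z \<epsilon> c \<and> z \<epsilon> y" by metis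
  have "\<exists>!d. d \<epsilon> S \<and> pair_in S d c" if S: "\<exists>d. d \<epsilon> S" "\<forall>d. d \<epsilon> S \<longrightarrow> d \<epsilon> D" for S
  proof -
    have "S \<epsilon> P" using S unfolding P P0 elts_def by blast
    obtain y where y: "Q S y" using Q_exists by blast
    then have "y \<epsilon> x" using x \<open>S \<epsilon> P\<close> by blast
    then have ex1: "\<exists>!z. z \<epsilon> c \<and> z \<epsilon> y" by (rule c)
    then obtain z where z: "z \<epsilon> c" "z \<epsilon> y" by blast
    then obtain d where "d \<epsilon> S" "z = opair S d" using y unfolding Q_def is_pair_iff by blast
    with z have d: "opair S d \<epsilon> c" "d \<epsilon> S" by simp_all
    have "d' = d" if "opair S d' \<epsilon> c" "d' \<epsilon> S" for d'
    proof -
      have "opair S d \<epsilon> y" "opair S d' \<epsilon> y" using y d that unfolding Q_def is_pair_iff by blast+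
      then have "opair S d' = opair S d" using ex1 d that by blast
      then show ?thesis by (simp add: opair_inject)
    qed
    then show ?thesis unfolding pair_in_iff using d by blast
  qed
  then show ?thesis by blast
qed

text \<open>An internal instance of Zorn's lemma, by Zermelo's argument without ordinals. Call
  a set independent if any two distinct elements of it are related by \<open>I\<close>. Let \<open>N S\<close> be the
  set of elements by which an independent set \<open>S\<close> can be extended, and let the successor of \<open>S\<close> arise by adding
  the chosen element of \<open>N S\<close>, if there is one. Let \<open>M\<close> be the least family of subsets of \<open>D\<close> that is closed under
  successors and unions. One shows that \<open>M\<close> is a chain; hence all members of \<open>M\<close> are independent, and the
  union of \<open>M\<close> is its own successor, that is, it cannot be extended.\<close>
theorem maximal_independent_subset:
  assumes def_I: "definable (\<lambda>e. I (e 0) (e 1))" and sym: "\<And>a b. I a b \<Longrightarrow> I b a"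
  shows "\<exists>A. (\<forall>a. a \<epsilon> A \<longrightarrow> a \<epsilon> D) \<and> (\<forall>a b. a \<epsilon> A \<and> b \<epsilon> A \<and> a \<noteq> b \<longrightarrow> I a b) \<and>
    (\<forall>d. d \<epsilon> D \<longrightarrow> d \<epsilon> A \<or> (\<exists>a. a \<epsilon> A \<and> \<not> I a d))"
proof -
  obtain c where c: "\<And>S. \<exists>d. d \<epsilon> S \<Longrightarrow> \<forall>d. d \<epsilon> S \<longrightarrow> d \<epsilon> D \<Longrightarrow> \<exists>!d. d \<epsilon> S \<and> pair_in S d c"
    using choice_function[of D] by blast
  define N where "N S d \<longleftrightarrow> d \<epsilon> D \<and> \<not> d \<epsilon> S \<and> (\<forall>a. a \<epsilon> S \<longrightarrow> I a d)" for S d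
  have def_N: "definable (\<lambda>e. N (e 0) (e 1))" unfolding N_def by (intro codef codef_subst2[OF def_I])
  define nxt where "nxt S d \<longleftrightarrow> (\<exists>M. (\<forall>z. z \<epsilon> M \<longleftrightarrow> N S z) \<and> d \<epsilon> M \<and> pair_in M d c)" for S d
  have def_nxt: "definable (\<lambda>e. nxt (e 0) (e 1))" unfolding nxt_def by (intro codef codef_subst2[OF def_N])
  have nxt_N: "N S d" if "nxt S d" for S d using that unfolding nxt_def by blast
  have N_set: "\<exists>M. \<forall>z. z \<epsilon> M \<longleftrightarrow> N S z" for S
  proof -
    have "definable (\<lambda>e. N S (e 0))" by (intro codef codef_subst2[OF def_N])
    then obtain M where "\<And>z. z \<epsilon> M \<longleftrightarrow> z \<epsilon> D \<and> N S z" using smallD[OF separation[of "N S" D]] by blast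
    then show ?thesis unfolding N_def by blast
  qed
  have nxt_exists: "\<exists>d. nxt S d" if N: "N S d0" for S d0
  proof -
    obtain M where M: "\<And>z. z \<epsilon> M \<longleftrightarrow> N S z" using N_set by blast
    obtain d where "d \<epsilon> M" "pair_in M d c" using c[of M] M N unfolding N_def by blast
    then show ?thesis unfolding nxt_def using M by blast
  qed
  have nxt_unique: "d = d'" if d: "nxt S d" "nxt S d'" for S d d'
  proof -
    obtain M where M: "\<And>z. z \<epsilon> M \<longleftrightarrow> N S z" "d \<epsilon> M" "pair_in M d c" using d(1) unfolding nxt_def by blast
    obtain M' where M': "\<And>z. z \<epsilon> M' \<longleftrightarrow> N S z" "d' \<epsilon> M'" "pair_in M' d' c" using d(2) unfolding nxt_def by blast
    have "M' = M" by (rule extensionality) (simp add: M(1) M'(1))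
    then have "d' \<epsilon> M" "pair_in M d' c" using M' by auto
    moreover have "\<exists>!d. d \<epsilon> M \<and> pair_in M d c" using c[of M] M unfolding N_def by blast
    ultimately show ?thesis using M by blast
  qed
  define suc where "suc S S' \<longleftrightarrow> (\<forall>z. z \<epsilon> S' \<longleftrightarrow> z \<epsilon> S \<or> nxt S z)" for S S'
  have def_suc: "definable (\<lambda>e. suc (e 0) (e 1))" unfolding suc_def by (intro codef codef_subst2[OF def_nxt])
  have suc_exists: "\<exists>S'. suc S S'" for S
  proof (cases "\<exists>d. nxt S d")
    case True
    then obtain d where d: "nxt S d" by blast
    obtain S' where "\<And>z. z \<epsilon> S' \<longleftrightarrow> z = d \<or> z \<epsilon> S" using adjoin by blast
    then have "suc S S'" unfolding suc_def using d nxt_unique by metis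
    then show ?thesis by blast
  next
    case False
    then have "suc S S" by (simp add: suc_def)
    then show ?thesis by blast
  qed
  define is_union where "is_union Y u \<longleftrightarrow> (\<forall>z. z \<epsilon> u \<longleftrightarrow> (\<exists>S. S \<epsilon> Y \<and> z \<epsilon> S))" for Y u
  have def_union: "definable (\<lambda>e. is_union (e 0) (e 1))" unfolding is_union_def by (intro codef)
  define tower where "tower T \<longleftrightarrow>
    (\<forall>S S'. S \<epsilon> T \<and> suc S S' \<longrightarrow> S' \<epsilon> T) \<and>
    (\<forall>Y u. (\<forall>S. S \<epsilon> Y \<longrightarrow> S \<epsilon> T) \<and> is_union Y u \<longrightarrow> u \<epsilon> T)" for T
  have def_tower: "definable (\<lambda>e. tower (e 0))"
    unfolding tower_def by (intro codef codef_subst2[OF def_suc] codef_subst2[OF def_union])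
  obtain P where P: "\<And>S. S \<epsilon> P \<longleftrightarrow> (\<forall>d. d \<epsilon> S \<longrightarrow> d \<epsilon> D)"
    using smallD[OF small_Pow[of D]] unfolding elts_def subset_eq Ball_def mem_Collect_eq by blast
  have nxt_D: "d \<epsilon> D" if "nxt S d" for S d using nxt_N[OF that] unfolding N_def by blast
  have tower_P: "tower P"
    unfolding tower_def
  proof (intro conjI allI impI)
    fix S S' assume "S \<epsilon> P \<and> suc S S'"
    then show "S' \<epsilon> P" unfolding P suc_def using nxt_D by blast
  next
    fix Y u assume "(\<forall>S. S \<epsilon> Y \<longrightarrow> S \<epsilon> P) \<and> is_union Y u"
    then show "u \<epsilon> P" unfolding P is_union_def by blast
  qed
  have "definable (\<lambda>e. \<forall>T. tower T \<longrightarrow> e 0 \<epsilon> T)" by (intro codef codef_subst1[OF def_tower])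
  then obtain M where M: "\<And>S. S \<epsilon> M \<longleftrightarrow> S \<epsilon> P \<and> (\<forall>T. tower T \<longrightarrow> S \<epsilon> T)"
    using smallD[OF separation[of "\<lambda>S. \<forall>T. tower T \<longrightarrow> S \<epsilon> T" P]] by blast
  have M: "S \<epsilon> M \<longleftrightarrow> (\<forall>T. tower T \<longrightarrow> S \<epsilon> T)" for S
    using M tower_P by blast
  have tower_suc: "S' \<epsilon> T" if "tower T" "S \<epsilon> T" "suc S S'" for T S S'
    using that unfolding tower_def by blast
  have tower_union: "u \<epsilon> T" if "tower T" "\<And>S. S \<epsilon> Y \<Longrightarrow> S \<epsilon> T" "is_union Y u" for T Y u
    using that unfolding tower_def by blast
  have M_suc: "S' \<epsilon> M" if "S \<epsilon> M" "suc S S'" for S S'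
    unfolding M using that tower_suc M by blast
  have M_union: "u \<epsilon> M" if "\<And>S. S \<epsilon> Y \<Longrightarrow> S \<epsilon> M" "is_union Y u" for Y u
    unfolding M
  proof (intro allI impI)
    fix T assume "tower T"
    then show "u \<epsilon> T" using tower_union[of T Y u] that M by blast
  qed
  have M_induct: "Q S" if S: "S \<epsilon> M" and def_Q: "definable (\<lambda>e. Q (e 0))"
    and Q_suc: "\<And>S S'. S \<epsilon> M \<Longrightarrow> Q S \<Longrightarrow> suc S S' \<Longrightarrow> Q S'"
    and Q_union: "\<And>Y u. (\<And>S. S \<epsilon> Y \<Longrightarrow> S \<epsilon> M \<and> Q S) \<Longrightarrow> is_union Y u \<Longrightarrow> Q u" for Q S
  proof -
    obtain T where T: "\<And>S. S \<epsilon> T \<longleftrightarrow> S \<epsilon> M \<and> Q S" using smallD[OF separation[OF def_Q, of M]] by blast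
    have "tower T" unfolding tower_def
    proof (intro conjI allI impI)
      fix S S' assume "S \<epsilon> T \<and> suc S S'"
      then show "S' \<epsilon> T" unfolding T using M_suc Q_suc by blast
    next
      fix Y u assume Y: "(\<forall>S. S \<epsilon> Y \<longrightarrow> S \<epsilon> T) \<and> is_union Y u"
      then have "u \<epsilon> M" using M_union[of Y u] unfolding T by blast
      moreover have "Q u" using Q_union[of Y u] Y unfolding T by blast
      ultimately show "u \<epsilon> T" unfolding T by blast
    qed
    then show ?thesis using S T M by blast
  qed
  define sub where "sub S R \<longleftrightarrow> (\<forall>z. z \<epsilon> S \<longrightarrow> z \<epsilon> R)" for S R
  have def_sub: "definable (\<lambda>e. sub (e 0) (e 1))" unfolding sub_def by (intro codef)
  define comparable where "comparable S \<longleftrightarrow> (\<forall>R. R \<epsilon> M \<longrightarrow> sub R S \<or> sub S R)" for S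
  have def_comparable: "definable (\<lambda>e. comparable (e 0))"
    unfolding comparable_def by (intro codef codef_subst2[OF def_sub])
  \<comment> \<open>Nothing in \<open>M\<close> lies strictly between a comparable set and its successor.\<close>
  have gap: "sub R S \<or> sub S' R" if S: "S \<epsilon> M" "comparable S" "suc S S'" and R: "R \<epsilon> M" for S S' R
  proof (rule M_induct[where Q = "\<lambda>R. sub R S \<or> sub S' R", OF R])
    show "definable (\<lambda>e. sub (e 0) S \<or> sub S' (e 0))" by (intro codef codef_subst2[OF def_sub])
  next
    fix R R' assume R: "R \<epsilon> M" "sub R S \<or> sub S' R" "suc R R'"
    from R(2) show "sub R' S \<or> sub S' R'"
    proof
      assume "sub S' R" then show ?thesis using R(3) unfolding sub_def suc_def by blast
    next
      assume RS: "sub R S"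
      have "sub R' S \<or> sub S R'" using S(2) M_suc[OF R(1,3)] unfolding comparable_def by blast
      then show ?thesis
      proof
        assume SR': "sub S R'"
        show ?thesis
        proof (cases "sub S R")
          case True
          then have "S = R" by (intro extensionality) (use RS in \<open>auto simp: sub_def\<close>)
          then show ?thesis using S(3) R(3) unfolding suc_def sub_def by blast
        next
          case False
          then obtain z where "z \<epsilon> S" "\<not> z \<epsilon> R" unfolding sub_def by blast
          then have "nxt R z" using SR' R(3) unfolding sub_def suc_def by blast
          then have "w \<epsilon> S" if "w \<epsilon> R'" for w
            using that R(3) RS \<open>z \<epsilon> S\<close> nxt_unique unfolding suc_def sub_def by blast
          then show ?thesis unfolding sub_def by blast
        qed
      qed simp
    qed
  next
    fix Y u assume Y: "\<And>R. R \<epsilon> Y \<Longrightarrow> R \<epsilon> M \<and> (sub R S \<or> sub S' R)" and u: "is_union Y u"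
    show "sub u S \<or> sub S' u"
    proof (cases "\<exists>R. R \<epsilon> Y \<and> sub S' R")
      case True then show ?thesis using u unfolding is_union_def sub_def by blast
    next
      case False then show ?thesis using u Y unfolding is_union_def sub_def by blast
    qed
  qed
  have chain: "comparable S" if "S \<epsilon> M" for S
  proof (rule M_induct[where Q = comparable, OF that def_comparable])
    fix S S' assume S: "S \<epsilon> M" "comparable S" "suc S S'"
    show "comparable S'" unfolding comparable_def
    proof (intro allI impI)
      fix R assume "R \<epsilon> M"
      then have "sub R S \<or> sub S' R" using gap S by blast
      moreover have "sub S S'" using S(3) unfolding suc_def sub_def by blast
      ultimately show "sub R S' \<or> sub S' R" unfolding sub_def by blast
    qed
  next
    fix Y u assume Y: "\<And>S. S \<epsilon> Y \<Longrightarrow> S \<epsilon> M \<and> comparable S" and u: "is_union Y u"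
    show "comparable u" unfolding comparable_def
    proof (intro allI impI)
      fix R assume R: "R \<epsilon> M"
      show "sub R u \<or> sub u R"
      proof (cases "\<exists>S. S \<epsilon> Y \<and> sub R S")
        case True then show ?thesis using u unfolding is_union_def sub_def by blast
      next
        case False
        then have "sub S R" if "S \<epsilon> Y" for S using Y[OF that] R that unfolding comparable_def by blast
        then show ?thesis using u unfolding is_union_def sub_def by blast
      qed
    qed
  qed
  define indep where "indep S \<longleftrightarrow> (\<forall>a b. a \<epsilon> S \<and> b \<epsilon> S \<and> a \<noteq> b \<longrightarrow> I a b)" for S
  have M_indep: "indep S" if "S \<epsilon> M" for S
  proof (rule M_induct[where Q = indep, OF that])
    show "definable (\<lambda>e. indep (e 0))" unfolding indep_def by (intro codef codef_subst2[OF def_I])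
  next
    fix S S' assume S: "S \<epsilon> M" "indep S" "suc S S'"
    show "indep S'" unfolding indep_def
    proof (intro allI impI)
      fix a b assume ab: "a \<epsilon> S' \<and> b \<epsilon> S' \<and> a \<noteq> b"
      then have "a \<epsilon> S \<or> nxt S a" "b \<epsilon> S \<or> nxt S b" using S(3) unfolding suc_def by blast+
      moreover have "I x y" "I y x" if "x \<epsilon> S" "nxt S y" for x y
        using that nxt_N sym unfolding N_def by blast+
      ultimately show "I a b" using S(2) ab nxt_unique unfolding indep_def by blast
    qed
  next
    fix Y u assume Y: "\<And>S. S \<epsilon> Y \<Longrightarrow> S \<epsilon> M \<and> indep S" and u: "is_union Y u"
    show "indep u" unfolding indep_def
    proof (intro allI impI)
      fix a b assume ab: "a \<epsilon> u \<and> b \<epsilon> u \<and> a \<noteq> b"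
      then obtain S R where SR: "S \<epsilon> Y" "a \<epsilon> S" "R \<epsilon> Y" "b \<epsilon> R" using u unfolding is_union_def by blast
      then have "sub S R \<or> sub R S" using chain[of S] Y unfolding comparable_def by blast
      then show "I a b" using SR Y ab unfolding sub_def indep_def by blast
    qed
  qed
  obtain A where A: "is_union M A" using smallD[OF small_Union[of M]] unfolding is_union_def by blast
  have "A \<epsilon> M" using M_union[OF _ A] by blast
  then have 1: "\<forall>a. a \<epsilon> A \<longrightarrow> a \<epsilon> D" using M tower_P P by blast
  have 2: "\<forall>a b. a \<epsilon> A \<and> b \<epsilon> A \<and> a \<noteq> b \<longrightarrow> I a b" using M_indep[OF \<open>A \<epsilon> M\<close>] unfolding indep_def .
  obtain A' where A': "suc A A'" using suc_exists by blast
  then have "A' \<epsilon> M" using M_suc \<open>A \<epsilon> M\<close> by blast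
  have "\<not> nxt A d" for d
  proof
    assume d: "nxt A d"
    then have "d \<epsilon> A'" using A' unfolding suc_def by blast
    then have "d \<epsilon> A" using A \<open>A' \<epsilon> M\<close> unfolding is_union_def by blast
    then show False using nxt_N[OF d] unfolding N_def by blast
  qed
  then have "\<not> N A d" for d using nxt_exists by blast
  then have "\<forall>d. d \<epsilon> D \<longrightarrow> d \<epsilon> A \<or> (\<exists>a. a \<epsilon> A \<and> \<not> I a d)" unfolding N_def by blast
  with 1 2 show ?thesis by blast
qed

end

section \<open>Complete Boolean algebras inside a model\<close>

context internal_algebra begin

definition is_compl :: "'a \<Rightarrow> 'a \<Rightarrow> bool" where
  "is_compl a c \<longleftrightarrow> c \<epsilon> B \<and> (\<exists>z. is_lub {} z \<and> is_glb {a, c} z) \<and> (\<exists>u. is_glb {} u \<and> is_lub {a, c} u)"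

end

lemma codef_is_compl [codef]:
  assumes "coterm j t t'" "coterm j u u'"
  shows "codefinable E E' j (\<lambda>e. internal_algebra.is_compl E B L (t e) (u e))
    (\<lambda>e. internal_algebra.is_compl E' (j B) (j L) (t' e) (u' e))"
  unfolding internal_algebra.is_compl_def by (intro codef coterm_shift assms)

text \<open>The laws of Boolean algebra hold on the elements of \<open>B\<close>; the relation \<open>L\<close> may contain further pairs, about
  which nothing is known.\<close>
locale cba_model = internal_algebra mem B L + zfc_model mem
  for mem :: "'a \<Rightarrow> 'a \<Rightarrow> bool" (infix "\<epsilon>" 50) and B L +
  assumes cba: complete_boolean_algebra
begin

lemma ba: boolean_algebra using cba by (simp add: complete_boolean_algebra_def)

lemma le_refl: "a \<epsilon> B \<Longrightarrow> a \<preceq> a"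
  using ba unfolding boolean_algebra_def elts_def by blast

lemma le_antisym: "a \<epsilon> B \<Longrightarrow> b \<epsilon> B \<Longrightarrow> a \<preceq> b \<Longrightarrow> b \<preceq> a \<Longrightarrow> a = b"
  using ba unfolding boolean_algebra_def elts_def by blast

lemma le_trans: "a \<epsilon> B \<Longrightarrow> b \<epsilon> B \<Longrightarrow> c \<epsilon> B \<Longrightarrow> a \<preceq> b \<Longrightarrow> b \<preceq> c \<Longrightarrow> a \<preceq> c"
  using ba unfolding boolean_algebra_def elts_def by blast

lemma meet_join_distrib: "a \<epsilon> B \<Longrightarrow> b \<epsilon> B \<Longrightarrow> c \<epsilon> B \<Longrightarrow> a \<sqinter> (b \<squnion> c) = (a \<sqinter> b) \<squnion> (a \<sqinter> c)"
  using ba unfolding boolean_algebra_def elts_def by blast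

lemma is_lub_unique: "is_lub S s \<Longrightarrow> is_lub S s' \<Longrightarrow> s = s'"
  unfolding is_lub_def by (meson le_antisym)

lemma is_glb_unique: "is_glb S s \<Longrightarrow> is_glb S s' \<Longrightarrow> s = s'"
  unfolding is_glb_def by (meson le_antisym)

lemma bsup_eq: "is_lub S s \<Longrightarrow> bsup S = s"
  unfolding bsup_def by (rule the_equality) (auto intro: is_lub_unique)

lemma binf_eq: "is_glb S s \<Longrightarrow> binf S = s"
  unfolding binf_def by (rule the_equality) (auto intro: is_glb_unique)

text \<open>Completeness is internal, so suprema exist for definable classes of elements of \<open>B\<close>.\<close>
lemma lub_bsup:
  assumes "S \<subseteq> elts B" "definable (\<lambda>e. e 0 \<in> S)"
  shows "is_lub S (bsup S)"
proof -
  obtain X where X: "elts X = S" using small_subset[OF assms] by (rule smallE)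
  then obtain s where "is_lub S s" using cba assms(1) unfolding complete_boolean_algebra_def by blast
  then show ?thesis using bsup_eq by metis
qed

lemma glb_binf:
  assumes S: "S \<subseteq> elts B" and def: "definable (\<lambda>e. e 0 \<in> S)"
  shows "is_glb S (binf S)"
proof -
  let ?M = "{u. u \<epsilon> B \<and> (\<forall>a. a \<in> S \<longrightarrow> u \<preceq> a)}"
  have "definable (\<lambda>e. e 0 \<in> ?M)" unfolding mem_Collect_eq
    by (intro codef codef_subst1[where P = "\<lambda>a. a \<in> S" and P' = "\<lambda>a. a \<in> S", OF def])
  then have lub: "is_lub ?M (bsup ?M)" by (intro lub_bsup) (auto simp: elts_def)
  have "is_glb S (bsup ?M)"
    unfolding is_glb_def
  proof (intro conjI ballI allI impI)
    show "bsup ?M \<epsilon> B" using lub unfolding is_lub_def by blast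
  next
    fix a assume "a \<in> S"
    then have "a \<epsilon> B" using S unfolding elts_def by blast
    moreover have "\<forall>u\<in>?M. u \<preceq> a" using \<open>a \<in> S\<close> by blast
    ultimately show "bsup ?M \<preceq> a" using lub unfolding is_lub_def by blast
  next
    fix u assume "u \<epsilon> B \<and> (\<forall>a\<in>S. u \<preceq> a)"
    then show "u \<preceq> bsup ?M" using lub unfolding is_lub_def by blast
  qed
  then show ?thesis using binf_eq by metis
qed

lemma lub_zero: "is_lub {} zero"
proof -
  obtain s where "is_lub {} s" using ba unfolding boolean_algebra_def by blast
  then show ?thesis unfolding zero_def using bsup_eq by metis
qed

lemma glb_one: "is_glb {} one"
proof -
  obtain s where "is_glb {} s" using ba unfolding boolean_algebra_def by blast
  then show ?thesis unfolding one_def using binf_eq by metis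
qed

lemma zero_in: "zero \<epsilon> B" and zero_le: "a \<epsilon> B \<Longrightarrow> zero \<preceq> a"
  using lub_zero unfolding is_lub_def by blast+

lemma one_in: "one \<epsilon> B" and le_one: "a \<epsilon> B \<Longrightarrow> a \<preceq> one"
  using glb_one unfolding is_glb_def by blast+

lemma lub_join: "a \<epsilon> B \<Longrightarrow> b \<epsilon> B \<Longrightarrow> is_lub {a, b} (a \<squnion> b)"
proof -
  assume "a \<epsilon> B" "b \<epsilon> B"
  then obtain s where "is_lub {a, b} s" using ba unfolding boolean_algebra_def elts_def by blast
  then show ?thesis unfolding join_def using bsup_eq by metis
qed

lemma glb_meet: "a \<epsilon> B \<Longrightarrow> b \<epsilon> B \<Longrightarrow> is_glb {a, b} (a \<sqinter> b)"
proof -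
  assume "a \<epsilon> B" "b \<epsilon> B"
  then obtain s where "is_glb {a, b} s" using ba unfolding boolean_algebra_def elts_def by blast
  then show ?thesis unfolding meet_def using binf_eq by metis
qed

lemma meet_in: "a \<epsilon> B \<Longrightarrow> b \<epsilon> B \<Longrightarrow> a \<sqinter> b \<epsilon> B"
  and meet_le1: "a \<epsilon> B \<Longrightarrow> b \<epsilon> B \<Longrightarrow> a \<sqinter> b \<preceq> a"
  and meet_le2: "a \<epsilon> B \<Longrightarrow> b \<epsilon> B \<Longrightarrow> a \<sqinter> b \<preceq> b"
  and meet_greatest: "a \<epsilon> B \<Longrightarrow> b \<epsilon> B \<Longrightarrow> c \<epsilon> B \<Longrightarrow> c \<preceq> a \<Longrightarrow> c \<preceq> b \<Longrightarrow> c \<preceq> a \<sqinter> b"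
  using glb_meet[of a b] unfolding is_glb_def by auto

lemma join_in: "a \<epsilon> B \<Longrightarrow> b \<epsilon> B \<Longrightarrow> a \<squnion> b \<epsilon> B"
  and join_ge1: "a \<epsilon> B \<Longrightarrow> b \<epsilon> B \<Longrightarrow> a \<preceq> a \<squnion> b"
  and join_ge2: "a \<epsilon> B \<Longrightarrow> b \<epsilon> B \<Longrightarrow> b \<preceq> a \<squnion> b"
  and join_least: "a \<epsilon> B \<Longrightarrow> b \<epsilon> B \<Longrightarrow> c \<epsilon> B \<Longrightarrow> a \<preceq> c \<Longrightarrow> b \<preceq> c \<Longrightarrow> a \<squnion> b \<preceq> c"
  using lub_join[of a b] unfolding is_lub_def by auto

lemma meet_commute: "a \<sqinter> b = b \<sqinter> a"
  unfolding meet_def by (simp add: insert_commute)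

lemma join_commute: "a \<squnion> b = b \<squnion> a"
  unfolding join_def by (simp add: insert_commute)

lemma meet_absorb: "a \<epsilon> B \<Longrightarrow> b \<epsilon> B \<Longrightarrow> a \<preceq> b \<Longrightarrow> a \<sqinter> b = a"
  by (rule le_antisym) (auto intro: meet_in meet_le1 meet_greatest le_refl)

lemma le_meet_iff: "a \<epsilon> B \<Longrightarrow> b \<epsilon> B \<Longrightarrow> c \<epsilon> B \<Longrightarrow> c \<preceq> a \<sqinter> b \<longleftrightarrow> c \<preceq> a \<and> c \<preceq> b"
  by (meson le_trans meet_in meet_le1 meet_le2 meet_greatest)

lemma le_zero: "a \<epsilon> B \<Longrightarrow> a \<preceq> zero \<longleftrightarrow> a = zero"
  by (metis le_antisym le_refl zero_in zero_le)

lemma join_zero: "a \<epsilon> B \<Longrightarrow> a \<squnion> zero = a"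
  by (rule le_antisym) (auto intro: join_in zero_in join_ge1 join_least le_refl zero_le)

lemma meet_one: "a \<epsilon> B \<Longrightarrow> a \<sqinter> one = a"
  by (rule meet_absorb) (auto intro: one_in le_one)

lemma complement_unique:
  assumes "a \<epsilon> B" "c \<epsilon> B" "d \<epsilon> B" "a \<sqinter> c = zero" "a \<squnion> c = one" "a \<sqinter> d = zero" "a \<squnion> d = one"
  shows "c = d"
proof -
  have 1: "c \<preceq> d" if "c \<epsilon> B" "d \<epsilon> B" "a \<sqinter> c = zero" "a \<squnion> d = one" for c d
  proof -
    have "c = c \<sqinter> (a \<squnion> d)" using that meet_one by simp
    also have "\<dots> = (c \<sqinter> a) \<squnion> (c \<sqinter> d)" using that assms(1) by (intro meet_join_distrib)
    also have "\<dots> = c \<sqinter> d" using that assms(1) meet_commute[of c a] join_commute[of zero] join_zero meet_in by simp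
    finally have eq: "c \<sqinter> d = c" by (rule sym)
    show ?thesis using meet_le2[OF that(1,2)] unfolding eq .
  qed
  show ?thesis by (rule le_antisym) (fact assms | rule 1, fact, fact, fact, fact)+
qed

lemma compl_in: "a \<epsilon> B \<Longrightarrow> compl a \<epsilon> B"
  and meet_compl: "a \<epsilon> B \<Longrightarrow> a \<sqinter> compl a = zero"
  and join_compl: "a \<epsilon> B \<Longrightarrow> a \<squnion> compl a = one"
proof -
  have "compl a \<epsilon> B \<and> a \<sqinter> compl a = zero \<and> a \<squnion> compl a = one" if "a \<epsilon> B"
  proof -
    obtain c where c: "c \<epsilon> B" "a \<sqinter> c = zero" "a \<squnion> c = one"
      using ba \<open>a \<epsilon> B\<close> unfolding boolean_algebra_def elts_def by blast
    have "d = c" if "d \<epsilon> B \<and> a \<sqinter> d = zero \<and> a \<squnion> d = one" for d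
      by (rule complement_unique[OF \<open>a \<epsilon> B\<close>]) (use that c in simp_all)
    then have "\<exists>!c. c \<epsilon> B \<and> a \<sqinter> c = zero \<and> a \<squnion> c = one" using c by metis
    from theI'[OF this] show ?thesis unfolding compl_def .
  qed
  then show "a \<epsilon> B \<Longrightarrow> compl a \<epsilon> B" "a \<epsilon> B \<Longrightarrow> a \<sqinter> compl a = zero" "a \<epsilon> B \<Longrightarrow> a \<squnion> compl a = one"
    by blast+
qed

lemma is_compl_iff: "a \<epsilon> B \<Longrightarrow> is_compl a c \<longleftrightarrow> c = compl a"
proof
  assume a: "a \<epsilon> B" and "is_compl a c"
  then obtain z u where c: "c \<epsilon> B" "is_lub {} z" "is_glb {a, c} z" "is_glb {} u" "is_lub {a, c} u"
    unfolding is_compl_def by blast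
  then have "z = zero" "u = one" using is_lub_unique lub_zero is_glb_unique glb_one by blast+
  then have "a \<sqinter> c = zero" "a \<squnion> c = one" using c unfolding meet_def join_def by (auto intro: binf_eq bsup_eq)
  then show "c = compl a" using a c complement_unique compl_in meet_compl join_compl by blast
next
  assume a: "a \<epsilon> B" and c: "c = compl a"
  then show "is_compl a c" unfolding is_compl_def
    using compl_in[OF a] glb_meet[OF a compl_in[OF a]] lub_join[OF a compl_in[OF a]]
      meet_compl[OF a] join_compl[OF a] lub_zero glb_one by metis
qed

text \<open>This gives both the meaning of Boolean implication in \<open>sub_val\<close> and the distributivity of meets over
  arbitrary suprema in the next lemma.\<close>
lemma residuation:
  assumes "a \<epsilon> B" "m \<epsilon> B" "n \<epsilon> B"
  shows "a \<preceq> compl m \<squnion> n \<longleftrightarrow> a \<sqinter> m \<preceq> n"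
proof
  assume le: "a \<preceq> compl m \<squnion> n"
  have "a \<sqinter> m \<preceq> compl m \<squnion> n"
    by (rule le_trans[OF _ _ _ meet_le1[of a m] le]) (simp_all add: assms compl_in join_in meet_in)
  then have "a \<sqinter> m \<preceq> m \<sqinter> (compl m \<squnion> n)"
    by (intro meet_greatest meet_le2) (simp_all add: assms compl_in join_in meet_in)
  also have "m \<sqinter> (compl m \<squnion> n) = (m \<sqinter> compl m) \<squnion> (m \<sqinter> n)"
    using assms by (intro meet_join_distrib compl_in)
  also have "\<dots> = m \<sqinter> n"
    using assms by (simp add: meet_compl join_commute[of zero] join_zero meet_in)
  finally show "a \<sqinter> m \<preceq> n" using assms meet_le2[of m n] le_trans meet_in by blast
next
  assume le: "a \<sqinter> m \<preceq> n"
  have "a = a \<sqinter> (m \<squnion> compl m)" using assms by (simp add: join_compl meet_one)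
  also have "\<dots> = (a \<sqinter> m) \<squnion> (a \<sqinter> compl m)" using assms by (intro meet_join_distrib compl_in)
  finally have eq: "a = (a \<sqinter> m) \<squnion> (a \<sqinter> compl m)" .
  have "(a \<sqinter> m) \<squnion> (a \<sqinter> compl m) \<preceq> compl m \<squnion> n"
  proof (rule join_least)
    show "a \<sqinter> m \<preceq> compl m \<squnion> n"
      using le_trans[OF _ _ _ le join_ge2[of "compl m" n]] assms compl_in join_in meet_in by blast
    show "a \<sqinter> compl m \<preceq> compl m \<squnion> n"
      using le_trans[OF _ _ _ meet_le2[of a "compl m"] join_ge1[of "compl m" n]] assms compl_in join_in meet_in by blast
  qed (use assms compl_in join_in meet_in in auto)
  then show "a \<preceq> compl m \<squnion> n" using eq by simp
qed

lemma meet_lub_le: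
  assumes "is_lub S s" "p \<epsilon> B" "q \<epsilon> B" "\<And>a. a \<in> S \<Longrightarrow> a \<epsilon> B" "\<And>a. a \<in> S \<Longrightarrow> p \<sqinter> a \<preceq> q"
  shows "p \<sqinter> s \<preceq> q"
proof -
  have s: "s \<epsilon> B" using assms(1) unfolding is_lub_def by blast
  have "a \<preceq> compl p \<squnion> q" if "a \<in> S" for a
    using assms(5)[OF that] residuation[OF assms(4)[OF that] assms(2,3)] meet_commute[of a p] by simp
  then have "s \<preceq> compl p \<squnion> q"
    using assms(1) join_in[OF compl_in[OF assms(2)] assms(3)] unfolding is_lub_def by blast
  then show ?thesis using residuation[OF s assms(2,3)] meet_commute[of s p] by simp
qed

lemma meet_mono:
  assumes "a \<epsilon> B" "b \<epsilon> B" "c \<epsilon> B" "d \<epsilon> B" "a \<preceq> c" "b \<preceq> d" shows "a \<sqinter> b \<preceq> c \<sqinter> d"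
proof (rule meet_greatest)
  show "a \<sqinter> b \<preceq> c" by (rule le_trans[OF _ _ _ meet_le1[of a b]]) (simp_all add: assms meet_in)
  show "a \<sqinter> b \<preceq> d" by (rule le_trans[OF _ _ _ meet_le2[of a b]]) (simp_all add: assms meet_in)
qed (simp_all add: assms meet_in)

lemma glb_zero_iff: "a \<epsilon> B \<Longrightarrow> b \<epsilon> B \<Longrightarrow> (\<exists>z. is_lub {} z \<and> is_glb {a, b} z) \<longleftrightarrow> a \<sqinter> b = zero"
  using lub_zero is_lub_unique glb_meet is_glb_unique by metis

lemma is_glb_iff: "a \<epsilon> B \<Longrightarrow> b \<epsilon> B \<Longrightarrow> is_glb {a, b} s \<longleftrightarrow> s = a \<sqinter> b"
  using glb_meet is_glb_unique by blast

lemma is_lub_iff: "a \<epsilon> B \<Longrightarrow> b \<epsilon> B \<Longrightarrow> is_lub {a, b} s \<longleftrightarrow> s = a \<squnion> b"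
  using lub_join is_lub_unique by blast

lemma is_zero_iff: "is_lub {} z \<longleftrightarrow> z = zero" using lub_zero is_lub_unique by blast

lemma is_one_iff: "is_glb {} z \<longleftrightarrow> z = one" using glb_one is_glb_unique by blast

section \<open>Antichains\<close>

text \<open>Maximality in the sense of inclusion among the antichains of the model is the same as being predense:
  an element incompatible with all of \<open>A\<close> could be added to \<open>A\<close>.\<close>
lemma maximal_antichain_iff:
  "maximal_antichain A \<longleftrightarrow> antichain A \<and> (\<forall>b. b \<epsilon> B \<and> b \<noteq> zero \<longrightarrow> (\<exists>a. a \<epsilon> A \<and> a \<sqinter> b \<noteq> zero))"
proof (intro iffI conjI allI impI)
  assume max: "maximal_antichain A"
  then show anti: "antichain A" by (simp add: maximal_antichain_def)
  fix b assume b: "b \<epsilon> B \<and> b \<noteq> zero"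
  show "\<exists>a. a \<epsilon> A \<and> a \<sqinter> b \<noteq> zero"
  proof (rule ccontr)
    assume no: "\<not> (\<exists>a. a \<epsilon> A \<and> a \<sqinter> b \<noteq> zero)"
    obtain A' where A': "\<And>z. z \<epsilon> A' \<longleftrightarrow> z = b \<or> z \<epsilon> A" using adjoin by blast
    have *: "a \<sqinter> b = zero" "b \<sqinter> a = zero" if "a \<epsilon> A" for a
      using no that meet_commute[of b a] by auto
    have "antichain A'" unfolding antichain_def elts_def Ball_def mem_Collect_eq
    proof (intro conjI allI impI)
      fix x assume "x \<epsilon> A'"
      then show "x \<epsilon> B" "x \<noteq> zero"
        using anti b unfolding A' antichain_def elts_def Ball_def mem_Collect_eq by blast+
    next
      fix x y assume "x \<epsilon> A'" "y \<epsilon> A'" "x \<noteq> y"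
      then consider "x = b" "y \<epsilon> A" | "x \<epsilon> A" "y = b" | "x \<epsilon> A" "y \<epsilon> A" unfolding A' by blast
      then show "x \<sqinter> y = zero"
      proof cases
        case 3 then show ?thesis
          using anti \<open>x \<noteq> y\<close> unfolding antichain_def elts_def Ball_def mem_Collect_eq by blast
      qed (simp_all add: *)
    qed
    moreover have "elts A \<subseteq> elts A'" by (auto simp: elts_def A')
    ultimately have "A' = A" using max unfolding maximal_antichain_def by blast
    then have "b \<epsilon> A" using A' by blast
    moreover have "b \<sqinter> b = b" using b by (intro meet_absorb le_refl) auto
    ultimately show False using no b by metis
  qed
next
  assume A: "antichain A \<and> (\<forall>b. b \<epsilon> B \<and> b \<noteq> zero \<longrightarrow> (\<exists>a. a \<epsilon> A \<and> a \<sqinter> b \<noteq> zero))"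
  show "maximal_antichain A" unfolding maximal_antichain_def
  proof (intro conjI allI impI)
    fix A' assume A': "antichain A' \<and> elts A \<subseteq> elts A'"
    show "A' = A"
    proof (rule extensionality)
      fix b show "b \<epsilon> A' \<longleftrightarrow> b \<epsilon> A"
      proof
        assume b: "b \<epsilon> A'"
        then have "b \<epsilon> B \<and> b \<noteq> zero" using A' unfolding antichain_def elts_def by blast
        then obtain a where "a \<epsilon> A" "a \<sqinter> b \<noteq> zero" using A by blast
        moreover have "a \<epsilon> A'" using A' \<open>a \<epsilon> A\<close> unfolding elts_def by blast
        ultimately have "a = b" using A' b unfolding antichain_def elts_iff Ball_def by metis
        then show "b \<epsilon> A" using \<open>a \<epsilon> A\<close> by simp
      qed (use A' in \<open>auto simp: elts_def\<close>)
    qed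
  qed (use A in blast)
qed

text \<open>A set that is maximal among the pairwise incompatible sets of elements of a dense class is a maximal
  antichain of the whole algebra.\<close>
lemma antichain_below_dense:
  assumes D: "\<And>b. b \<epsilon> B \<Longrightarrow> b \<noteq> zero \<Longrightarrow> \<exists>d. d \<epsilon> B \<and> P d \<and> d \<noteq> zero \<and> d \<preceq> b"
    and def: "definable (\<lambda>e. P (e 0))"
  shows "\<exists>A. maximal_antichain A \<and> (\<forall>a. a \<epsilon> A \<longrightarrow> P a)"
proof -
  have "definable (\<lambda>e. P (e 0) \<and> e 0 \<noteq> zero)" by (intro codef def)
  then obtain D' where D': "\<And>d. d \<epsilon> D' \<longleftrightarrow> d \<epsilon> B \<and> P d \<and> d \<noteq> zero"
    using smallD[OF separation[of "\<lambda>d. P d \<and> d \<noteq> zero" B]] by blast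
  have "definable (\<lambda>e. \<exists>z. is_lub {} z \<and> is_glb {e 0, e 1} z)" by (intro codef)
  note * = maximal_independent_subset[of "\<lambda>a b. \<exists>z. is_lub {} z \<and> is_glb {a, b} z" D', OF this]
  obtain A where A: "\<And>a. a \<epsilon> A \<Longrightarrow> a \<epsilon> D'"
      and ind: "\<And>a b. a \<epsilon> A \<Longrightarrow> b \<epsilon> A \<Longrightarrow> a \<noteq> b \<Longrightarrow> \<exists>z. is_lub {} z \<and> is_glb {a, b} z"
      and max: "\<And>d. d \<epsilon> D' \<Longrightarrow> d \<epsilon> A \<or> (\<exists>a. a \<epsilon> A \<and> \<not> (\<exists>z. is_lub {} z \<and> is_glb {a, d} z))"
  proof -
    have "\<exists>z. is_lub {} z \<and> is_glb {b, a} z" if "\<exists>z. is_lub {} z \<and> is_glb {a, b} z" for a b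
      using that by (simp add: insert_commute)
    from *[OF this] show ?thesis using that by blast
  qed
  have inB: "a \<epsilon> B" if "a \<epsilon> A" for a using A[OF that] D' by blast
  have "antichain A" unfolding antichain_def elts_def Ball_def mem_Collect_eq
  proof (intro conjI allI impI)
    fix a b assume "a \<epsilon> A" "b \<epsilon> A" "a \<noteq> b"
    then show "a \<sqinter> b = zero" using ind glb_zero_iff[OF inB inB] by blast
  qed (use A D' in blast)+
  moreover have "\<exists>a. a \<epsilon> A \<and> a \<sqinter> b \<noteq> zero" if b: "b \<epsilon> B \<and> b \<noteq> zero" for b
  proof -
    obtain d where d: "d \<epsilon> B" "P d" "d \<noteq> zero" "d \<preceq> b" using D b by blast
    then have "d \<epsilon> D'" using D' by blast
    then have "\<exists>a. a \<epsilon> A \<and> a \<sqinter> d \<noteq> zero"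
      using max[of d] glb_zero_iff[of _ d] inB d meet_absorb[OF d(1,1) le_refl[OF d(1)]] by metis
    then obtain a where a: "a \<epsilon> A" "a \<sqinter> d \<noteq> zero" by blast
    have "a \<sqinter> d \<preceq> a \<sqinter> b" using inB[OF a(1)] d b le_refl by (intro meet_mono) auto
    then have "a \<sqinter> b \<noteq> zero" using a inB[OF a(1)] d b le_zero meet_in by metis
    then show ?thesis using a by blast
  qed
  ultimately have "maximal_antichain A" unfolding maximal_antichain_iff by blast
  then show ?thesis using A D' by blast
qed

end

section \<open>Boolean values as first-order relations\<close>

context internal_algebra begin

text \<open>First-order counterparts of \<open>mem_val\<close>, \<open>sub_val\<close>, \<open>eq_recursion\<close> and \<open>eq_value\<close>, with the function
  on pairs of names given by an element \<open>g\<close> of the structure.\<close>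
definition val_at :: "'a \<Rightarrow> 'a \<Rightarrow> 'a \<Rightarrow> 'a \<Rightarrow> bool" where
  "val_at g \<tau> \<sigma> u \<longleftrightarrow> (\<exists>p. is_pair \<tau> \<sigma> p \<and> pair_in p u g)"

definition mem_rel :: "'a \<Rightarrow> 'a \<Rightarrow> 'a \<Rightarrow> 'a \<Rightarrow> bool" where
  "mem_rel g \<tau> \<sigma> m \<longleftrightarrow>
     is_lub {s. \<exists>\<eta> b u. pair_in \<eta> b \<sigma> \<and> val_at g \<tau> \<eta> u \<and> is_glb {u, b} s} m"

definition sub_rel :: "'a \<Rightarrow> 'a \<Rightarrow> 'a \<Rightarrow> 'a \<Rightarrow> bool" where
  "sub_rel g \<tau> \<sigma> m \<longleftrightarrow>
     is_glb {s. \<exists>\<eta> b m1 m2 c. pair_in \<eta> b \<tau> \<and> mem_rel g \<eta> \<tau> m1 \<and> mem_rel g \<eta> \<sigma> m2 \<and>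
       is_compl m1 c \<and> is_lub {c, m2} s} m"

definition eq_step :: "'a \<Rightarrow> 'a \<Rightarrow> 'a \<Rightarrow> 'a \<Rightarrow> bool" where
  "eq_step g \<tau> \<sigma> y \<longleftrightarrow> (\<exists>s1 s2. sub_rel g \<tau> \<sigma> s1 \<and> sub_rel g \<sigma> \<tau> s2 \<and> is_glb {s1, s2} y)"

definition eq_rec :: "'a \<Rightarrow> 'a \<Rightarrow> bool" where
  "eq_rec T g \<longleftrightarrow> names_set T \<and> (\<exists>D. is_prod T T D \<and> is_fun g D) \<and>
     (\<forall>\<tau> \<sigma>. \<tau> \<epsilon> T \<and> \<sigma> \<epsilon> T \<longrightarrow> (\<exists>y. val_at g \<tau> \<sigma> y \<and> eq_step g \<tau> \<sigma> y))"

definition eq_rel :: "'a \<Rightarrow> 'a \<Rightarrow> 'a \<Rightarrow> bool" where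
  "eq_rel \<tau> \<sigma> y \<longleftrightarrow> (\<exists>T g. eq_rec T g \<and> \<tau> \<epsilon> T \<and> \<sigma> \<epsilon> T \<and> val_at g \<tau> \<sigma> y)"

definition mem_value_rel :: "'a \<Rightarrow> 'a \<Rightarrow> 'a \<Rightarrow> bool" where
  "mem_value_rel \<tau> \<sigma> y \<longleftrightarrow>
     is_lub {s. \<exists>\<eta> b u. pair_in \<eta> b \<sigma> \<and> eq_rel \<tau> \<eta> u \<and> is_glb {u, b} s} y"

definition check_rel :: "'a \<Rightarrow> 'a \<Rightarrow> bool" where
  "check_rel x z \<longleftrightarrow> (\<exists>T c. transitive_set T \<and> is_fun c T \<and>
     (\<forall>x cx. pair_in x cx c \<longrightarrow>
       (\<forall>p. p \<epsilon> cx \<longleftrightarrow> (\<exists>y cy u. y \<epsilon> x \<and> pair_in y cy c \<and> is_glb {} u \<and> is_pair cy u p))) \<and> pair_in x z c)"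

end

lemma codef_names_set [codef]:
  assumes "coterm j t t'"
  shows "codefinable E E' j (\<lambda>e. internal_algebra.names_set E B (t e))
    (\<lambda>e. internal_algebra.names_set E' (j B) (t' e))"
  by (rule codef_subst1[OF _ assms]) (unfold internal_algebra.names_set_def, intro codef)

lemma codef_names [codef]:
  assumes "coterm j t t'"
  shows "codefinable E E' j (\<lambda>e. t e \<in> internal_algebra.names E B)
    (\<lambda>e. t' e \<in> internal_algebra.names E' (j B))"
  by (rule codef_subst1[OF _ assms]) (unfold internal_algebra.names_def mem_Collect_eq, intro codef)

lemma codef_val_at [codef]:
  assumes "coterm j t t'" "coterm j u u'" "coterm j v v'" "coterm j w w'"
  shows "codefinable E E' j (\<lambda>e. internal_algebra.val_at E (t e) (u e) (v e) (w e))
    (\<lambda>e. internal_algebra.val_at E' (t' e) (u' e) (v' e) (w' e))"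
  by (rule codef_subst4[OF _ assms]) (unfold internal_algebra.val_at_def, intro codef)

lemma codef_mem_rel [codef]:
  assumes "coterm j t t'" "coterm j u u'" "coterm j v v'" "coterm j w w'"
  shows "codefinable E E' j (\<lambda>e. internal_algebra.mem_rel E B L (t e) (u e) (v e) (w e))
    (\<lambda>e. internal_algebra.mem_rel E' (j B) (j L) (t' e) (u' e) (v' e) (w' e))"
  by (rule codef_subst4[OF _ assms]) (unfold internal_algebra.mem_rel_def, intro codef)

lemma codef_sub_rel [codef]:
  assumes "coterm j t t'" "coterm j u u'" "coterm j v v'" "coterm j w w'"
  shows "codefinable E E' j (\<lambda>e. internal_algebra.sub_rel E B L (t e) (u e) (v e) (w e))
    (\<lambda>e. internal_algebra.sub_rel E' (j B) (j L) (t' e) (u' e) (v' e) (w' e))"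
  by (rule codef_subst4[OF _ assms]) (unfold internal_algebra.sub_rel_def, intro codef)

lemma codef_eq_step [codef]:
  assumes "coterm j t t'" "coterm j u u'" "coterm j v v'" "coterm j w w'"
  shows "codefinable E E' j (\<lambda>e. internal_algebra.eq_step E B L (t e) (u e) (v e) (w e))
    (\<lambda>e. internal_algebra.eq_step E' (j B) (j L) (t' e) (u' e) (v' e) (w' e))"
  by (rule codef_subst4[OF _ assms]) (unfold internal_algebra.eq_step_def, intro codef)

lemma codef_eq_rec [codef]:
  assumes "coterm j t t'" "coterm j u u'"
  shows "codefinable E E' j (\<lambda>e. internal_algebra.eq_rec E B L (t e) (u e))
    (\<lambda>e. internal_algebra.eq_rec E' (j B) (j L) (t' e) (u' e))"
  by (rule codef_subst2[OF _ assms]) (unfold internal_algebra.eq_rec_def, intro codef)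

lemma codef_eq_rel [codef]:
  assumes "coterm j t t'" "coterm j u u'" "coterm j v v'"
  shows "codefinable E E' j (\<lambda>e. internal_algebra.eq_rel E B L (t e) (u e) (v e))
    (\<lambda>e. internal_algebra.eq_rel E' (j B) (j L) (t' e) (u' e) (v' e))"
  by (rule codef_subst3[OF _ assms]) (unfold internal_algebra.eq_rel_def, intro codef)

lemma codef_mem_value_rel [codef]:
  assumes "coterm j t t'" "coterm j u u'" "coterm j v v'"
  shows "codefinable E E' j (\<lambda>e. internal_algebra.mem_value_rel E B L (t e) (u e) (v e))
    (\<lambda>e. internal_algebra.mem_value_rel E' (j B) (j L) (t' e) (u' e) (v' e))"
  by (rule codef_subst3[OF _ assms]) (unfold internal_algebra.mem_value_rel_def, intro codef)

lemma codef_check_rel [codef]: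
  assumes "coterm j t t'" "coterm j u u'"
  shows "codefinable E E' j (\<lambda>e. internal_algebra.check_rel E B L (t e) (u e))
    (\<lambda>e. internal_algebra.check_rel E' (j B) (j L) (t' e) (u' e))"
  by (rule codef_subst2[OF _ assms]) (unfold internal_algebra.check_rel_def, intro codef)

context cba_model begin

section \<open>Names\<close>

lemma names_setD:
  assumes "names_set T" "\<tau> \<epsilon> T" "pair_in \<eta> b \<tau>"
  shows "\<eta> \<epsilon> T \<and> b \<epsilon> B"
proof -
  obtain \<sigma> c where "\<sigma> \<epsilon> T" "c \<epsilon> B" "opair \<eta> b = opair \<sigma> c"
    using assms unfolding names_set_def pair_in_iff is_pair_iff by blast
  then show ?thesis by (simp add: opair_inject)
qed

lemma namesD:
  assumes "\<tau> \<in> names" "p \<epsilon> \<tau>"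
  shows "\<exists>\<sigma> b. \<sigma> \<in> names \<and> b \<epsilon> B \<and> is_pair \<sigma> b p"
proof -
  obtain T where T: "names_set T" "\<tau> \<epsilon> T" using assms(1) unfolding names_def by blast
  then obtain \<sigma> b where "\<sigma> \<epsilon> T" "b \<epsilon> B" "is_pair \<sigma> b p"
    using assms(2) unfolding names_set_def by blast
  moreover have "\<sigma> \<in> names" unfolding names_def using T(1) \<open>\<sigma> \<epsilon> T\<close> by blast
  ultimately show ?thesis by blast
qed

text \<open>Being a name is a local condition: if the components of \<open>\<tau>\<close> are names, then \<open>\<tau>\<close> and the names in its transitive
  closure form a closed set of names.\<close>
lemma names_iff: "\<tau> \<in> names \<longleftrightarrow> (\<forall>p. p \<epsilon> \<tau> \<longrightarrow> (\<exists>\<sigma> b. \<sigma> \<in> names \<and> b \<epsilon> B \<and> is_pair \<sigma> b p))"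
proof
  assume "\<tau> \<in> names"
  then show "\<forall>p. p \<epsilon> \<tau> \<longrightarrow> (\<exists>\<sigma> b. \<sigma> \<in> names \<and> b \<epsilon> B \<and> is_pair \<sigma> b p)"
    using namesD by blast
next
  assume \<tau>: "\<forall>p. p \<epsilon> \<tau> \<longrightarrow> (\<exists>\<sigma> b. \<sigma> \<in> names \<and> b \<epsilon> B \<and> is_pair \<sigma> b p)"
  obtain t where t: "transitive_set t" "\<tau> \<epsilon> t" using transitive_closure_exists by blast
  have "definable (\<lambda>e. e 0 \<in> names)" by (intro codef)
  then obtain T0 where T0: "\<And>z. z \<epsilon> T0 \<longleftrightarrow> z \<epsilon> t \<and> z \<in> names"
    using smallD[OF separation[of "\<lambda>z. z \<in> names" t]] by blast
  obtain T where T: "\<And>z. z \<epsilon> T \<longleftrightarrow> z = \<tau> \<or> z \<epsilon> T0" using adjoin by blast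
  have "names_set T"
    unfolding names_set_def
  proof (intro allI impI)
    fix \<rho> p assume \<rho>: "\<rho> \<epsilon> T" "p \<epsilon> \<rho>"
    have "\<exists>\<sigma> b. \<sigma> \<in> names \<and> b \<epsilon> B \<and> is_pair \<sigma> b p"
    proof (cases "\<rho> = \<tau>")
      case False
      then have "\<rho> \<in> names" using \<rho>(1) unfolding T T0 by simp
      then show ?thesis using namesD \<rho>(2) by blast
    qed (use \<tau> \<rho> in blast)
    then obtain \<sigma> b where \<sigma>: "\<sigma> \<in> names" "b \<epsilon> B" "is_pair \<sigma> b p" by blast
    have "\<rho> \<epsilon> t" using \<rho>(1) t(2) unfolding T T0 by auto
    then have "p \<epsilon> t" using \<rho>(2) t unfolding transitive_set_def by blast
    moreover obtain u where "u \<epsilon> p" "\<sigma> \<epsilon> u" using pair_components \<sigma>(3) unfolding is_pair_iff by blast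
    ultimately have "\<sigma> \<epsilon> t" using t unfolding transitive_set_def by blast
    then show "\<exists>\<sigma> b. \<sigma> \<epsilon> T \<and> b \<epsilon> B \<and> is_pair \<sigma> b p" unfolding T T0 using \<sigma> by blast
  qed
  then show "\<tau> \<in> names" unfolding names_def using T by blast
qed

lemma names_pair:
  assumes "\<tau> \<in> names" "pair_in \<eta> b \<tau>" shows "\<eta> \<in> names \<and> b \<epsilon> B"
proof -
  obtain \<sigma> c where "\<sigma> \<in> names" "c \<epsilon> B" "opair \<eta> b = opair \<sigma> c"
    using namesD[OF assms(1)] assms(2) unfolding pair_in_iff is_pair_iff by blast
  then show ?thesis by (simp add: opair_inject)
qed

lemma names_set_Un:
  assumes "names_set T1" "names_set T2" "\<And>z. z \<epsilon> T \<longleftrightarrow> z \<epsilon> T1 \<or> z \<epsilon> T2"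
  shows "names_set T"
  unfolding names_set_def
proof (intro allI impI)
  fix \<rho> p assume "\<rho> \<epsilon> T" and p: "p \<epsilon> \<rho>"
  then consider "\<rho> \<epsilon> T1" | "\<rho> \<epsilon> T2" using assms(3) by blast
  then obtain \<sigma> b where "\<sigma> \<epsilon> T1 \<or> \<sigma> \<epsilon> T2" "b \<epsilon> B" "is_pair \<sigma> b p"
  proof cases
    case 1 then show ?thesis using assms(1) p that unfolding names_set_def by blast
  next
    case 2 then show ?thesis using assms(2) p that unfolding names_set_def by blast
  qed
  then show "\<exists>\<sigma> b. \<sigma> \<epsilon> T \<and> b \<epsilon> B \<and> is_pair \<sigma> b p" using assms(3) by blast
qed

lemma names_set_common:
  assumes "\<tau> \<in> names" "\<sigma> \<in> names" obtains T where "names_set T" "\<tau> \<epsilon> T" "\<sigma> \<epsilon> T"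
proof -
  obtain T1 T2 where T: "names_set T1" "\<tau> \<epsilon> T1" "names_set T2" "\<sigma> \<epsilon> T2"
    using assms unfolding names_def by blast
  obtain T where "\<And>z. z \<epsilon> T \<longleftrightarrow> z \<in> elts T1 \<union> elts T2"
    using small_Un[OF small_elts small_elts, of T1 T2] smallE by metis
  then have T': "z \<epsilon> T \<longleftrightarrow> z \<epsilon> T1 \<or> z \<epsilon> T2" for z by (simp add: elts_def)
  show ?thesis using that[OF names_set_Un[OF T(1,3) T']] T(2,4) T' by simp
qed

lemma val_at_iff: "val_at g \<tau> \<sigma> u \<longleftrightarrow> pair_in (opair \<tau> \<sigma>) u g"
  by (simp add: val_at_def is_pair_iff)

section \<open>The recursion for Boolean values\<close>

text \<open>Here and in the next lemmas, the relational form determines the same value as the definite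
  description, provided that the values from which it is computed exist and are in \<open>B\<close>.\<close>
lemma mem_val_lub:
  assumes B: "\<And>\<eta> b. pair_in \<eta> b \<sigma> \<Longrightarrow> b \<epsilon> B" and G: "\<And>\<eta> b. pair_in \<eta> b \<sigma> \<Longrightarrow> G \<tau> \<eta> \<epsilon> B"
    and R: "\<And>\<eta> b u. pair_in \<eta> b \<sigma> \<Longrightarrow> R \<tau> \<eta> u \<longleftrightarrow> u = G \<tau> \<eta>"
    and def: "definable (\<lambda>e. R (e 0) (e 1) (e 2))"
  shows "is_lub {G \<tau> \<eta> \<sqinter> b | \<eta> b. pair_in \<eta> b \<sigma>} (mem_val G \<tau> \<sigma>)"
    and "is_lub {s. \<exists>\<eta> b u. pair_in \<eta> b \<sigma> \<and> R \<tau> \<eta> u \<and> is_glb {u, b} s} m \<longleftrightarrow> m = mem_val G \<tau> \<sigma>"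
proof -
  let ?S = "{s. \<exists>\<eta> b u. pair_in \<eta> b \<sigma> \<and> R \<tau> \<eta> u \<and> is_glb {u, b} s}"
  have eq: "?S = {G \<tau> \<eta> \<sqinter> b | \<eta> b. pair_in \<eta> b \<sigma>}"
    using R is_glb_iff[OF G B] by fastforce
  have "definable (\<lambda>e. e 0 \<in> ?S)" unfolding mem_Collect_eq by (intro codef codef_subst3[OF def])
  moreover have "?S \<subseteq> elts B" unfolding elts_def is_glb_def by blast
  ultimately have lub: "is_lub ?S (mem_val G \<tau> \<sigma>)"
    unfolding mem_val_def eq[symmetric] by (intro lub_bsup)
  then show "is_lub {G \<tau> \<eta> \<sqinter> b | \<eta> b. pair_in \<eta> b \<sigma>} (mem_val G \<tau> \<sigma>)" unfolding eq .
  show "is_lub ?S m \<longleftrightarrow> m = mem_val G \<tau> \<sigma>" using lub is_lub_unique by blast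
qed

lemma is_lub_in: "is_lub S s \<Longrightarrow> s \<epsilon> B" by (simp add: is_lub_def)
lemma is_glb_in: "is_glb S s \<Longrightarrow> s \<epsilon> B" by (simp add: is_glb_def)

lemma sub_val_glb:
  assumes B: "\<And>\<eta> b. pair_in \<eta> b \<tau> \<or> pair_in \<eta> b \<sigma> \<Longrightarrow> b \<epsilon> B"
    and G: "\<And>\<eta> \<theta> b c. pair_in \<eta> b \<tau> \<or> pair_in \<eta> b \<sigma> \<Longrightarrow> pair_in \<theta> c \<tau> \<or> pair_in \<theta> c \<sigma> \<Longrightarrow>
      G \<eta> \<theta> \<epsilon> B \<and> (\<forall>u. val_at g \<eta> \<theta> u \<longleftrightarrow> u = G \<eta> \<theta>)"
  shows "is_glb {compl (mem_val G \<eta> \<tau>) \<squnion> mem_val G \<eta> \<sigma> | \<eta>. \<exists>b. pair_in \<eta> b \<tau>} (sub_val G \<tau> \<sigma>)"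
    and "sub_rel g \<tau> \<sigma> m \<longleftrightarrow> m = sub_val G \<tau> \<sigma>"
proof -
  have def: "definable (\<lambda>e. val_at g (e 0) (e 1) (e 2))" by (intro codef)
  have m1: "mem_rel g \<eta> \<tau> m \<longleftrightarrow> m = mem_val G \<eta> \<tau>" "mem_val G \<eta> \<tau> \<epsilon> B"
    and m2: "mem_rel g \<eta> \<sigma> m \<longleftrightarrow> m = mem_val G \<eta> \<sigma>" "mem_val G \<eta> \<sigma> \<epsilon> B"
    if \<eta>: "pair_in \<eta> b \<tau>" for \<eta> b m
  proof -
    have "b \<epsilon> B" if "pair_in \<theta> b \<rho>" "\<rho> = \<tau> \<or> \<rho> = \<sigma>" for \<theta> b \<rho>
      using B that by blast
    moreover have "G \<eta> \<theta> \<epsilon> B" "val_at g \<eta> \<theta> u \<longleftrightarrow> u = G \<eta> \<theta>"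
      if "pair_in \<theta> c \<rho>" "\<rho> = \<tau> \<or> \<rho> = \<sigma>" for \<theta> c u \<rho>
      using G[of \<eta> b \<theta> c] \<eta> that by blast+
    ultimately have *: "is_lub {G \<eta> \<theta> \<sqinter> c | \<theta> c. pair_in \<theta> c \<rho>} (mem_val G \<eta> \<rho>) \<and>
        (mem_rel g \<eta> \<rho> m \<longleftrightarrow> m = mem_val G \<eta> \<rho>)" if "\<rho> = \<tau> \<or> \<rho> = \<sigma>" for \<rho> m
      unfolding mem_rel_def using that
      by (intro conjI mem_val_lub[where R = "val_at g" and G = G, OF _ _ _ def])
    show "mem_rel g \<eta> \<tau> m \<longleftrightarrow> m = mem_val G \<eta> \<tau>" using *[of \<tau> m] by simp
    show "mem_rel g \<eta> \<sigma> m \<longleftrightarrow> m = mem_val G \<eta> \<sigma>" using *[of \<sigma> m] by simp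
    show "mem_val G \<eta> \<tau> \<epsilon> B" using *[of \<tau>] by (blast intro: is_lub_in)
    show "mem_val G \<eta> \<sigma> \<epsilon> B" using *[of \<sigma>] by (blast intro: is_lub_in)
  qed
  let ?S = "{s. \<exists>\<eta> b m1 m2 c. pair_in \<eta> b \<tau> \<and> mem_rel g \<eta> \<tau> m1 \<and> mem_rel g \<eta> \<sigma> m2 \<and>
       is_compl m1 c \<and> is_lub {c, m2} s}"
  have eq: "?S = {compl (mem_val G \<eta> \<tau>) \<squnion> mem_val G \<eta> \<sigma> | \<eta>. \<exists>b. pair_in \<eta> b \<tau>}"
  proof (intro set_eqI iffI)
    fix s assume "s \<in> ?S"
    then obtain \<eta> b m1 m2 c where *: "pair_in \<eta> b \<tau>" "mem_rel g \<eta> \<tau> m1" "mem_rel g \<eta> \<sigma> m2"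
       "is_compl m1 c" "is_lub {c, m2} s" by blast
    then have "m1 = mem_val G \<eta> \<tau>" "m2 = mem_val G \<eta> \<sigma>" "c = compl m1"
      using m1[OF *(1)] m2[OF *(1)] is_compl_iff by auto
    then have "s = compl (mem_val G \<eta> \<tau>) \<squnion> mem_val G \<eta> \<sigma>"
      using is_lub_iff[OF compl_in[OF m1(2)[OF *(1)]] m2(2)[OF *(1)]] *(5) by simp
    then show "s \<in> {compl (mem_val G \<eta> \<tau>) \<squnion> mem_val G \<eta> \<sigma> | \<eta>. \<exists>b. pair_in \<eta> b \<tau>}" using *(1) by blast
  next
    fix s assume "s \<in> {compl (mem_val G \<eta> \<tau>) \<squnion> mem_val G \<eta> \<sigma> | \<eta>. \<exists>b. pair_in \<eta> b \<tau>}"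
    then obtain \<eta> b where *: "pair_in \<eta> b \<tau>" "s = compl (mem_val G \<eta> \<tau>) \<squnion> mem_val G \<eta> \<sigma>" by blast
    have "mem_rel g \<eta> \<tau> (mem_val G \<eta> \<tau>)" "mem_rel g \<eta> \<sigma> (mem_val G \<eta> \<sigma>)"
      "is_compl (mem_val G \<eta> \<tau>) (compl (mem_val G \<eta> \<tau>))" "is_lub {compl (mem_val G \<eta> \<tau>), mem_val G \<eta> \<sigma>} s"
      using m1[OF *(1)] m2[OF *(1)] is_compl_iff is_lub_iff[OF compl_in] *(2) by auto
    then show "s \<in> ?S" using *(1) by blast
  qed
  have "definable (\<lambda>e. e 0 \<in> ?S)" unfolding mem_Collect_eq by (intro codef)
  moreover have "?S \<subseteq> elts B" unfolding elts_def is_lub_def by blast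
  ultimately have glb: "is_glb ?S (sub_val G \<tau> \<sigma>)"
    unfolding sub_val_def eq[symmetric] by (intro glb_binf)
  then show "is_glb {compl (mem_val G \<eta> \<tau>) \<squnion> mem_val G \<eta> \<sigma> | \<eta>. \<exists>b. pair_in \<eta> b \<tau>} (sub_val G \<tau> \<sigma>)"
    unfolding eq .
  show "sub_rel g \<tau> \<sigma> m \<longleftrightarrow> m = sub_val G \<tau> \<sigma>" unfolding sub_rel_def using glb is_glb_unique by blast
qed

lemma eq_step_iff:
  assumes B: "\<And>\<eta> b. pair_in \<eta> b \<tau> \<or> pair_in \<eta> b \<sigma> \<Longrightarrow> b \<epsilon> B"
    and G: "\<And>\<eta> \<theta> b c. pair_in \<eta> b \<tau> \<or> pair_in \<eta> b \<sigma> \<Longrightarrow> pair_in \<theta> c \<tau> \<or> pair_in \<theta> c \<sigma> \<Longrightarrow>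
      G \<eta> \<theta> \<epsilon> B \<and> (\<forall>u. val_at g \<eta> \<theta> u \<longleftrightarrow> u = G \<eta> \<theta>)"
  shows "eq_step g \<tau> \<sigma> y \<longleftrightarrow> y = sub_val G \<tau> \<sigma> \<sqinter> sub_val G \<sigma> \<tau>"
    and "sub_val G \<tau> \<sigma> \<sqinter> sub_val G \<sigma> \<tau> \<epsilon> B"
proof -
  have B': "\<And>\<eta> b. pair_in \<eta> b \<sigma> \<or> pair_in \<eta> b \<tau> \<Longrightarrow> b \<epsilon> B" using B by blast
  have G': "\<And>\<eta> \<theta> b c. pair_in \<eta> b \<sigma> \<or> pair_in \<eta> b \<tau> \<Longrightarrow> pair_in \<theta> c \<sigma> \<or> pair_in \<theta> c \<tau> \<Longrightarrow>
      G \<eta> \<theta> \<epsilon> B \<and> (\<forall>u. val_at g \<eta> \<theta> u \<longleftrightarrow> u = G \<eta> \<theta>)" using G by blast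
  have r: "sub_rel g \<tau> \<sigma> m \<longleftrightarrow> m = sub_val G \<tau> \<sigma>" "sub_rel g \<sigma> \<tau> m \<longleftrightarrow> m = sub_val G \<sigma> \<tau>" for m
    by (rule sub_val_glb(2); fact B G B' G')+
  have s: "sub_val G \<tau> \<sigma> \<epsilon> B" "sub_val G \<sigma> \<tau> \<epsilon> B"
    using r unfolding sub_rel_def by (blast intro: is_glb_in)+
  show "eq_step g \<tau> \<sigma> y \<longleftrightarrow> y = sub_val G \<tau> \<sigma> \<sqinter> sub_val G \<sigma> \<tau>"
    unfolding eq_step_def r using is_glb_iff[OF s] by blast
  show "sub_val G \<tau> \<sigma> \<sqinter> sub_val G \<sigma> \<tau> \<epsilon> B" using s by (rule meet_in)
qed

lemma eq_step_cong:
  assumes "\<And>\<eta> \<theta> b c u. pair_in \<eta> b \<tau> \<or> pair_in \<eta> b \<sigma> \<Longrightarrow> pair_in \<theta> c \<tau> \<or> pair_in \<theta> c \<sigma> \<Longrightarrow>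
      val_at g \<eta> \<theta> u \<longleftrightarrow> val_at g' \<eta> \<theta> u"
  shows "eq_step g \<tau> \<sigma> y \<longleftrightarrow> eq_step g' \<tau> \<sigma> y"
proof -
  have m: "mem_rel g \<eta> \<tau> = mem_rel g' \<eta> \<tau>" "mem_rel g \<eta> \<sigma> = mem_rel g' \<eta> \<sigma>"
    if "pair_in \<eta> b \<tau> \<or> pair_in \<eta> b \<sigma>" for \<eta> b
  proof -
    have "{s. \<exists>\<theta> c u. pair_in \<theta> c \<tau> \<and> val_at g \<eta> \<theta> u \<and> is_glb {u, c} s} =
        {s. \<exists>\<theta> c u. pair_in \<theta> c \<tau> \<and> val_at g' \<eta> \<theta> u \<and> is_glb {u, c} s}"
      using assms[OF that] by blast
    then show "mem_rel g \<eta> \<tau> = mem_rel g' \<eta> \<tau>" by (simp add: fun_eq_iff mem_rel_def)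
    have "{s. \<exists>\<theta> c u. pair_in \<theta> c \<sigma> \<and> val_at g \<eta> \<theta> u \<and> is_glb {u, c} s} =
        {s. \<exists>\<theta> c u. pair_in \<theta> c \<sigma> \<and> val_at g' \<eta> \<theta> u \<and> is_glb {u, c} s}"
      using assms[OF that] by blast
    then show "mem_rel g \<eta> \<sigma> = mem_rel g' \<eta> \<sigma>" by (simp add: fun_eq_iff mem_rel_def)
  qed
  note m1 = m[OF disjI1, THEN fun_cong] and m2 = m[OF disjI2, THEN fun_cong]
  have "{s. \<exists>\<eta> b m1 m2 c. pair_in \<eta> b \<tau> \<and> mem_rel g \<eta> \<tau> m1 \<and> mem_rel g \<eta> \<sigma> m2 \<and> is_compl m1 c \<and> is_lub {c, m2} s} =
      {s. \<exists>\<eta> b m1 m2 c. pair_in \<eta> b \<tau> \<and> mem_rel g' \<eta> \<tau> m1 \<and> mem_rel g' \<eta> \<sigma> m2 \<and> is_compl m1 c \<and> is_lub {c, m2} s}"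
    by (intro Collect_cong ex_cong1 conj_cong refl) (erule m1)+
  then have 1: "sub_rel g \<tau> \<sigma> = sub_rel g' \<tau> \<sigma>" by (simp add: fun_eq_iff sub_rel_def)
  have "{s. \<exists>\<eta> b m1 m2 c. pair_in \<eta> b \<sigma> \<and> mem_rel g \<eta> \<sigma> m1 \<and> mem_rel g \<eta> \<tau> m2 \<and> is_compl m1 c \<and> is_lub {c, m2} s} =
      {s. \<exists>\<eta> b m1 m2 c. pair_in \<eta> b \<sigma> \<and> mem_rel g' \<eta> \<sigma> m1 \<and> mem_rel g' \<eta> \<tau> m2 \<and> is_compl m1 c \<and> is_lub {c, m2} s}"
    by (intro Collect_cong ex_cong1 conj_cong refl) (erule m2)+
  then have 2: "sub_rel g \<sigma> \<tau> = sub_rel g' \<sigma> \<tau>" by (simp add: fun_eq_iff sub_rel_def)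
  show ?thesis unfolding eq_step_def 1 2 ..
qed

lemma eq_step_unique: "eq_step g \<tau> \<sigma> y \<Longrightarrow> eq_step g \<tau> \<sigma> y' \<Longrightarrow> y = y'"
proof -
  assume "eq_step g \<tau> \<sigma> y" "eq_step g \<tau> \<sigma> y'"
  then obtain s1 s2 t1 t2 where *: "sub_rel g \<tau> \<sigma> s1" "sub_rel g \<sigma> \<tau> s2" "is_glb {s1, s2} y"
    "sub_rel g \<tau> \<sigma> t1" "sub_rel g \<sigma> \<tau> t2" "is_glb {t1, t2} y'"
    unfolding eq_step_def by blast
  then have "s1 = t1" "s2 = t2" unfolding sub_rel_def using is_glb_unique by blast+
  with *(3,6) show "y = y'" using is_glb_unique by blast
qed

lemma eq_step_in: "eq_step g \<tau> \<sigma> y \<Longrightarrow> y \<epsilon> B"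
  unfolding eq_step_def by (auto intro: is_glb_in)

end

context cba_model begin

lemma val_at_app:
  assumes "is_prod T T D" "is_fun g D" "\<tau> \<epsilon> T" "\<sigma> \<epsilon> T"
  shows "val_at g \<tau> \<sigma> u \<longleftrightarrow> u = app g (opair \<tau> \<sigma>)"
proof -
  have "opair \<tau> \<sigma> \<epsilon> D" using assms(1,3,4) is_pair_opair unfolding is_prod_def by blast
  then show ?thesis unfolding val_at_iff using app_eq[OF assms(2)] by auto
qed

lemma eq_recD:
  assumes "eq_rec T g"
  shows "names_set T"
    and "\<tau> \<epsilon> T \<Longrightarrow> \<sigma> \<epsilon> T \<Longrightarrow> val_at g \<tau> \<sigma> u \<longleftrightarrow> u = app g (opair \<tau> \<sigma>)"
    and "\<tau> \<epsilon> T \<Longrightarrow> \<sigma> \<epsilon> T \<Longrightarrow> eq_step g \<tau> \<sigma> (app g (opair \<tau> \<sigma>))"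
proof -
  show "names_set T" using assms unfolding eq_rec_def by blast
  obtain D where D: "is_prod T T D" "is_fun g D" using assms unfolding eq_rec_def by blast
  show "val_at g \<tau> \<sigma> u \<longleftrightarrow> u = app g (opair \<tau> \<sigma>)" if "\<tau> \<epsilon> T" "\<sigma> \<epsilon> T" for \<tau> \<sigma> u
    by (rule val_at_app[OF D that])
  show "eq_step g \<tau> \<sigma> (app g (opair \<tau> \<sigma>))" if \<tau>: "\<tau> \<epsilon> T" "\<sigma> \<epsilon> T"
  proof -
    obtain y where "val_at g \<tau> \<sigma> y" "eq_step g \<tau> \<sigma> y" using assms \<tau> unfolding eq_rec_def by blast
    then show ?thesis using val_at_app[OF D \<tau>] by simp
  qed
qed

text \<open>A solution in the sense of the definite descriptions could a priori take values outside
  \<open>B\<close>, for which the Boolean operations are unspecified. By induction on pairs this does not happen, so it suffices to verify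
  the step under the assumption that the relational and the functional form agree.\<close>
lemma eq_recI:
  assumes T: "names_set T" and D: "is_prod T T D" "is_fun g D"
    and G: "G = (\<lambda>\<tau> \<sigma>. app g (opair \<tau> \<sigma>))"
    and step: "\<And>\<tau> \<sigma>. \<tau> \<epsilon> T \<Longrightarrow> \<sigma> \<epsilon> T \<Longrightarrow>
      (\<And>y. eq_step g \<tau> \<sigma> y \<longleftrightarrow> y = sub_val G \<tau> \<sigma> \<sqinter> sub_val G \<sigma> \<tau>) \<Longrightarrow> eq_step g \<tau> \<sigma> (G \<tau> \<sigma>)"
  shows "eq_rec T g"
proof -
  have val: "val_at g \<tau> \<sigma> u \<longleftrightarrow> u = G \<tau> \<sigma>" if "\<tau> \<epsilon> T" "\<sigma> \<epsilon> T" for \<tau> \<sigma> u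
    unfolding G by (rule val_at_app[OF D that])
  let ?P = "\<lambda>\<tau> \<sigma>. \<tau> \<epsilon> T \<and> \<sigma> \<epsilon> T \<longrightarrow> (\<exists>y. val_at g \<tau> \<sigma> y \<and> eq_step g \<tau> \<sigma> y)"
  have "?P \<tau> \<sigma>" for \<tau> \<sigma>
  proof (rule dom_pair_induct[where P = ?P])
    show "definable (\<lambda>e. ?P (e 0) (e 1))" by (intro codef)
    fix \<tau> \<sigma>
    assume IH: "\<And>\<eta> \<theta> b c. pair_in \<eta> b \<tau> \<or> pair_in \<eta> b \<sigma> \<Longrightarrow> pair_in \<theta> c \<tau> \<or> pair_in \<theta> c \<sigma> \<Longrightarrow> ?P \<eta> \<theta>"
    show "?P \<tau> \<sigma>"
    proof
      assume \<tau>: "\<tau> \<epsilon> T \<and> \<sigma> \<epsilon> T"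
      have dom: "\<eta> \<epsilon> T \<and> b \<epsilon> B" if "pair_in \<eta> b \<tau> \<or> pair_in \<eta> b \<sigma>" for \<eta> b
        using that \<tau> names_setD[OF T] by blast
      have B: "b \<epsilon> B" if "pair_in \<eta> b \<tau> \<or> pair_in \<eta> b \<sigma>" for \<eta> b
        using dom[OF that] by blast
      have good: "G \<eta> \<theta> \<epsilon> B \<and> (\<forall>u. val_at g \<eta> \<theta> u \<longleftrightarrow> u = G \<eta> \<theta>)"
        if *: "pair_in \<eta> b \<tau> \<or> pair_in \<eta> b \<sigma>" "pair_in \<theta> c \<tau> \<or> pair_in \<theta> c \<sigma>" for \<eta> \<theta> b c
      proof -
        have 1: "\<eta> \<epsilon> T" "\<theta> \<epsilon> T" using dom * by blast+
        then obtain y where "val_at g \<eta> \<theta> y" "eq_step g \<eta> \<theta> y" using IH[OF *] by blast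
        then show ?thesis using val[OF 1] eq_step_in by simp
      qed
      have "eq_step g \<tau> \<sigma> (G \<tau> \<sigma>)"
        by (rule step[OF conjunct1[OF \<tau>] conjunct2[OF \<tau>]], rule eq_step_iff(1); fact B good)
      then show "\<exists>y. val_at g \<tau> \<sigma> y \<and> eq_step g \<tau> \<sigma> y" using val[of \<tau> \<sigma>] \<tau> by blast
    qed
  qed
  then show ?thesis unfolding eq_rec_def using T D by blast
qed

lemma eq_rec_equation:
  assumes g: "eq_rec T g" and \<tau>: "\<tau> \<epsilon> T" "\<sigma> \<epsilon> T"
    and G: "\<And>\<eta> \<theta>. \<eta> \<epsilon> T \<Longrightarrow> \<theta> \<epsilon> T \<Longrightarrow> G \<eta> \<theta> = app g (opair \<eta> \<theta>)"
  shows "G \<tau> \<sigma> = sub_val G \<tau> \<sigma> \<sqinter> sub_val G \<sigma> \<tau>"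
    and "is_glb {compl (mem_val G \<eta> \<tau>) \<squnion> mem_val G \<eta> \<sigma> | \<eta>. \<exists>b. pair_in \<eta> b \<tau>} (sub_val G \<tau> \<sigma>)"
proof -
  have dom: "\<eta> \<epsilon> T \<and> b \<epsilon> B" if "pair_in \<eta> b \<tau> \<or> pair_in \<eta> b \<sigma>" for \<eta> b
    using that \<tau> names_setD[OF eq_recD(1)[OF g]] by blast
  have B: "b \<epsilon> B" if "pair_in \<eta> b \<tau> \<or> pair_in \<eta> b \<sigma>" for \<eta> b
    using dom[OF that] by blast
  have good: "G \<eta> \<theta> \<epsilon> B \<and> (\<forall>u. val_at g \<eta> \<theta> u \<longleftrightarrow> u = G \<eta> \<theta>)"
    if *: "pair_in \<eta> b \<tau> \<or> pair_in \<eta> b \<sigma>" "pair_in \<theta> c \<tau> \<or> pair_in \<theta> c \<sigma>" for \<eta> \<theta> b c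
  proof -
    have 1: "\<eta> \<epsilon> T" "\<theta> \<epsilon> T" using dom * by blast+
    then show ?thesis using eq_recD(2)[OF g 1] eq_step_in[OF eq_recD(3)[OF g 1]] G[OF 1] by simp
  qed
  have st: "eq_step g \<tau> \<sigma> y \<longleftrightarrow> y = sub_val G \<tau> \<sigma> \<sqinter> sub_val G \<sigma> \<tau>" for y
    by (rule eq_step_iff(1); fact B good)
  show "G \<tau> \<sigma> = sub_val G \<tau> \<sigma> \<sqinter> sub_val G \<sigma> \<tau>"
    using eq_recD(3)[OF g \<tau>] G[OF \<tau>] unfolding st by simp
  show "is_glb {compl (mem_val G \<eta> \<tau>) \<squnion> mem_val G \<eta> \<sigma> | \<eta>. \<exists>b. pair_in \<eta> b \<tau>} (sub_val G \<tau> \<sigma>)"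
    by (rule sub_val_glb(1)[where g = g]; fact B good)
qed

text \<open>The recursion theorem on the set of pairs from \<open>T\<close>. The step must be total: if the relational step
  has no value, it is given the value \<open>zero\<close>, which by \<open>eq_recI\<close> does not occur.\<close>
lemma eq_rec_exists:
  assumes T: "names_set T" shows "\<exists>g. eq_rec T g"
proof -
  obtain D where D: "is_prod T T D" using prod_exists by blast
  define R where "R p q \<longleftrightarrow> (\<exists>\<eta> \<theta> \<tau> \<sigma> b c. is_pair \<eta> \<theta> p \<and> is_pair \<tau> \<sigma> q \<and>
    (pair_in \<eta> b \<tau> \<or> pair_in \<eta> b \<sigma>) \<and> (pair_in \<theta> c \<tau> \<or> pair_in \<theta> c \<sigma>))" for p q
  define H where "H q g y \<longleftrightarrow> (\<exists>\<tau> \<sigma>. is_pair \<tau> \<sigma> q \<and> eq_step g \<tau> \<sigma> y) \<or>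
    (\<not> (\<exists>\<tau> \<sigma> y. is_pair \<tau> \<sigma> q \<and> eq_step g \<tau> \<sigma> y) \<and> y = zero)" for q g y
  have H_pair: "H (opair \<tau> \<sigma>) g y \<longleftrightarrow> eq_step g \<tau> \<sigma> y \<or> (\<not> (\<exists>y. eq_step g \<tau> \<sigma> y) \<and> y = zero)" for \<tau> \<sigma> g y
    unfolding H_def is_pair_iff opair_inject by auto
  have D_iff: "q \<epsilon> D \<longleftrightarrow> (\<exists>\<tau> \<sigma>. \<tau> \<epsilon> T \<and> \<sigma> \<epsilon> T \<and> q = opair \<tau> \<sigma>)" for q
    using D unfolding is_prod_def is_pair_iff by blast
  have "\<exists>g. is_fun g D \<and> (\<forall>q y. pair_in q y g \<longrightarrow> H q g y)"
  proof (rule recursion[where R = R])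
    show "founded_on D R" unfolding founded_on_def
    proof (intro allI impI, rule ccontr)
      fix S assume S: "(\<exists>x. x \<epsilon> S) \<and> (\<forall>x. x \<epsilon> S \<longrightarrow> x \<epsilon> D)"
        and no: "\<not> (\<exists>m. m \<epsilon> S \<and> (\<forall>y. y \<epsilon> S \<longrightarrow> \<not> R y m))"
      have "\<not> (\<exists>p. is_pair \<tau> \<sigma> p \<and> p \<epsilon> S)" for \<tau> \<sigma>
      proof (rule dom_pair_induct[where P = "\<lambda>\<tau> \<sigma>. \<not> (\<exists>p. is_pair \<tau> \<sigma> p \<and> p \<epsilon> S)"])
        show "definable (\<lambda>e. \<not> (\<exists>p. is_pair (e 0) (e 1) p \<and> p \<epsilon> S))" by (intro codef)
        fix \<tau> \<sigma>
        assume IH: "\<And>\<eta> \<theta> b c. pair_in \<eta> b \<tau> \<or> pair_in \<eta> b \<sigma> \<Longrightarrow> pair_in \<theta> c \<tau> \<or> pair_in \<theta> c \<sigma> \<Longrightarrow>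
          \<not> (\<exists>p. is_pair \<eta> \<theta> p \<and> p \<epsilon> S)"
        show "\<not> (\<exists>p. is_pair \<tau> \<sigma> p \<and> p \<epsilon> S)"
        proof
          assume "\<exists>p. is_pair \<tau> \<sigma> p \<and> p \<epsilon> S"
          then obtain p where p: "is_pair \<tau> \<sigma> p" "p \<epsilon> S" by blast
          then obtain q where q: "q \<epsilon> S" "R q p" using no by blast
          then obtain \<eta> \<theta> \<tau>' \<sigma>' b c where *: "is_pair \<eta> \<theta> q" "is_pair \<tau>' \<sigma>' p"
            "pair_in \<eta> b \<tau>' \<or> pair_in \<eta> b \<sigma>'" "pair_in \<theta> c \<tau>' \<or> pair_in \<theta> c \<sigma>'" unfolding R_def by blast
          then have "\<tau>' = \<tau>" "\<sigma>' = \<sigma>" using p(1) unfolding is_pair_iff by (simp_all add: opair_inject)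
          then show False using IH * q(1) by blast
        qed
      qed
      then show False using S unfolding D_iff is_pair_iff by blast
    qed
    show "definable (\<lambda>e. R (e 0) (e 1))" unfolding R_def by (intro codef)
    show "definable (\<lambda>e. H (e 0) (e 1) (e 2))" unfolding H_def by (intro codef)
  next
    fix q g assume "q \<epsilon> D"
    then obtain \<tau> \<sigma> where q: "q = opair \<tau> \<sigma>" unfolding D_iff by blast
    show "\<exists>!y. H q g y" unfolding q H_pair
    proof (cases "\<exists>y. eq_step g \<tau> \<sigma> y")
      case True
      then show "\<exists>!y. eq_step g \<tau> \<sigma> y \<or> (\<not> (\<exists>y. eq_step g \<tau> \<sigma> y) \<and> y = zero)" using eq_step_unique by blast
    qed blast
  next
    fix q g g' y
    assume q: "q \<epsilon> D" and agree: "\<And>z u. z \<epsilon> D \<Longrightarrow> R z q \<Longrightarrow> pair_in z u g \<longleftrightarrow> pair_in z u g'" and y: "H q g y"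
    obtain \<tau> \<sigma> where \<tau>: "q = opair \<tau> \<sigma>" "\<tau> \<epsilon> T" "\<sigma> \<epsilon> T" using q unfolding D_iff by blast
    have "eq_step g \<tau> \<sigma> y \<longleftrightarrow> eq_step g' \<tau> \<sigma> y" for y
    proof (rule eq_step_cong)
      fix \<eta> \<theta> b c u
      assume *: "pair_in \<eta> b \<tau> \<or> pair_in \<eta> b \<sigma>" "pair_in \<theta> c \<tau> \<or> pair_in \<theta> c \<sigma>"
      then have "\<eta> \<epsilon> T" "\<theta> \<epsilon> T" using names_setD[OF T] \<tau> by blast+
      then have "opair \<eta> \<theta> \<epsilon> D" unfolding D_iff by blast
      moreover have "R (opair \<eta> \<theta>) q" unfolding R_def \<tau>(1) using * is_pair_opair by blast
      ultimately show "val_at g \<eta> \<theta> u \<longleftrightarrow> val_at g' \<eta> \<theta> u" unfolding val_at_iff by (rule agree)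
    qed
    then show "H q g' y" using y unfolding \<tau>(1) H_pair by simp
  qed
  then obtain g where g: "is_fun g D" "\<And>q y. pair_in q y g \<Longrightarrow> H q g y" by blast
  have "eq_rec T g"
  proof (rule eq_recI[OF T D g(1) refl])
    fix \<tau> \<sigma> assume "\<tau> \<epsilon> T" "\<sigma> \<epsilon> T"
      and st: "\<And>y. eq_step g \<tau> \<sigma> y \<longleftrightarrow> y = sub_val (\<lambda>\<tau> \<sigma>. app g (opair \<tau> \<sigma>)) \<tau> \<sigma> \<sqinter> sub_val (\<lambda>\<tau> \<sigma>. app g (opair \<tau> \<sigma>)) \<sigma> \<tau>"
    then have "opair \<tau> \<sigma> \<epsilon> D" unfolding D_iff by blast
    then have "H (opair \<tau> \<sigma>) g (app g (opair \<tau> \<sigma>))" using pair_in_app[OF g(1)] g(2) by blast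
    moreover have "\<exists>y. eq_step g \<tau> \<sigma> y" using st by blast
    ultimately show "eq_step g \<tau> \<sigma> (app g (opair \<tau> \<sigma>))" unfolding H_pair by blast
  qed
  then show ?thesis by blast
qed

lemma eq_rec_unique:
  assumes g: "eq_rec T g" "eq_rec T' g'" and "\<tau> \<epsilon> T" "\<sigma> \<epsilon> T" "\<tau> \<epsilon> T'" "\<sigma> \<epsilon> T'"
  shows "app g (opair \<tau> \<sigma>) = app g' (opair \<tau> \<sigma>)"
proof -
  note v = eq_recD(2)[OF g(1)] and v' = eq_recD(2)[OF g(2)]
  let ?P = "\<lambda>\<tau> \<sigma>. \<tau> \<epsilon> T \<and> \<sigma> \<epsilon> T \<and> \<tau> \<epsilon> T' \<and> \<sigma> \<epsilon> T' \<longrightarrow> (\<exists>y. val_at g \<tau> \<sigma> y \<and> val_at g' \<tau> \<sigma> y)"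
  have "?P \<tau> \<sigma>"
  proof (rule dom_pair_induct[where P = ?P])
    show "definable (\<lambda>e. ?P (e 0) (e 1))" by (intro codef)
    fix \<tau> \<sigma>
    assume IH: "\<And>\<eta> \<theta> b c. pair_in \<eta> b \<tau> \<or> pair_in \<eta> b \<sigma> \<Longrightarrow> pair_in \<theta> c \<tau> \<or> pair_in \<theta> c \<sigma> \<Longrightarrow> ?P \<eta> \<theta>"
    show "?P \<tau> \<sigma>"
    proof
      assume T: "\<tau> \<epsilon> T \<and> \<sigma> \<epsilon> T \<and> \<tau> \<epsilon> T' \<and> \<sigma> \<epsilon> T'"
      have "eq_step g \<tau> \<sigma> y \<longleftrightarrow> eq_step g' \<tau> \<sigma> y" for y
      proof (rule eq_step_cong)
        fix \<eta> \<theta> b c u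
        assume *: "pair_in \<eta> b \<tau> \<or> pair_in \<eta> b \<sigma>" "pair_in \<theta> c \<tau> \<or> pair_in \<theta> c \<sigma>"
        have dom: "\<eta> \<epsilon> T" "\<theta> \<epsilon> T" "\<eta> \<epsilon> T'" "\<theta> \<epsilon> T'"
          using * T names_setD[OF eq_recD(1)[OF g(1)]] names_setD[OF eq_recD(1)[OF g(2)]] by blast+
        then obtain y where "val_at g \<eta> \<theta> y" "val_at g' \<eta> \<theta> y" using IH[OF *] by blast
        then show "val_at g \<eta> \<theta> u \<longleftrightarrow> val_at g' \<eta> \<theta> u" using v[of \<eta> \<theta>] v'[of \<eta> \<theta>] dom by simp
      qed
      then have "eq_step g \<tau> \<sigma> (app g' (opair \<tau> \<sigma>))" using eq_recD(3)[OF g(2)] T by blast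
      then have "app g' (opair \<tau> \<sigma>) = app g (opair \<tau> \<sigma>)"
        using eq_step_unique eq_recD(3)[OF g(1)] T by blast
      then show "\<exists>y. val_at g \<tau> \<sigma> y \<and> val_at g' \<tau> \<sigma> y" using v[of \<tau> \<sigma>] v'[of \<tau> \<sigma>] T by auto
    qed
  qed
  then show ?thesis using v[of \<tau> \<sigma>] v'[of \<tau> \<sigma>] assms(3-) by auto
qed

lemma eq_recursion_iff: "eq_recursion T g \<longleftrightarrow> eq_rec T g"
proof
  let ?G = "\<lambda>\<tau> \<sigma>. app g (opair \<tau> \<sigma>)"
  assume rec: "eq_recursion T g"
  then obtain D where D: "is_prod T T D" "is_fun g D" and T: "names_set T"
    and eq: "\<And>\<tau> \<sigma>. \<tau> \<epsilon> T \<Longrightarrow> \<sigma> \<epsilon> T \<Longrightarrow> ?G \<tau> \<sigma> = sub_val ?G \<tau> \<sigma> \<sqinter> sub_val ?G \<sigma> \<tau>"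
    unfolding eq_recursion_def Let_def elts_def by blast
  show "eq_rec T g" by (rule eq_recI[OF T D refl]) (simp only: eq)
next
  assume rec: "eq_rec T g"
  show "eq_recursion T g"
    using rec eq_rec_equation(1)[OF rec _ _ refl]
    unfolding eq_recursion_def Let_def elts_def eq_rec_def by blast
qed

text \<open>Different solutions agree where both are defined, so any solution computes the Boolean value.\<close>
lemma eq_value_app:
  assumes "eq_rec T g" "\<tau> \<epsilon> T" "\<sigma> \<epsilon> T"
  shows "\<lbrakk>\<tau> =\<^sub>B \<sigma>\<rbrakk> = app g (opair \<tau> \<sigma>)"
  unfolding eq_value_def eq_recursion_iff
proof (rule the_equality)
  show "\<exists>T g'. eq_rec T g' \<and> \<tau> \<epsilon> T \<and> \<sigma> \<epsilon> T \<and> app g (opair \<tau> \<sigma>) = app g' (opair \<tau> \<sigma>)"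
    using assms by blast
next
  fix b assume "\<exists>T g'. eq_rec T g' \<and> \<tau> \<epsilon> T \<and> \<sigma> \<epsilon> T \<and> b = app g' (opair \<tau> \<sigma>)"
  then obtain T' g' where *: "eq_rec T' g'" "\<tau> \<epsilon> T'" "\<sigma> \<epsilon> T'" "b = app g' (opair \<tau> \<sigma>)" by blast
  then show "b = app g (opair \<tau> \<sigma>)" using eq_rec_unique[OF *(1) assms(1) *(2,3) assms(2,3)] by simp
qed

lemma eq_rel_iff:
  assumes "\<tau> \<in> names" "\<sigma> \<in> names"
  shows "eq_rel \<tau> \<sigma> y \<longleftrightarrow> y = \<lbrakk>\<tau> =\<^sub>B \<sigma>\<rbrakk>"
proof
  assume "eq_rel \<tau> \<sigma> y"
  then obtain T g where *: "eq_rec T g" "\<tau> \<epsilon> T" "\<sigma> \<epsilon> T" "val_at g \<tau> \<sigma> y" unfolding eq_rel_def by blast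
  then show "y = \<lbrakk>\<tau> =\<^sub>B \<sigma>\<rbrakk>" using eq_value_app[OF *(1-3)] eq_recD(2)[OF *(1-3)] by simp
next
  assume y: "y = \<lbrakk>\<tau> =\<^sub>B \<sigma>\<rbrakk>"
  obtain T where T: "names_set T" "\<tau> \<epsilon> T" "\<sigma> \<epsilon> T" using names_set_common[OF assms] .
  then obtain g where g: "eq_rec T g" using eq_rec_exists by blast
  then have "val_at g \<tau> \<sigma> y" using y eq_value_app[OF g T(2,3)] eq_recD(2)[OF g T(2,3)] by simp
  then show "eq_rel \<tau> \<sigma> y" unfolding eq_rel_def using g T by blast
qed

lemma eq_value_in: "\<tau> \<in> names \<Longrightarrow> \<sigma> \<in> names \<Longrightarrow> \<lbrakk>\<tau> =\<^sub>B \<sigma>\<rbrakk> \<epsilon> B"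
proof -
  assume "\<tau> \<in> names" "\<sigma> \<in> names"
  then obtain T where T: "names_set T" "\<tau> \<epsilon> T" "\<sigma> \<epsilon> T" by (rule names_set_common)
  then obtain g where g: "eq_rec T g" using eq_rec_exists by blast
  show ?thesis using eq_value_app[OF g T(2,3)] eq_step_in[OF eq_recD(3)[OF g T(2,3)]] by simp
qed

lemma mem_value_lub:
  assumes "\<tau> \<in> names" "\<sigma> \<in> names"
  shows "is_lub {\<lbrakk>\<tau> =\<^sub>B \<eta>\<rbrakk> \<sqinter> b | \<eta> b. pair_in \<eta> b \<sigma>} \<lbrakk>\<tau> \<in>\<^sub>B \<sigma>\<rbrakk>"
    and "mem_value_rel \<tau> \<sigma> m \<longleftrightarrow> m = \<lbrakk>\<tau> \<in>\<^sub>B \<sigma>\<rbrakk>"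
proof -
  have n: "\<eta> \<in> names" "b \<epsilon> B" if "pair_in \<eta> b \<sigma>" for \<eta> b using names_pair[OF assms(2) that] by blast+
  have def: "definable (\<lambda>e. eq_rel (e 0) (e 1) (e 2))" by (intro codef)
  show "is_lub {\<lbrakk>\<tau> =\<^sub>B \<eta>\<rbrakk> \<sqinter> b | \<eta> b. pair_in \<eta> b \<sigma>} \<lbrakk>\<tau> \<in>\<^sub>B \<sigma>\<rbrakk>"
    unfolding mem_value_def
    by (rule mem_val_lub(1)[where R = eq_rel and G = eq_value]; (rule def)?; fact n(2) eq_value_in[OF assms(1) n(1)] eq_rel_iff[OF assms(1) n(1)])
  show "mem_value_rel \<tau> \<sigma> m \<longleftrightarrow> m = \<lbrakk>\<tau> \<in>\<^sub>B \<sigma>\<rbrakk>"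
    unfolding mem_value_def mem_value_rel_def
    by (rule mem_val_lub(2)[where R = eq_rel and G = eq_value]; (rule def)?; fact n(2) eq_value_in[OF assms(1) n(1)] eq_rel_iff[OF assms(1) n(1)])
qed

lemma mem_value_in: "\<tau> \<in> names \<Longrightarrow> \<sigma> \<in> names \<Longrightarrow> \<lbrakk>\<tau> \<in>\<^sub>B \<sigma>\<rbrakk> \<epsilon> B"
  using mem_value_lub(1) is_lub_in by blast

lemma eq_value_equation:
  assumes "\<tau> \<in> names" "\<sigma> \<in> names"
  shows "\<lbrakk>\<tau> =\<^sub>B \<sigma>\<rbrakk> = sub_val eq_value \<tau> \<sigma> \<sqinter> sub_val eq_value \<sigma> \<tau>"
    and "is_glb {compl \<lbrakk>\<eta> \<in>\<^sub>B \<tau>\<rbrakk> \<squnion> \<lbrakk>\<eta> \<in>\<^sub>B \<sigma>\<rbrakk> | \<eta>. \<exists>b. pair_in \<eta> b \<tau>} (sub_val eq_value \<tau> \<sigma>)"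
proof -
  obtain T where T: "names_set T" "\<tau> \<epsilon> T" "\<sigma> \<epsilon> T" using names_set_common[OF assms] .
  then obtain g where g: "eq_rec T g" using eq_rec_exists by blast
  note eqn = eq_rec_equation[where G = eq_value, OF g T(2,3) eq_value_app[OF g]]
  show "\<lbrakk>\<tau> =\<^sub>B \<sigma>\<rbrakk> = sub_val eq_value \<tau> \<sigma> \<sqinter> sub_val eq_value \<sigma> \<tau>"
    by (rule eqn(1))
  show "is_glb {compl \<lbrakk>\<eta> \<in>\<^sub>B \<tau>\<rbrakk> \<squnion> \<lbrakk>\<eta> \<in>\<^sub>B \<sigma>\<rbrakk> | \<eta>. \<exists>b. pair_in \<eta> b \<tau>} (sub_val eq_value \<tau> \<sigma>)"
    unfolding mem_value_def by (rule eqn(2))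
qed

end

section \<open>Laws of the Boolean-valued model\<close>

context internal_algebra begin

text \<open>The first-order counterpart of \<open>ground_value\<close>.\<close>
definition ground_rel :: "'a \<Rightarrow> 'a \<Rightarrow> bool" where
  "ground_rel \<tau> m \<longleftrightarrow> is_lub {s. \<exists>x z. check_rel x z \<and> eq_rel \<tau> z s} m"

end

lemma codef_ground_rel [codef]:
  assumes "coterm j t t'" "coterm j u u'"
  shows "codefinable E E' j (\<lambda>e. internal_algebra.ground_rel E B L (t e) (u e))
    (\<lambda>e. internal_algebra.ground_rel E' (j B) (j L) (t' e) (u' e))"
  by (rule codef_subst2[OF _ assms]) (unfold internal_algebra.ground_rel_def, intro codef)

context cba_model begin

text \<open>The order of \<open>B\<close> with membership in \<open>B\<close> built in; this makes transitivity unconditional. The laws of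
  the Boolean-valued model are stated in the style of forcing, as closure properties of the
  conditions \<open>p\<close> below a Boolean value.\<close>
definition below :: "'a \<Rightarrow> 'a \<Rightarrow> bool" (infix "\<sqsubseteq>" 50) where
  "p \<sqsubseteq> a \<longleftrightarrow> p \<epsilon> B \<and> a \<epsilon> B \<and> p \<preceq> a"

lemma below_trans: "r \<sqsubseteq> p \<Longrightarrow> p \<sqsubseteq> a \<Longrightarrow> r \<sqsubseteq> a"
  unfolding below_def using le_trans by blast

lemma below_refl: "p \<epsilon> B \<Longrightarrow> p \<sqsubseteq> p" unfolding below_def using le_refl by blast

lemma below_antisym: "p \<sqsubseteq> q \<Longrightarrow> q \<sqsubseteq> p \<Longrightarrow> p = q" unfolding below_def using le_antisym by blast

lemma below_in: "p \<sqsubseteq> q \<Longrightarrow> p \<epsilon> B" "p \<sqsubseteq> q \<Longrightarrow> q \<epsilon> B" unfolding below_def by blast+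

lemma below_meet: "r \<sqsubseteq> a \<Longrightarrow> r \<sqsubseteq> b \<Longrightarrow> r \<sqsubseteq> a \<sqinter> b"
  unfolding below_def using meet_greatest meet_in by blast

lemma meet_below: "a \<epsilon> B \<Longrightarrow> b \<epsilon> B \<Longrightarrow> a \<sqinter> b \<sqsubseteq> a" "a \<epsilon> B \<Longrightarrow> b \<epsilon> B \<Longrightarrow> a \<sqinter> b \<sqsubseteq> b"
  unfolding below_def using meet_in meet_le1 meet_le2 by blast+

lemma below_zero: "p \<sqsubseteq> zero \<longleftrightarrow> p = zero"
  unfolding below_def using zero_in le_zero by blast

lemma below_one: "p \<epsilon> B \<Longrightarrow> p \<sqsubseteq> one" unfolding below_def using one_in le_one by blast

lemma mem_value_below:
  assumes "\<tau> \<in> names" "\<sigma> \<in> names" "pair_in \<eta> b \<sigma>" "r \<sqsubseteq> \<lbrakk>\<tau> =\<^sub>B \<eta>\<rbrakk>" "r \<sqsubseteq> b"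
  shows "r \<sqsubseteq> \<lbrakk>\<tau> \<in>\<^sub>B \<sigma>\<rbrakk>"
proof -
  have "\<eta> \<in> names" "b \<epsilon> B" using names_pair assms by blast+
  then have "\<lbrakk>\<tau> =\<^sub>B \<eta>\<rbrakk> \<sqinter> b \<epsilon> B" using meet_in eq_value_in assms(1) by blast
  moreover have "\<lbrakk>\<tau> =\<^sub>B \<eta>\<rbrakk> \<sqinter> b \<preceq> \<lbrakk>\<tau> \<in>\<^sub>B \<sigma>\<rbrakk>"
    using mem_value_lub(1)[OF assms(1,2)] assms(3) unfolding is_lub_def by blast
  ultimately have "\<lbrakk>\<tau> =\<^sub>B \<eta>\<rbrakk> \<sqinter> b \<sqsubseteq> \<lbrakk>\<tau> \<in>\<^sub>B \<sigma>\<rbrakk>" unfolding below_def using mem_value_in assms by blast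
  then show ?thesis using below_meet[OF assms(4,5)] below_trans by blast
qed

text \<open>Distributivity: to show that \<open>p\<close> is below \<open>q\<close>, one may strengthen \<open>p\<close> to decide by which pair \<open>\<langle>\<eta>, b\<rangle>\<close> of \<open>\<sigma>\<close>
  the membership of \<open>\<tau>\<close> in \<open>\<sigma>\<close> is witnessed.\<close>
lemma mem_value_cases:
  assumes "\<tau> \<in> names" "\<sigma> \<in> names" "p \<sqsubseteq> \<lbrakk>\<tau> \<in>\<^sub>B \<sigma>\<rbrakk>" "q \<epsilon> B"
    and "\<And>\<eta> b r. pair_in \<eta> b \<sigma> \<Longrightarrow> r \<sqsubseteq> p \<Longrightarrow> r \<sqsubseteq> \<lbrakk>\<tau> =\<^sub>B \<eta>\<rbrakk> \<Longrightarrow> r \<sqsubseteq> b \<Longrightarrow> r \<sqsubseteq> q"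
  shows "p \<sqsubseteq> q"
proof -
  have p: "p \<epsilon> B" using below_in assms(3) by blast
  have in_B: "\<lbrakk>\<tau> =\<^sub>B \<eta>\<rbrakk> \<epsilon> B" "b \<epsilon> B" "\<lbrakk>\<tau> =\<^sub>B \<eta>\<rbrakk> \<sqinter> b \<epsilon> B" if "pair_in \<eta> b \<sigma>" for \<eta> b
    using names_pair[OF assms(2) that] eq_value_in assms(1) meet_in by auto
  have "p \<sqinter> \<lbrakk>\<tau> \<in>\<^sub>B \<sigma>\<rbrakk> \<preceq> q"
  proof (rule meet_lub_le[OF mem_value_lub(1)[OF assms(1,2)] p assms(4)])
    fix a assume "a \<in> {\<lbrakk>\<tau> =\<^sub>B \<eta>\<rbrakk> \<sqinter> b | \<eta> b. pair_in \<eta> b \<sigma>}"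
    then obtain \<eta> b where a: "a = \<lbrakk>\<tau> =\<^sub>B \<eta>\<rbrakk> \<sqinter> b" "pair_in \<eta> b \<sigma>" by blast
    show "a \<epsilon> B" unfolding a(1) by (rule in_B(3)[OF a(2)])
    then have "p \<sqinter> a \<sqsubseteq> p" "p \<sqinter> a \<sqsubseteq> a" using meet_below[OF p] by blast+
    moreover have "a \<sqsubseteq> \<lbrakk>\<tau> =\<^sub>B \<eta>\<rbrakk>" "a \<sqsubseteq> b" unfolding a(1) using meet_below in_B[OF a(2)] by blast+
    ultimately have "p \<sqinter> a \<sqsubseteq> q" using assms(5)[OF a(2)] below_trans by blast
    then show "p \<sqinter> a \<preceq> q" unfolding below_def by blast
  qed
  moreover have "p \<sqinter> \<lbrakk>\<tau> \<in>\<^sub>B \<sigma>\<rbrakk> = p"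
    using meet_absorb assms(3) unfolding below_def by blast
  ultimately show ?thesis using p assms(4) unfolding below_def by simp
qed

lemma below_sub_val:
  assumes "\<tau> \<in> names" "\<sigma> \<in> names" "p \<epsilon> B"
  shows "p \<sqsubseteq> sub_val eq_value \<tau> \<sigma> \<longleftrightarrow>
    (\<forall>\<eta> b r. pair_in \<eta> b \<tau> \<and> r \<sqsubseteq> p \<and> r \<sqsubseteq> \<lbrakk>\<eta> \<in>\<^sub>B \<tau>\<rbrakk> \<longrightarrow> r \<sqsubseteq> \<lbrakk>\<eta> \<in>\<^sub>B \<sigma>\<rbrakk>)" (is "?l \<longleftrightarrow> ?r")
proof -
  note glb = eq_value_equation(2)[OF assms(1,2)]
  have v: "\<lbrakk>\<eta> \<in>\<^sub>B \<tau>\<rbrakk> \<epsilon> B" "\<lbrakk>\<eta> \<in>\<^sub>B \<sigma>\<rbrakk> \<epsilon> B" if "pair_in \<eta> b \<tau>" for \<eta> b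
    using names_pair[OF assms(1) that] mem_value_in assms by blast+
  have imp_in: "compl \<lbrakk>\<eta> \<in>\<^sub>B \<tau>\<rbrakk> \<squnion> \<lbrakk>\<eta> \<in>\<^sub>B \<sigma>\<rbrakk> \<epsilon> B" if "pair_in \<eta> b \<tau>" for \<eta> b
    using v[OF that] compl_in join_in by blast
  have imp: "p \<preceq> compl \<lbrakk>\<eta> \<in>\<^sub>B \<tau>\<rbrakk> \<squnion> \<lbrakk>\<eta> \<in>\<^sub>B \<sigma>\<rbrakk> \<longleftrightarrow>
      (\<forall>r. r \<sqsubseteq> p \<and> r \<sqsubseteq> \<lbrakk>\<eta> \<in>\<^sub>B \<tau>\<rbrakk> \<longrightarrow> r \<sqsubseteq> \<lbrakk>\<eta> \<in>\<^sub>B \<sigma>\<rbrakk>)" if \<eta>: "pair_in \<eta> b \<tau>" for \<eta> b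
  proof -
    have "p \<sqinter> \<lbrakk>\<eta> \<in>\<^sub>B \<tau>\<rbrakk> \<sqsubseteq> \<lbrakk>\<eta> \<in>\<^sub>B \<sigma>\<rbrakk> \<longleftrightarrow> (\<forall>r. r \<sqsubseteq> p \<and> r \<sqsubseteq> \<lbrakk>\<eta> \<in>\<^sub>B \<tau>\<rbrakk> \<longrightarrow> r \<sqsubseteq> \<lbrakk>\<eta> \<in>\<^sub>B \<sigma>\<rbrakk>)"
      using below_meet meet_below[OF assms(3) v(1)[OF \<eta>]] below_trans by blast
    moreover have "p \<sqinter> \<lbrakk>\<eta> \<in>\<^sub>B \<tau>\<rbrakk> \<sqsubseteq> \<lbrakk>\<eta> \<in>\<^sub>B \<sigma>\<rbrakk> \<longleftrightarrow> p \<sqinter> \<lbrakk>\<eta> \<in>\<^sub>B \<tau>\<rbrakk> \<preceq> \<lbrakk>\<eta> \<in>\<^sub>B \<sigma>\<rbrakk>"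
      unfolding below_def using v[OF \<eta>] meet_in[OF assms(3)] by blast
    ultimately show ?thesis using residuation[OF assms(3) v[OF \<eta>]] by blast
  qed
  have s: "sub_val eq_value \<tau> \<sigma> \<epsilon> B" by (rule is_glb_in[OF glb])
  show ?thesis
  proof
    assume l: ?l
    have "p \<preceq> compl \<lbrakk>\<eta> \<in>\<^sub>B \<tau>\<rbrakk> \<squnion> \<lbrakk>\<eta> \<in>\<^sub>B \<sigma>\<rbrakk>" if \<eta>: "pair_in \<eta> b \<tau>" for \<eta> b
    proof -
      have "sub_val eq_value \<tau> \<sigma> \<preceq> compl \<lbrakk>\<eta> \<in>\<^sub>B \<tau>\<rbrakk> \<squnion> \<lbrakk>\<eta> \<in>\<^sub>B \<sigma>\<rbrakk>"
        using glb \<eta> unfolding is_glb_def by blast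
      then show ?thesis using l le_trans[OF assms(3) s imp_in[OF \<eta>]] unfolding below_def by blast
    qed
    then show ?r using imp by blast
  next
    assume r: ?r
    have "p \<preceq> a" if "a \<in> {compl \<lbrakk>\<eta> \<in>\<^sub>B \<tau>\<rbrakk> \<squnion> \<lbrakk>\<eta> \<in>\<^sub>B \<sigma>\<rbrakk> | \<eta>. \<exists>b. pair_in \<eta> b \<tau>}" for a
    proof -
      obtain \<eta> b where a: "a = compl \<lbrakk>\<eta> \<in>\<^sub>B \<tau>\<rbrakk> \<squnion> \<lbrakk>\<eta> \<in>\<^sub>B \<sigma>\<rbrakk>" "pair_in \<eta> b \<tau>" using \<open>a \<in> _\<close> by blast
      show ?thesis unfolding a(1) imp[OF a(2)] using r a(2) by blast
    qed
    then have "p \<preceq> sub_val eq_value \<tau> \<sigma>" using glb assms(3) unfolding is_glb_def by blast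
    then show ?l unfolding below_def using s assms(3) by blast
  qed
qed

lemma below_eq_value:
  assumes "\<tau> \<in> names" "\<sigma> \<in> names" "p \<epsilon> B"
  shows "p \<sqsubseteq> \<lbrakk>\<tau> =\<^sub>B \<sigma>\<rbrakk> \<longleftrightarrow>
    (\<forall>\<eta> b r. pair_in \<eta> b \<tau> \<and> r \<sqsubseteq> p \<and> r \<sqsubseteq> \<lbrakk>\<eta> \<in>\<^sub>B \<tau>\<rbrakk> \<longrightarrow> r \<sqsubseteq> \<lbrakk>\<eta> \<in>\<^sub>B \<sigma>\<rbrakk>) \<and>
    (\<forall>\<eta> b r. pair_in \<eta> b \<sigma> \<and> r \<sqsubseteq> p \<and> r \<sqsubseteq> \<lbrakk>\<eta> \<in>\<^sub>B \<sigma>\<rbrakk> \<longrightarrow> r \<sqsubseteq> \<lbrakk>\<eta> \<in>\<^sub>B \<tau>\<rbrakk>)"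
proof -
  have s: "sub_val eq_value \<tau> \<sigma> \<epsilon> B" "sub_val eq_value \<sigma> \<tau> \<epsilon> B"
    using is_glb_in eq_value_equation(2) assms by blast+
  have "p \<sqsubseteq> \<lbrakk>\<tau> =\<^sub>B \<sigma>\<rbrakk> \<longleftrightarrow> p \<sqsubseteq> sub_val eq_value \<tau> \<sigma> \<and> p \<sqsubseteq> sub_val eq_value \<sigma> \<tau>"
    unfolding eq_value_equation(1)[OF assms(1,2)]
    using below_meet meet_below[OF s] below_trans by blast
  then show ?thesis using below_sub_val assms by simp
qed

lemma below_eq_valueD:
  assumes "\<tau> \<in> names" "\<sigma> \<in> names" "p \<sqsubseteq> \<lbrakk>\<tau> =\<^sub>B \<sigma>\<rbrakk>" "pair_in \<eta> b \<tau>" "p \<sqsubseteq> \<lbrakk>\<eta> \<in>\<^sub>B \<tau>\<rbrakk>"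
  shows "p \<sqsubseteq> \<lbrakk>\<eta> \<in>\<^sub>B \<sigma>\<rbrakk>"
  using assms below_eq_value[OF assms(1,2)] below_refl below_in by blast

lemma eq_value_sym: "\<tau> \<in> names \<Longrightarrow> \<sigma> \<in> names \<Longrightarrow> \<lbrakk>\<tau> =\<^sub>B \<sigma>\<rbrakk> = \<lbrakk>\<sigma> =\<^sub>B \<tau>\<rbrakk>"
  using eq_value_equation(1) meet_commute by metis

text \<open>Immediate, because the value of an inclusion is computed from the values of \<open>\<eta> \<in> \<tau>\<close> rather than from the
  conditions \<open>b\<close> that occur in \<open>\<tau>\<close>.\<close>
lemma eq_value_refl:
  assumes "\<tau> \<in> names" shows "\<lbrakk>\<tau> =\<^sub>B \<tau>\<rbrakk> = one"
proof -
  have "one \<sqsubseteq> \<lbrakk>\<tau> =\<^sub>B \<tau>\<rbrakk>" unfolding below_eq_value[OF assms assms one_in] by blast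
  then show ?thesis using below_antisym below_one eq_value_in assms by blast
qed

lemma below_mem_value_self:
  assumes "\<sigma> \<in> names" "pair_in \<eta> b \<sigma>" "r \<sqsubseteq> b" shows "r \<sqsubseteq> \<lbrakk>\<eta> \<in>\<^sub>B \<sigma>\<rbrakk>"
proof -
  have \<eta>: "\<eta> \<in> names" using names_pair assms by blast
  have "r \<sqsubseteq> \<lbrakk>\<eta> =\<^sub>B \<eta>\<rbrakk>" unfolding eq_value_refl[OF \<eta>] using below_one below_in assms(3) by blast
  then show ?thesis using mem_value_below[OF \<eta> assms(1,2)] assms(3) by blast
qed

text \<open>A witness \<open>\<eta>\<close> of membership in \<open>\<tau>\<close> is moved to some \<open>\<xi>\<close> in \<open>dom \<sigma>\<close> and on to some \<open>\<theta>\<close> in \<open>dom \<rho>\<close>. This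
  reduces transitivity for \<open>\<tau>\<close>, \<open>\<sigma>\<close>, \<open>\<rho>\<close> to transitivity for names in their domains.\<close>
lemma mem_value_path:
  assumes n: "\<tau> \<in> names" "\<sigma> \<in> names" "\<rho> \<in> names"
    and p: "p \<sqsubseteq> \<lbrakk>\<tau> =\<^sub>B \<sigma>\<rbrakk>" "p \<sqsubseteq> \<lbrakk>\<sigma> =\<^sub>B \<rho>\<rbrakk>"
    and \<eta>: "pair_in \<eta> b \<tau>" and r: "r \<sqsubseteq> p" "r \<sqsubseteq> \<lbrakk>\<eta> \<in>\<^sub>B \<tau>\<rbrakk>"
    and trans: "\<And>\<xi> \<theta> c d q. pair_in \<xi> c \<sigma> \<Longrightarrow> pair_in \<theta> d \<rho> \<Longrightarrow> q \<sqsubseteq> \<lbrakk>\<eta> =\<^sub>B \<xi>\<rbrakk> \<Longrightarrow> q \<sqsubseteq> \<lbrakk>\<xi> =\<^sub>B \<theta>\<rbrakk> \<Longrightarrow> q \<sqsubseteq> \<lbrakk>\<eta> =\<^sub>B \<theta>\<rbrakk>"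
  shows "r \<sqsubseteq> \<lbrakk>\<eta> \<in>\<^sub>B \<rho>\<rbrakk>"
proof -
  have \<eta>n: "\<eta> \<in> names" using names_pair n(1) \<eta> by blast
  have "r \<sqsubseteq> \<lbrakk>\<eta> \<in>\<^sub>B \<sigma>\<rbrakk>"
    by (rule below_eq_valueD[OF n(1,2) below_trans[OF r(1) p(1)] \<eta> r(2)])
  then show ?thesis
  proof (rule mem_value_cases[OF \<eta>n n(2) _ mem_value_in[OF \<eta>n n(3)]])
    fix \<xi> c r1 assume \<xi>: "pair_in \<xi> c \<sigma>" and r1: "r1 \<sqsubseteq> r" "r1 \<sqsubseteq> \<lbrakk>\<eta> =\<^sub>B \<xi>\<rbrakk>" "r1 \<sqsubseteq> c"
    have \<xi>n: "\<xi> \<in> names" using names_pair n(2) \<xi> by blast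
    have r1p: "r1 \<sqsubseteq> p" using r1(1) r(1) below_trans by blast
    have "r1 \<sqsubseteq> \<lbrakk>\<xi> \<in>\<^sub>B \<rho>\<rbrakk>"
      by (rule below_eq_valueD[OF n(2,3) below_trans[OF r1p p(2)] \<xi> below_mem_value_self[OF n(2) \<xi> r1(3)]])
    then show "r1 \<sqsubseteq> \<lbrakk>\<eta> \<in>\<^sub>B \<rho>\<rbrakk>"
    proof (rule mem_value_cases[OF \<xi>n n(3) _ mem_value_in[OF \<eta>n n(3)]])
      fix \<theta> d r2 assume \<theta>: "pair_in \<theta> d \<rho>" and r2: "r2 \<sqsubseteq> r1" "r2 \<sqsubseteq> \<lbrakk>\<xi> =\<^sub>B \<theta>\<rbrakk>" "r2 \<sqsubseteq> d"
      have "r2 \<sqsubseteq> \<lbrakk>\<eta> =\<^sub>B \<theta>\<rbrakk>" by (rule trans[OF \<xi> \<theta> below_trans[OF r2(1) r1(2)] r2(2)])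
      then show "r2 \<sqsubseteq> \<lbrakk>\<eta> \<in>\<^sub>B \<rho>\<rbrakk>" using mem_value_below[OF \<eta>n n(3) \<theta>] r2(3) by blast
    qed
  qed
qed

text \<open>By induction on \<open>\<tau>\<close> for all \<open>\<sigma>\<close> and \<open>\<rho>\<close>; in the reverse inclusion, the induction hypothesis for a
  name in \<open>dom \<tau>\<close> applies after the path has been reversed by symmetry. The predicate \<open>Q\<close> is the first-order form of the
  claim.\<close>
lemma eq_value_trans:
  assumes "\<tau> \<in> names" "\<sigma> \<in> names" "\<rho> \<in> names" "p \<sqsubseteq> \<lbrakk>\<tau> =\<^sub>B \<sigma>\<rbrakk>" "p \<sqsubseteq> \<lbrakk>\<sigma> =\<^sub>B \<rho>\<rbrakk>"
  shows "p \<sqsubseteq> \<lbrakk>\<tau> =\<^sub>B \<rho>\<rbrakk>"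
proof -
  define Q where "Q \<tau> \<longleftrightarrow> (\<tau> \<in> names \<longrightarrow> (\<forall>\<sigma> \<rho> p u v w. \<sigma> \<in> names \<and> \<rho> \<in> names \<and> p \<epsilon> B \<and>
    eq_rel \<tau> \<sigma> u \<and> eq_rel \<sigma> \<rho> v \<and> eq_rel \<tau> \<rho> w \<and> p \<preceq> u \<and> p \<preceq> v \<longrightarrow> p \<preceq> w))" for \<tau>
  have def: "definable (\<lambda>e. Q (e 0))" unfolding Q_def by (intro codef)
  have QI: "Q \<tau>" if "\<And>\<sigma> \<rho> p. \<tau> \<in> names \<Longrightarrow> \<sigma> \<in> names \<Longrightarrow> \<rho> \<in> names \<Longrightarrow>
      p \<sqsubseteq> \<lbrakk>\<tau> =\<^sub>B \<sigma>\<rbrakk> \<Longrightarrow> p \<sqsubseteq> \<lbrakk>\<sigma> =\<^sub>B \<rho>\<rbrakk> \<Longrightarrow> p \<sqsubseteq> \<lbrakk>\<tau> =\<^sub>B \<rho>\<rbrakk>" for \<tau>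
    unfolding Q_def
  proof (intro impI allI)
    fix \<sigma> \<rho> p u v w
    assume \<tau>: "\<tau> \<in> names" and *: "\<sigma> \<in> names \<and> \<rho> \<in> names \<and> p \<epsilon> B \<and>
      eq_rel \<tau> \<sigma> u \<and> eq_rel \<sigma> \<rho> v \<and> eq_rel \<tau> \<rho> w \<and> p \<preceq> u \<and> p \<preceq> v"
    then have "u = \<lbrakk>\<tau> =\<^sub>B \<sigma>\<rbrakk>" "v = \<lbrakk>\<sigma> =\<^sub>B \<rho>\<rbrakk>" "w = \<lbrakk>\<tau> =\<^sub>B \<rho>\<rbrakk>" using eq_rel_iff by blast+
    then show "p \<preceq> w" using that[of \<sigma> \<rho> p] \<tau> * eq_value_in unfolding below_def by simp
  qed
  have QD: "p \<sqsubseteq> \<lbrakk>\<tau> =\<^sub>B \<rho>\<rbrakk>" if "Q \<tau>" "\<tau> \<in> names" "\<sigma> \<in> names" "\<rho> \<in> names"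
      "p \<sqsubseteq> \<lbrakk>\<tau> =\<^sub>B \<sigma>\<rbrakk>" "p \<sqsubseteq> \<lbrakk>\<sigma> =\<^sub>B \<rho>\<rbrakk>" for \<tau> \<sigma> \<rho> p
  proof -
    have "p \<preceq> \<lbrakk>\<tau> =\<^sub>B \<rho>\<rbrakk>"
      using that(1)[unfolded Q_def, rule_format, of \<sigma> \<rho> p "\<lbrakk>\<tau> =\<^sub>B \<sigma>\<rbrakk>" "\<lbrakk>\<sigma> =\<^sub>B \<rho>\<rbrakk>" "\<lbrakk>\<tau> =\<^sub>B \<rho>\<rbrakk>"]
        that(2-) eq_rel_iff unfolding below_def by simp
    then show ?thesis using that eq_value_in unfolding below_def by blast
  qed
  have "Q \<tau>"
  proof (rule dom_induct[where P = Q, OF def])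
    fix \<tau> assume IH: "\<And>\<eta> b. pair_in \<eta> b \<tau> \<Longrightarrow> Q \<eta>"
    show "Q \<tau>"
    proof (rule QI)
      fix \<sigma> \<rho> p
      assume n: "\<tau> \<in> names" "\<sigma> \<in> names" "\<rho> \<in> names" and p: "p \<sqsubseteq> \<lbrakk>\<tau> =\<^sub>B \<sigma>\<rbrakk>" "p \<sqsubseteq> \<lbrakk>\<sigma> =\<^sub>B \<rho>\<rbrakk>"
      have p_in: "p \<epsilon> B" using below_in p by blast
      have p': "p \<sqsubseteq> \<lbrakk>\<rho> =\<^sub>B \<sigma>\<rbrakk>" "p \<sqsubseteq> \<lbrakk>\<sigma> =\<^sub>B \<tau>\<rbrakk>" using p eq_value_sym n by simp_all
      have comp: "q \<sqsubseteq> \<lbrakk>\<eta> =\<^sub>B \<theta>\<rbrakk>" if "pair_in \<eta> b \<tau>" "pair_in \<xi> c \<sigma>" "pair_in \<theta> d \<rho>"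
          "q \<sqsubseteq> \<lbrakk>\<eta> =\<^sub>B \<xi>\<rbrakk>" "q \<sqsubseteq> \<lbrakk>\<xi> =\<^sub>B \<theta>\<rbrakk>" for \<eta> \<xi> \<theta> b c d q
        using QD[OF IH[OF that(1)] _ _ _ that(4,5)] names_pair n that(1-3) by blast
      show "p \<sqsubseteq> \<lbrakk>\<tau> =\<^sub>B \<rho>\<rbrakk>"
        unfolding below_eq_value[OF n(1,3) p_in]
      proof (intro conjI allI impI; elim conjE)
        fix \<eta> b r assume \<eta>: "pair_in \<eta> b \<tau>" and r: "r \<sqsubseteq> p" "r \<sqsubseteq> \<lbrakk>\<eta> \<in>\<^sub>B \<tau>\<rbrakk>"
        show "r \<sqsubseteq> \<lbrakk>\<eta> \<in>\<^sub>B \<rho>\<rbrakk>" by (rule mem_value_path[OF n p \<eta> r comp[OF \<eta>]])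
      next
        fix \<theta> d r assume \<theta>: "pair_in \<theta> d \<rho>" and r: "r \<sqsubseteq> p" "r \<sqsubseteq> \<lbrakk>\<theta> \<in>\<^sub>B \<rho>\<rbrakk>"
        show "r \<sqsubseteq> \<lbrakk>\<theta> \<in>\<^sub>B \<tau>\<rbrakk>"
        proof (rule mem_value_path[OF n(3,2,1) p' \<theta> r])
          fix \<xi> \<eta> c b q assume \<xi>: "pair_in \<xi> c \<sigma>" and \<eta>: "pair_in \<eta> b \<tau>"
            and q: "q \<sqsubseteq> \<lbrakk>\<theta> =\<^sub>B \<xi>\<rbrakk>" "q \<sqsubseteq> \<lbrakk>\<xi> =\<^sub>B \<eta>\<rbrakk>"
          have nn: "\<eta> \<in> names" "\<xi> \<in> names" "\<theta> \<in> names" using names_pair n \<eta> \<xi> \<theta> by blast+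
          then show "q \<sqsubseteq> \<lbrakk>\<theta> =\<^sub>B \<eta>\<rbrakk>" using comp[OF \<eta> \<xi> \<theta>, of q] q eq_value_sym by simp
        qed
      qed
    qed
  qed
  then show ?thesis using QD assms by blast
qed

lemma mem_value_subst_left:
  assumes n: "\<tau> \<in> names" "\<tau>' \<in> names" "\<sigma> \<in> names" and p: "p \<sqsubseteq> \<lbrakk>\<tau> =\<^sub>B \<tau>'\<rbrakk>" "p \<sqsubseteq> \<lbrakk>\<tau>' \<in>\<^sub>B \<sigma>\<rbrakk>"
  shows "p \<sqsubseteq> \<lbrakk>\<tau> \<in>\<^sub>B \<sigma>\<rbrakk>"
  using p(2)
proof (rule mem_value_cases[OF n(2,3) _ mem_value_in[OF n(1,3)]])
  fix \<eta> b r assume \<eta>: "pair_in \<eta> b \<sigma>" and r: "r \<sqsubseteq> p" "r \<sqsubseteq> \<lbrakk>\<tau>' =\<^sub>B \<eta>\<rbrakk>" "r \<sqsubseteq> b"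
  have "\<eta> \<in> names" using names_pair n(3) \<eta> by blast
  then have "r \<sqsubseteq> \<lbrakk>\<tau> =\<^sub>B \<eta>\<rbrakk>" by (rule eq_value_trans[OF n(1,2) _ below_trans[OF r(1) p(1)] r(2)])
  then show "r \<sqsubseteq> \<lbrakk>\<tau> \<in>\<^sub>B \<sigma>\<rbrakk>" using mem_value_below[OF n(1,3) \<eta>] r(3) by blast
qed

lemma mem_value_subst_right:
  assumes n: "\<tau> \<in> names" "\<sigma> \<in> names" "\<rho> \<in> names" and p: "p \<sqsubseteq> \<lbrakk>\<tau> \<in>\<^sub>B \<sigma>\<rbrakk>" "p \<sqsubseteq> \<lbrakk>\<sigma> =\<^sub>B \<rho>\<rbrakk>"
  shows "p \<sqsubseteq> \<lbrakk>\<tau> \<in>\<^sub>B \<rho>\<rbrakk>"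
  using p(1)
proof (rule mem_value_cases[OF n(1,2) _ mem_value_in[OF n(1,3)]])
  fix \<eta> b r assume \<eta>: "pair_in \<eta> b \<sigma>" and r: "r \<sqsubseteq> p" "r \<sqsubseteq> \<lbrakk>\<tau> =\<^sub>B \<eta>\<rbrakk>" "r \<sqsubseteq> b"
  have \<eta>n: "\<eta> \<in> names" using names_pair n(2) \<eta> by blast
  have "r \<sqsubseteq> \<lbrakk>\<eta> \<in>\<^sub>B \<rho>\<rbrakk>"
    by (rule below_eq_valueD[OF n(2,3) below_trans[OF r(1) p(2)] \<eta> below_mem_value_self[OF n(2) \<eta> r(3)]])
  then show "r \<sqsubseteq> \<lbrakk>\<tau> \<in>\<^sub>B \<rho>\<rbrakk>" by (rule mem_value_subst_left[OF n(1) \<eta>n n(3) r(2)])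
qed

section \<open>Check names\<close>

lemma check_recursion_exists:
  assumes T: "transitive_set T"
  shows "\<exists>c. is_fun c T \<and> (\<forall>x cx. pair_in x cx c \<longrightarrow>
       (\<forall>p. p \<epsilon> cx \<longleftrightarrow> (\<exists>y cy u. y \<epsilon> x \<and> pair_in y cy c \<and> is_glb {} u \<and> is_pair cy u p)))"
proof (rule recursion[where R = "(\<epsilon>)" and H = "\<lambda>x c cx. \<forall>p. p \<epsilon> cx \<longleftrightarrow>
    (\<exists>y cy u. y \<epsilon> x \<and> pair_in y cy c \<and> is_glb {} u \<and> is_pair cy u p)", OF founded_on_mem])
  show "definable (\<lambda>e. e 0 \<epsilon> e 1)" by (intro codef)
  show "definable (\<lambda>e. \<forall>p. p \<epsilon> e 2 \<longleftrightarrow>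
    (\<exists>y cy u. y \<epsilon> e 0 \<and> pair_in y cy (e 1) \<and> is_glb {} u \<and> is_pair cy u p))" by (intro codef)
next
  fix x c
  have "small {cy. \<exists>y. y \<epsilon> x \<and> pair_in y cy c}"
    by (rule small_field[of _ c]) (blast, unfold mem_Collect_eq, intro codef)
  then obtain s where s: "\<And>cy. cy \<epsilon> s \<longleftrightarrow> (\<exists>y. y \<epsilon> x \<and> pair_in y cy c)" using smallD by blast
  have "small {p. \<exists>cy. cy \<epsilon> s \<and> is_pair cy one p}"
  proof (rule replacement)
    show "definable (\<lambda>e. is_pair (e 0) one (e 1))" by (intro codef)
  qed (rule is_pair_unique)
  then obtain cx where cx: "\<And>p. p \<epsilon> cx \<longleftrightarrow> (\<exists>cy. cy \<epsilon> s \<and> is_pair cy one p)" using smallD by blast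
  have "p \<epsilon> cx \<longleftrightarrow> (\<exists>y cy u. y \<epsilon> x \<and> pair_in y cy c \<and> is_glb {} u \<and> is_pair cy u p)" for p
    unfolding cx s is_one_iff by blast
  note cx' = this
  show "\<exists>!cx. \<forall>p. p \<epsilon> cx \<longleftrightarrow> (\<exists>y cy u. y \<epsilon> x \<and> pair_in y cy c \<and> is_glb {} u \<and> is_pair cy u p)"
  proof (rule ex1I[of _ cx])
    fix cx'
    assume *: "\<forall>p. p \<epsilon> cx' \<longleftrightarrow> (\<exists>y cy u. y \<epsilon> x \<and> pair_in y cy c \<and> is_glb {} u \<and> is_pair cy u p)"
    show "cx' = cx" by (rule extensionality) (simp only: *[rule_format] cx')
  qed (simp add: cx')
next
  fix x c c' cx
  assume x: "x \<epsilon> T" and agree: "\<And>z u. z \<epsilon> T \<Longrightarrow> z \<epsilon> x \<Longrightarrow> pair_in z u c \<longleftrightarrow> pair_in z u c'"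
    and H: "\<forall>p. p \<epsilon> cx \<longleftrightarrow> (\<exists>y cy u. y \<epsilon> x \<and> pair_in y cy c \<and> is_glb {} u \<and> is_pair cy u p)"
  have "pair_in z u c \<longleftrightarrow> pair_in z u c'" if "z \<epsilon> x" for z u
  proof -
    have "z \<epsilon> T" using that x T unfolding transitive_set_def by blast
    then show ?thesis using that by (rule agree)
  qed
  then show "\<forall>p. p \<epsilon> cx \<longleftrightarrow> (\<exists>y cy u. y \<epsilon> x \<and> pair_in y cy c' \<and> is_glb {} u \<and> is_pair cy u p)"
    unfolding H[rule_format] by blast
qed

lemma check_recursion_iff:
  "check_recursion T c \<longleftrightarrow> transitive_set T \<and> is_fun c T \<and> (\<forall>x cx. pair_in x cx c \<longrightarrow>
       (\<forall>p. p \<epsilon> cx \<longleftrightarrow> (\<exists>y cy u. y \<epsilon> x \<and> pair_in y cy c \<and> is_glb {} u \<and> is_pair cy u p)))"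
proof (cases "transitive_set T \<and> is_fun c T")
  case True
  then have T: "y \<epsilon> T" if "x \<epsilon> T" "y \<epsilon> x" for x y using that unfolding transitive_set_def by blast
  have c: "pair_in x y c \<longleftrightarrow> x \<epsilon> T \<and> y = app c x" for x y
  proof
    assume *: "pair_in x y c"
    then have "x \<epsilon> T" using is_fun_dom True by blast
    with * show "x \<epsilon> T \<and> y = app c x" using app_eq[of c T x y] True by simp
  next
    assume *: "x \<epsilon> T \<and> y = app c x"
    then show "pair_in x y c" using pair_in_app[of c T x] True by simp
  qed
  have R: "(\<exists>y cy u. y \<epsilon> x \<and> pair_in y cy c \<and> is_glb {} u \<and> is_pair cy u p) \<longleftrightarrow>
      (\<exists>y. y \<epsilon> x \<and> is_pair (app c y) one p)" if "x \<epsilon> T" for x p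
    unfolding c is_one_iff using T[OF that] by blast
  have "(\<forall>x cx. pair_in x cx c \<longrightarrow>
       (\<forall>p. p \<epsilon> cx \<longleftrightarrow> (\<exists>y cy u. y \<epsilon> x \<and> pair_in y cy c \<and> is_glb {} u \<and> is_pair cy u p))) \<longleftrightarrow>
    (\<forall>x. x \<epsilon> T \<longrightarrow> (\<forall>p. p \<epsilon> app c x \<longleftrightarrow> (\<exists>y. y \<epsilon> x \<and> is_pair (app c y) one p)))" (is "?l \<longleftrightarrow> ?r")
  proof
    assume l: ?l
    show ?r
    proof (intro allI impI)
      fix x p assume x: "x \<epsilon> T"
      have "pair_in x (app c x) c" unfolding c using x by simp
      with l have "p \<epsilon> app c x \<longleftrightarrow> (\<exists>y cy u. y \<epsilon> x \<and> pair_in y cy c \<and> is_glb {} u \<and> is_pair cy u p)" by simp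
      then show "p \<epsilon> app c x \<longleftrightarrow> (\<exists>y. y \<epsilon> x \<and> is_pair (app c y) one p)" unfolding R[OF x] .
    qed
  next
    assume r: ?r
    show ?l
    proof (intro allI impI)
      fix x cx p assume "pair_in x cx c"
      then have x: "x \<epsilon> T" "cx = app c x" unfolding c by simp_all
      show "p \<epsilon> cx \<longleftrightarrow> (\<exists>y cy u. y \<epsilon> x \<and> pair_in y cy c \<and> is_glb {} u \<and> is_pair cy u p)"
        unfolding R[OF x(1)] x(2) using r x(1) by simp
    qed
  qed
  then show ?thesis unfolding check_recursion_def by simp
qed (auto simp: check_recursion_def)

lemma check_rel_unique: "check_rel x z \<Longrightarrow> check_rel x z' \<Longrightarrow> z = z'"
proof -
  let ?P = "\<lambda>x. \<forall>z z'. check_rel x z \<and> check_rel x z' \<longrightarrow> z = z'"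
  have "?P x"
  proof (rule mem_induct[where P = ?P])
    show "definable (\<lambda>e. ?P (e 0))" by (intro codef)
    fix x assume IH: "\<And>y. y \<epsilon> x \<Longrightarrow> ?P y"
    show "?P x"
    proof (intro allI impI)
      fix z z' assume z: "check_rel x z \<and> check_rel x z'"
      have *: "p \<epsilon> z \<Longrightarrow> p \<epsilon> z'" if z: "check_rel x z" "check_rel x z'" for z z' p
      proof -
        assume p: "p \<epsilon> z"
        obtain T c where c: "transitive_set T" "is_fun c T"
          "\<And>x cx p. pair_in x cx c \<Longrightarrow> p \<epsilon> cx \<longleftrightarrow> (\<exists>y cy u. y \<epsilon> x \<and> pair_in y cy c \<and> is_glb {} u \<and> is_pair cy u p)"
          "pair_in x z c" using z(1) unfolding check_rel_def by blast
        obtain T' c' where c': "transitive_set T'" "is_fun c' T'"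
          "\<And>x cx p. pair_in x cx c' \<Longrightarrow> p \<epsilon> cx \<longleftrightarrow> (\<exists>y cy u. y \<epsilon> x \<and> pair_in y cy c' \<and> is_glb {} u \<and> is_pair cy u p)"
          "pair_in x z' c'" using z(2) unfolding check_rel_def by blast
        obtain y cy u where y: "y \<epsilon> x" "pair_in y cy c" "is_glb {} u" "is_pair cy u p"
          using c(3)[OF c(4)] p by blast
        have "y \<epsilon> T'" using is_fun_dom[OF c'(2,4)] c'(1) y(1) unfolding transitive_set_def by blast
        then obtain cy' where cy': "pair_in y cy' c'" using c'(2) unfolding is_fun_def by blast
        have "check_rel y cy" unfolding check_rel_def using c y(2) by blast
        moreover have "check_rel y cy'" unfolding check_rel_def using c' cy' by blast
        ultimately have "cy' = cy" using IH[OF y(1)] by blast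
        then show "p \<epsilon> z'" using c'(3)[OF c'(4)] y cy' by blast
      qed
      show "z = z'" by (rule extensionality) (use * z in blast)
    qed
  qed
  then show "check_rel x z \<Longrightarrow> check_rel x z' \<Longrightarrow> z = z'" by blast
qed

text \<open>Transitive sets exist around every \<open>x\<close>, and on them the recursion for \<open>check\<close> has a solution.\<close>
lemma check_rel_iff: "check_rel x z \<longleftrightarrow> z = check x"
proof -
  have rel: "(\<exists>T c. check_recursion T c \<and> x \<epsilon> T \<and> z = app c x) \<longleftrightarrow> check_rel x z" for z
  proof
    assume "\<exists>T c. check_recursion T c \<and> x \<epsilon> T \<and> z = app c x"
    then obtain T c where c: "check_recursion T c" "x \<epsilon> T" "z = app c x" by blast
    then have "pair_in x z c" using pair_in_app unfolding check_recursion_iff by blast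
    then show "check_rel x z" using c(1) unfolding check_rel_def check_recursion_iff by blast
  next
    assume "check_rel x z"
    then obtain T c where c: "check_recursion T c" "pair_in x z c"
      unfolding check_rel_def check_recursion_iff by blast
    then have "x \<epsilon> T" using is_fun_dom unfolding check_recursion_iff by blast
    moreover from this c have "app c x = z" using app_eq unfolding check_recursion_iff by blast
    ultimately show "\<exists>T c. check_recursion T c \<and> x \<epsilon> T \<and> z = app c x" using c(1) by blast
  qed
  obtain T where T: "transitive_set T" "x \<epsilon> T" using transitive_closure_exists by blast
  obtain c where c: "is_fun c T" "\<forall>x cx. pair_in x cx c \<longrightarrow>
       (\<forall>p. p \<epsilon> cx \<longleftrightarrow> (\<exists>y cy u. y \<epsilon> x \<and> pair_in y cy c \<and> is_glb {} u \<and> is_pair cy u p))"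
    using check_recursion_exists[OF T(1)] by blast
  have "check_rel x (app c x)" unfolding check_rel_def using T c pair_in_app[OF c(1) T(2)] by blast
  then have "\<exists>!z. check_rel x z" using check_rel_unique by blast
  then have "check_rel x (check x)" unfolding check_def rel by (rule theI')
  then show ?thesis using check_rel_unique by blast
qed

lemma mem_check: "p \<epsilon> check x \<longleftrightarrow> (\<exists>y. y \<epsilon> x \<and> is_pair (check y) one p)"
proof -
  have "check_rel x (check x)" by (simp add: check_rel_iff)
  then obtain T c where c: "transitive_set T" "is_fun c T"
    "\<And>x cx p. pair_in x cx c \<Longrightarrow> p \<epsilon> cx \<longleftrightarrow> (\<exists>y cy u. y \<epsilon> x \<and> pair_in y cy c \<and> is_glb {} u \<and> is_pair cy u p)"
    "pair_in x (check x) c" unfolding check_rel_def by blast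
  have chk: "pair_in y cy c \<longleftrightarrow> cy = check y" if "y \<epsilon> x" for y cy
  proof -
    have *: "cy = check y" if "pair_in y cy c" for cy
    proof -
      have "check_rel y cy" unfolding check_rel_def using c(1-3) that by blast
      then show ?thesis by (simp add: check_rel_iff)
    qed
    have "y \<epsilon> T" using is_fun_dom[OF c(2,4)] c(1) that unfolding transitive_set_def by blast
    then obtain cy' where "pair_in y cy' c" using c(2) unfolding is_fun_def by blast
    then show ?thesis using * by blast
  qed
  show ?thesis unfolding c(3)[OF c(4)] is_one_iff
  proof (intro ex_cong1)
    fix y show "(\<exists>cy u. y \<epsilon> x \<and> pair_in y cy c \<and> u = one \<and> is_pair cy u p) \<longleftrightarrow>
      y \<epsilon> x \<and> is_pair (check y) one p"
      by (cases "y \<epsilon> x") (simp_all add: chk)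
  qed
qed

lemma pair_in_check: "pair_in \<eta> b (check x) \<longleftrightarrow> (\<exists>y. y \<epsilon> x \<and> \<eta> = check y) \<and> b = one"
  unfolding pair_in_iff mem_check is_pair_iff opair_inject by blast

lemma check_in_names: "check x \<in> names"
proof -
  let ?P = "\<lambda>x. \<forall>z. check_rel x z \<longrightarrow> z \<in> names"
  have "?P x"
  proof (rule mem_induct[where P = ?P])
    show "definable (\<lambda>e. ?P (e 0))" by (intro codef)
    fix x assume IH: "\<And>y. y \<epsilon> x \<Longrightarrow> ?P y"
    then have "check y \<in> names" if "y \<epsilon> x" for y using that by (simp add: check_rel_iff)
    then have "check x \<in> names" unfolding names_iff[of "check x"] mem_check using one_in by blast
    then show "?P x" by (simp add: check_rel_iff)
  qed
  then show ?thesis by (simp add: check_rel_iff)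
qed

text \<open>By induction on \<open>x\<close>: some \<open>z\<close> belongs to exactly one of \<open>x\<close> and \<open>y\<close>. A condition forcing equality of \<open>x\<close>
  and \<open>y\<close> would have to force \<open>z\<close> to be equal to an element of the other set, all of which differ
  from \<open>z\<close>.\<close>
lemma eq_value_check_distinct: "x \<noteq> y \<Longrightarrow> \<lbrakk>check x =\<^sub>B check y\<rbrakk> = zero"
proof -
  note n = check_in_names
  let ?P = "\<lambda>x. \<forall>y u v w. x \<noteq> y \<and> check_rel x u \<and> check_rel y v \<and> eq_rel u v w \<longrightarrow> is_lub {} w"
  have P: "?P x \<longleftrightarrow> (\<forall>y. x \<noteq> y \<longrightarrow> \<lbrakk>check x =\<^sub>B check y\<rbrakk> = zero)" for x
    by (auto simp: check_rel_iff eq_rel_iff[OF n n] is_zero_iff)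
  have "?P x"
  proof (rule mem_induct[where P = ?P])
    show "definable (\<lambda>e. ?P (e 0))" by (intro codef)
    fix x assume "\<And>y. y \<epsilon> x \<Longrightarrow> ?P y"
    then have IH: "\<lbrakk>check z =\<^sub>B check w\<rbrakk> = zero" if "z \<epsilon> x" "z \<noteq> w" for z w using that unfolding P by blast
    show "?P x" unfolding P
    proof (intro allI impI)
      fix y assume "x \<noteq> y"
      let ?p = "\<lbrakk>check x =\<^sub>B check y\<rbrakk>"
      have p: "?p \<sqsubseteq> ?p" "?p \<sqsubseteq> \<lbrakk>check y =\<^sub>B check x\<rbrakk>" "?p \<sqsubseteq> one"
        using below_refl eq_value_in n eq_value_sym[OF n n] below_one by metis+
      \<comment> \<open>Used for \<open>x\<close> and \<open>y\<close> in either order.\<close>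
      have zero: "?p \<sqsubseteq> zero" if "?p \<sqsubseteq> \<lbrakk>check u =\<^sub>B check v\<rbrakk>" and z: "z \<epsilon> u" "\<not> z \<epsilon> v"
        and uv: "\<And>w. w \<epsilon> v \<Longrightarrow> \<lbrakk>check z =\<^sub>B check w\<rbrakk> = zero" for u v z
      proof -
        have zu: "pair_in (check z) one (check u)" unfolding pair_in_check using z by blast
        have "?p \<sqsubseteq> \<lbrakk>check z \<in>\<^sub>B check v\<rbrakk>"
          by (rule below_eq_valueD[OF n n that(1) zu below_mem_value_self[OF n zu p(3)]])
        then show ?thesis
        proof (rule mem_value_cases[OF n n _ zero_in])
          fix \<eta> b r assume "pair_in \<eta> b (check v)" and r: "r \<sqsubseteq> \<lbrakk>check z =\<^sub>B \<eta>\<rbrakk>"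
          then obtain w where "w \<epsilon> v" "\<eta> = check w" unfolding pair_in_check by blast
          then show "r \<sqsubseteq> zero" using r uv by simp
        qed
      qed
      from \<open>x \<noteq> y\<close> consider z where "z \<epsilon> x" "\<not> z \<epsilon> y" | z where "z \<epsilon> y" "\<not> z \<epsilon> x"
        using extensionality by blast
      then have "?p \<sqsubseteq> zero"
      proof cases
        case 1
        then show ?thesis using zero[OF p(1) 1] IH[OF 1(1)] by metis
      next
        case 2
        then show ?thesis using zero[OF p(2) 2] IH[of _ z] eq_value_sym[OF n n] by metis
      qed
      then show "?p = zero" unfolding below_zero .
    qed
  qed
  then show "x \<noteq> y \<Longrightarrow> \<lbrakk>check x =\<^sub>B check y\<rbrakk> = zero" unfolding P by blast
qed

lemma mem_value_check: "\<lbrakk>check x \<in>\<^sub>B check y\<rbrakk> = (if x \<epsilon> y then one else zero)"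
proof (cases "x \<epsilon> y")
  case True
  then have "pair_in (check x) one (check y)" unfolding pair_in_check by blast
  then have "one \<sqsubseteq> \<lbrakk>check x \<in>\<^sub>B check y\<rbrakk>"
    by (rule below_mem_value_self[OF check_in_names _ below_refl[OF one_in]])
  then show ?thesis using True below_antisym below_one mem_value_in check_in_names by metis
next
  case False
  have "\<lbrakk>check x \<in>\<^sub>B check y\<rbrakk> \<sqsubseteq> zero"
  proof (rule mem_value_cases[OF check_in_names check_in_names below_refl zero_in])
    fix \<eta> b r assume "pair_in \<eta> b (check y)" and r: "r \<sqsubseteq> \<lbrakk>check x =\<^sub>B \<eta>\<rbrakk>"
    then obtain w where "w \<epsilon> y" "\<eta> = check w" unfolding pair_in_check by blast
    moreover have "x \<noteq> w" using False \<open>w \<epsilon> y\<close> by blast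
    ultimately show "r \<sqsubseteq> zero" using r eq_value_check_distinct by simp
  qed (rule mem_value_in[OF check_in_names check_in_names])
  then show ?thesis using False unfolding below_zero by simp
qed

lemma ground_value_lub:
  assumes "\<tau> \<in> names"
  shows "is_lub {\<lbrakk>\<tau> =\<^sub>B check x\<rbrakk> | x. True} \<lbrakk>\<tau> \<in>\<^sub>B V\<rbrakk>"
    and "ground_rel \<tau> m \<longleftrightarrow> m = \<lbrakk>\<tau> \<in>\<^sub>B V\<rbrakk>"
proof -
  let ?S = "{s. \<exists>x z. check_rel x z \<and> eq_rel \<tau> z s}"
  have eq: "?S = {\<lbrakk>\<tau> =\<^sub>B check x\<rbrakk> | x. True}"
    by (auto simp: check_rel_iff eq_rel_iff[OF assms check_in_names])
  have "definable (\<lambda>e. e 0 \<in> ?S)" unfolding mem_Collect_eq by (intro codef)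
  moreover have "?S \<subseteq> elts B" unfolding eq elts_def using eq_value_in[OF assms check_in_names] by blast
  ultimately have lub: "is_lub ?S \<lbrakk>\<tau> \<in>\<^sub>B V\<rbrakk>"
    unfolding ground_value_def eq[symmetric] by (intro lub_bsup)
  then show "is_lub {\<lbrakk>\<tau> =\<^sub>B check x\<rbrakk> | x. True} \<lbrakk>\<tau> \<in>\<^sub>B V\<rbrakk>" unfolding eq .
  show "ground_rel \<tau> m \<longleftrightarrow> m = \<lbrakk>\<tau> \<in>\<^sub>B V\<rbrakk>" unfolding ground_rel_def using lub is_lub_unique by blast
qed

section \<open>Mixing of names\<close>

text \<open>The mixture of the names \<open>f(a)\<close> consists of the pairs \<open>\<langle>\<eta>, a \<sqinter> b\<rangle>\<close> with \<open>a \<in> A\<close> and \<open>\<langle>\<eta>, b\<rangle> \<in> f(a)\<close>: below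
  \<open>a\<close>, the pairs that come from other elements of the antichain disappear. Arguments at which \<open>f\<close> does not
  take a name contribute nothing.\<close>
lemma mixing:
  assumes A: "antichain A"
  shows "\<exists>\<tau>\<in>names. \<forall>a \<sigma>. a \<epsilon> A \<and> pair_in a \<sigma> f \<and> \<sigma> \<in> names \<and> (\<forall>\<sigma>'. pair_in a \<sigma>' f \<longrightarrow> \<sigma>' = \<sigma>) \<longrightarrow> a \<sqsubseteq> \<lbrakk>\<tau> =\<^sub>B \<sigma>\<rbrakk>"
proof -
  have A_in: "a \<epsilon> B" if "a \<epsilon> A" for a using A that unfolding antichain_def elts_def by blast
  have A_disj: "a \<sqinter> b = zero" if "a \<epsilon> A" "b \<epsilon> A" "a \<noteq> b" for a b
    using A that unfolding antichain_def elts_def by blast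
  have "small {\<sigma>. \<exists>a. pair_in a \<sigma> f}"
    by (rule small_field[of _ f]) (blast, unfold mem_Collect_eq, intro codef)
  then obtain s where s: "\<And>\<sigma>. \<sigma> \<epsilon> s \<longleftrightarrow> (\<exists>a. pair_in a \<sigma> f)" using smallD by blast
  obtain r where r: "\<And>p. p \<epsilon> r \<longleftrightarrow> (\<exists>\<sigma>. \<sigma> \<epsilon> s \<and> p \<epsilon> \<sigma>)" using smallD[OF small_Union[of s]] by blast
  have "small {\<eta>. \<exists>b. pair_in \<eta> b r}"
    by (rule small_field[of _ r]) (blast, unfold mem_Collect_eq, intro codef)
  then obtain d where d: "\<And>\<eta>. \<eta> \<epsilon> d \<longleftrightarrow> (\<exists>b. pair_in \<eta> b r)" using smallD by blast
  obtain D where D: "\<And>p. p \<epsilon> D \<longleftrightarrow> (\<exists>x y. x \<epsilon> d \<and> y \<epsilon> B \<and> is_pair x y p)"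
    using prod_exists[of d B] unfolding is_prod_def by blast
  define K where "K p \<longleftrightarrow> (\<exists>a \<sigma> \<eta> b c. a \<epsilon> A \<and> pair_in a \<sigma> f \<and> \<sigma> \<in> names \<and> pair_in \<eta> b \<sigma> \<and>
    is_glb {a, b} c \<and> is_pair \<eta> c p)" for p
  have K_D: "p \<epsilon> D" if Kp: "K p" for p
  proof -
    obtain a \<sigma> \<eta> b c where *: "pair_in a \<sigma> f" "pair_in \<eta> b \<sigma>" "is_glb {a, b} c" "is_pair \<eta> c p"
      using Kp unfolding K_def by blast
    have "\<eta> \<epsilon> d" unfolding d pair_in_iff r s using *(1,2) unfolding pair_in_iff by blast
    then show ?thesis unfolding D using * is_glb_in by blast
  qed
  have "definable (\<lambda>e. K (e 0))" unfolding K_def by (intro codef)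
  then obtain \<tau> where "\<And>p. p \<epsilon> \<tau> \<longleftrightarrow> p \<epsilon> D \<and> K p" using smallD[OF separation[of K D]] by blast
  then have \<tau>: "p \<epsilon> \<tau> \<longleftrightarrow> K p" for p using K_D by blast
  have pair_\<tau>: "pair_in \<eta> c \<tau> \<longleftrightarrow>
     (\<exists>a \<sigma> b. a \<epsilon> A \<and> pair_in a \<sigma> f \<and> \<sigma> \<in> names \<and> pair_in \<eta> b \<sigma> \<and> c = a \<sqinter> b)" for \<eta> c
  proof -
    have "pair_in \<eta> c \<tau> \<longleftrightarrow> (\<exists>a \<sigma> b. a \<epsilon> A \<and> pair_in a \<sigma> f \<and> \<sigma> \<in> names \<and> pair_in \<eta> b \<sigma> \<and> is_glb {a, b} c)"
      unfolding pair_in_iff[of \<eta> c \<tau>] \<tau> K_def is_pair_iff opair_inject by blast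
    also have "\<dots> \<longleftrightarrow> (\<exists>a \<sigma> b. a \<epsilon> A \<and> pair_in a \<sigma> f \<and> \<sigma> \<in> names \<and> pair_in \<eta> b \<sigma> \<and> c = a \<sqinter> b)"
      by (intro ex_cong1 conj_cong refl) (rule is_glb_iff, erule A_in, blast dest: names_pair)
    finally show ?thesis .
  qed
  have \<tau>n: "\<tau> \<in> names"
    unfolding names_iff[of \<tau>] \<tau> K_def using names_pair is_glb_in by blast
  have "a \<sqsubseteq> \<lbrakk>\<tau> =\<^sub>B \<sigma>\<rbrakk>" if a: "a \<epsilon> A" and \<sigma>: "pair_in a \<sigma> f" "\<sigma> \<in> names" "\<And>\<sigma>'. pair_in a \<sigma>' f \<Longrightarrow> \<sigma>' = \<sigma>" for a \<sigma>
    unfolding below_eq_value[OF \<tau>n \<sigma>(2) A_in[OF a]]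
  proof (intro conjI allI impI; elim conjE)
    fix \<eta> c p assume "pair_in \<eta> c \<tau>" and p: "p \<sqsubseteq> a" "p \<sqsubseteq> \<lbrakk>\<eta> \<in>\<^sub>B \<tau>\<rbrakk>"
    then have \<eta>n: "\<eta> \<in> names" using names_pair \<tau>n by blast
    from p(2) show "p \<sqsubseteq> \<lbrakk>\<eta> \<in>\<^sub>B \<sigma>\<rbrakk>"
    proof (rule mem_value_cases[OF \<eta>n \<tau>n _ mem_value_in[OF \<eta>n \<sigma>(2)]])
      fix \<xi> c q assume "pair_in \<xi> c \<tau>" and q: "q \<sqsubseteq> p" "q \<sqsubseteq> \<lbrakk>\<eta> =\<^sub>B \<xi>\<rbrakk>" "q \<sqsubseteq> c"
      then obtain a' \<sigma>' b where *: "a' \<epsilon> A" "pair_in a' \<sigma>' f" "\<sigma>' \<in> names" "pair_in \<xi> b \<sigma>'" "c = a' \<sqinter> b"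
        unfolding pair_\<tau> by blast
      have b: "b \<epsilon> B" using names_pair *(3,4) by blast
      have qa: "q \<sqsubseteq> a'" "q \<sqsubseteq> b" "q \<sqsubseteq> a"
        using q(3) meet_below[OF A_in[OF *(1)] b] below_trans q(1) p(1) unfolding *(5) by blast+
      show "q \<sqsubseteq> \<lbrakk>\<eta> \<in>\<^sub>B \<sigma>\<rbrakk>"
      proof (cases "a' = a")
        case True
        then have "pair_in \<xi> b \<sigma>" using * \<sigma>(3) by blast
        then show ?thesis using mem_value_below[OF \<eta>n \<sigma>(2)] q(2) qa(2) by blast
      next
        case False
        then have "q \<sqsubseteq> zero" using below_meet[OF qa(3,1)] A_disj[OF a *(1)] by simp
        moreover have "zero \<sqsubseteq> \<lbrakk>\<eta> \<in>\<^sub>B \<sigma>\<rbrakk>"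
          unfolding below_def using zero_in zero_le mem_value_in[OF \<eta>n \<sigma>(2)] by blast
        ultimately show ?thesis using below_trans by blast
      qed
    qed
  next
    fix \<eta> b0 p assume "pair_in \<eta> b0 \<sigma>" and p: "p \<sqsubseteq> a" "p \<sqsubseteq> \<lbrakk>\<eta> \<in>\<^sub>B \<sigma>\<rbrakk>"
    then have \<eta>n: "\<eta> \<in> names" using names_pair \<sigma>(2) by blast
    from p(2) show "p \<sqsubseteq> \<lbrakk>\<eta> \<in>\<^sub>B \<tau>\<rbrakk>"
    proof (rule mem_value_cases[OF \<eta>n \<sigma>(2) _ mem_value_in[OF \<eta>n \<tau>n]])
      fix \<xi> b q assume \<xi>: "pair_in \<xi> b \<sigma>" and q: "q \<sqsubseteq> p" "q \<sqsubseteq> \<lbrakk>\<eta> =\<^sub>B \<xi>\<rbrakk>" "q \<sqsubseteq> b"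
      have "pair_in \<xi> (a \<sqinter> b) \<tau>" unfolding pair_\<tau> using a \<sigma> \<xi> by blast
      moreover have "q \<sqsubseteq> a \<sqinter> b" by (rule below_meet[OF below_trans[OF q(1) p(1)] q(3)])
      ultimately show "q \<sqsubseteq> \<lbrakk>\<eta> \<in>\<^sub>B \<tau>\<rbrakk>" using mem_value_below[OF \<eta>n \<tau>n] q(2) by blast
    qed
  qed
  then show ?thesis using \<tau>n by blast
qed

end

section \<open>Filters\<close>

context cba_model begin

lemma filter_up: "is_filter F \<Longrightarrow> p \<in> F \<Longrightarrow> p \<sqsubseteq> a \<Longrightarrow> a \<in> F"
  unfolding is_filter_def below_def subset_eq Ball_def elts_iff by blast

lemma filter_meet: "is_filter F \<Longrightarrow> a \<in> F \<Longrightarrow> b \<in> F \<Longrightarrow> a \<sqinter> b \<in> F"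
  unfolding is_filter_def by blast

lemma filter_in: "is_filter F \<Longrightarrow> a \<in> F \<Longrightarrow> a \<epsilon> B"
  unfolding is_filter_def subset_eq Ball_def elts_iff by blast

lemma filter_one: "is_filter F \<Longrightarrow> one \<in> F" and filter_zero: "is_filter F \<Longrightarrow> zero \<notin> F"
  unfolding is_filter_def by blast+

lemma filter_common:
  assumes "is_filter F" "a \<in> F" "b \<in> F" obtains p where "p \<in> F" "p \<sqsubseteq> a" "p \<sqsubseteq> b"
  using filter_meet[OF assms] meet_below filter_in[OF assms(1)] assms(2,3) by blast

text \<open>The laws of equality, in the form in which a filter sees them.\<close>
lemma filter_eq_trans:
  assumes F: "is_filter F" and n: "\<tau> \<in> names" "\<sigma> \<in> names" "\<rho> \<in> names"
    and eq: "\<lbrakk>\<tau> =\<^sub>B \<sigma>\<rbrakk> \<in> F" "\<lbrakk>\<sigma> =\<^sub>B \<rho>\<rbrakk> \<in> F"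
  shows "\<lbrakk>\<tau> =\<^sub>B \<rho>\<rbrakk> \<in> F"
proof -
  obtain p where p: "p \<in> F" "p \<sqsubseteq> \<lbrakk>\<tau> =\<^sub>B \<sigma>\<rbrakk>" "p \<sqsubseteq> \<lbrakk>\<sigma> =\<^sub>B \<rho>\<rbrakk>" using filter_common[OF F eq] .
  then show ?thesis using eq_value_trans[OF n p(2,3)] filter_up[OF F] by blast
qed

lemma filter_mem_cong:
  assumes F: "is_filter F" and n: "\<tau> \<in> names" "\<tau>' \<in> names" "\<sigma> \<in> names" "\<sigma>' \<in> names"
    and eq: "\<lbrakk>\<tau> =\<^sub>B \<tau>'\<rbrakk> \<in> F" "\<lbrakk>\<sigma>' =\<^sub>B \<sigma>\<rbrakk> \<in> F" and mem: "\<lbrakk>\<tau>' \<in>\<^sub>B \<sigma>'\<rbrakk> \<in> F"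
  shows "\<lbrakk>\<tau> \<in>\<^sub>B \<sigma>\<rbrakk> \<in> F"
proof -
  obtain p where p: "p \<in> F" "p \<sqsubseteq> \<lbrakk>\<tau> =\<^sub>B \<tau>'\<rbrakk>" "p \<sqsubseteq> \<lbrakk>\<tau>' \<in>\<^sub>B \<sigma>'\<rbrakk>" using filter_common[OF F eq(1) mem] .
  then have "\<lbrakk>\<tau> \<in>\<^sub>B \<sigma>'\<rbrakk> \<in> F" using mem_value_subst_left[OF n(1,2,4)] filter_up[OF F] by blast
  then obtain q where q: "q \<in> F" "q \<sqsubseteq> \<lbrakk>\<tau> \<in>\<^sub>B \<sigma>'\<rbrakk>" "q \<sqsubseteq> \<lbrakk>\<sigma>' =\<^sub>B \<sigma>\<rbrakk>" using filter_common[OF F _ eq(2)] by blast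
  then show ?thesis using mem_value_subst_right[OF n(1,4,3)] filter_up[OF F] by blast
qed

lemma filter_eq_refl: "is_filter F \<Longrightarrow> \<tau> \<in> names \<Longrightarrow> \<lbrakk>\<tau> =\<^sub>B \<tau>\<rbrakk> \<in> F"
  by (simp add: eq_value_refl filter_one)

lemma filter_eq_sym: "\<lbrakk>\<tau> =\<^sub>B \<sigma>\<rbrakk> \<in> F \<Longrightarrow> \<tau> \<in> names \<Longrightarrow> \<sigma> \<in> names \<Longrightarrow> \<lbrakk>\<sigma> =\<^sub>B \<tau>\<rbrakk> \<in> F"
  by (simp add: eq_value_sym)

lemma name_class_eq_iff:
  assumes F: "is_filter F" and n: "\<tau> \<in> names" "\<sigma> \<in> names"
  shows "name_class F \<tau> = name_class F \<sigma> \<longleftrightarrow> \<lbrakk>\<tau> =\<^sub>B \<sigma>\<rbrakk> \<in> F"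
proof
  assume "name_class F \<tau> = name_class F \<sigma>"
  moreover have "\<tau> \<in> name_class F \<tau>" unfolding name_class_def using n filter_eq_refl[OF F] by blast
  ultimately show "\<lbrakk>\<tau> =\<^sub>B \<sigma>\<rbrakk> \<in> F" unfolding name_class_def by blast
next
  assume eq: "\<lbrakk>\<tau> =\<^sub>B \<sigma>\<rbrakk> \<in> F"
  have "\<lbrakk>\<rho> =\<^sub>B \<tau>\<rbrakk> \<in> F \<longleftrightarrow> \<lbrakk>\<rho> =\<^sub>B \<sigma>\<rbrakk> \<in> F" if "\<rho> \<in> names" for \<rho>
    using filter_eq_trans[OF F that n(1,2) _ eq] filter_eq_trans[OF F that n(2,1) _ filter_eq_sym[OF eq n]] by blast
  then show "name_class F \<tau> = name_class F \<sigma>" unfolding name_class_def by blast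
qed

lemma mem_class_iff:
  assumes F: "is_filter F" and n: "\<tau> \<in> names" "\<sigma> \<in> names"
  shows "mem_class F (name_class F \<tau>) (name_class F \<sigma>) \<longleftrightarrow> \<lbrakk>\<tau> \<in>\<^sub>B \<sigma>\<rbrakk> \<in> F"
proof
  assume "mem_class F (name_class F \<tau>) (name_class F \<sigma>)"
  then obtain \<tau>' \<sigma>' where *: "\<tau>' \<in> names" "\<lbrakk>\<tau>' =\<^sub>B \<tau>\<rbrakk> \<in> F" "\<sigma>' \<in> names" "\<lbrakk>\<sigma>' =\<^sub>B \<sigma>\<rbrakk> \<in> F" "\<lbrakk>\<tau>' \<in>\<^sub>B \<sigma>'\<rbrakk> \<in> F"
    unfolding mem_class_def name_class_def by blast
  then show "\<lbrakk>\<tau> \<in>\<^sub>B \<sigma>\<rbrakk> \<in> F" using filter_mem_cong[OF F n(1) *(1) n(2) *(3)] filter_eq_sym[OF _ *(1) n(1)] by blast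
next
  assume "\<lbrakk>\<tau> \<in>\<^sub>B \<sigma>\<rbrakk> \<in> F"
  then show "mem_class F (name_class F \<tau>) (name_class F \<sigma>)"
    unfolding mem_class_def name_class_def using n filter_eq_refl[OF F] by blast
qed

section \<open>Generic filters\<close>

lemma meet_compl_zero: "a \<epsilon> B \<Longrightarrow> b \<epsilon> B \<Longrightarrow> b \<sqinter> compl a = zero \<Longrightarrow> b \<preceq> a"
proof -
  assume a: "a \<epsilon> B" and b: "b \<epsilon> B" and z: "b \<sqinter> compl a = zero"
  have "b = b \<sqinter> (a \<squnion> compl a)" using a b by (simp add: join_compl meet_one)
  also have "\<dots> = (b \<sqinter> a) \<squnion> (b \<sqinter> compl a)" using a b compl_in by (intro meet_join_distrib)
  also have "\<dots> = b \<sqinter> a" using z a b join_zero meet_in by simp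
  finally have "b \<sqinter> a = b" by (rule sym)
  then show "b \<preceq> a" using meet_le2[OF b a] by simp
qed

lemma generic_meets:
  assumes F: "is_filter F" "generic F" and def: "definable (\<lambda>e. P (e 0))"
    and dense: "\<And>b. b \<epsilon> B \<Longrightarrow> b \<noteq> zero \<Longrightarrow> \<exists>d. d \<epsilon> B \<and> P d \<and> d \<noteq> zero \<and> d \<preceq> b"
  obtains d where "d \<in> F" "P d"
proof -
  obtain D where D: "\<And>d. d \<epsilon> D \<longleftrightarrow> d \<epsilon> B \<and> P d" using smallD[OF separation[OF def, of B]] by blast
  have "dense D" unfolding dense_def subset_eq Ball_def Bex_def elts_iff D using dense by blast
  then have "F \<inter> elts D \<noteq> {}" using F(2) unfolding generic_def by blast
  then obtain d where "d \<in> F" "d \<epsilon> D" by (auto simp: elts_iff)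
  then show ?thesis using that D by blast
qed

text \<open>The conditions that are below an element of \<open>S\<close> or incompatible with its supremum are dense, and the second
  kind is excluded by \<open>s \<in> F\<close>.\<close>
lemma generic_lub:
  assumes F: "is_filter F" "generic F" and S: "is_lub S s" "s \<in> F" "S \<subseteq> elts B"
    and def: "definable (\<lambda>e. e 0 \<in> S)"
  shows "\<exists>a\<in>S. a \<in> F"
proof -
  have s: "s \<epsilon> B" by (rule is_lub_in[OF S(1)])
  have S_in: "a \<epsilon> B" if "a \<in> S" for a using S(3) that by (auto simp: elts_iff)
  let ?P = "\<lambda>d. (\<exists>a. a \<in> S \<and> d \<preceq> a) \<or> (\<exists>z. is_lub {} z \<and> is_glb {d, s} z)"
  obtain d where d: "d \<in> F" "?P d"
  proof (rule generic_meets[OF F, of ?P])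
    show "definable (\<lambda>e. ?P (e 0))"
      by (intro codef codef_subst1[where P = "\<lambda>a. a \<in> S" and P' = "\<lambda>a. a \<in> S", OF def])
  next
    fix b assume b: "b \<epsilon> B" "b \<noteq> zero"
    show "\<exists>d. d \<epsilon> B \<and> ?P d \<and> d \<noteq> zero \<and> d \<preceq> b"
    proof (cases "\<exists>a\<in>S. b \<sqinter> a \<noteq> zero")
      case True
      then obtain a where a: "a \<in> S" "b \<sqinter> a \<noteq> zero" by blast
      note ai = S_in[OF a(1)]
      have "b \<sqinter> a \<epsilon> B" "b \<sqinter> a \<preceq> b" "b \<sqinter> a \<preceq> a"
        by (rule meet_in[OF b(1) ai] meet_le1[OF b(1) ai] meet_le2[OF b(1) ai])+
      then show ?thesis using a by (intro exI[of _ "b \<sqinter> a"]) auto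
    next
      case False
      have "b \<sqinter> s \<preceq> zero"
        by (rule meet_lub_le[OF S(1) b(1) zero_in S_in]) (use False zero_le zero_in in auto)
      then have "b \<sqinter> s = zero" using le_zero meet_in b s by blast
      then show ?thesis using glb_zero_iff[OF b(1) s] b le_refl by blast
    qed
  qed
  have d_in: "d \<epsilon> B" by (rule filter_in[OF F(1) d(1)])
  have "d \<sqinter> s \<noteq> zero" using filter_meet[OF F(1) d(1) S(2)] filter_zero[OF F(1)] by metis
  then obtain a where "a \<in> S" "d \<preceq> a" using d(2) glb_zero_iff[OF d_in s] by blast
  then show ?thesis using filter_up[OF F(1) d(1)] S_in d_in unfolding below_def by blast
qed

text \<open>Dually, the conditions below the infimum or incompatible with an element of \<open>S\<close> are dense.\<close>
lemma generic_glb: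
  assumes F: "is_filter F" "generic F" and S: "is_glb S s" "S \<subseteq> F"
    and def: "definable (\<lambda>e. e 0 \<in> S)"
  shows "s \<in> F"
proof -
  have s: "s \<epsilon> B" by (rule is_glb_in[OF S(1)])
  have S_in: "a \<epsilon> B" if "a \<in> S" for a using S(2) that filter_in[OF F(1)] by blast
  let ?P = "\<lambda>d. d \<preceq> s \<or> (\<exists>a z. a \<in> S \<and> is_lub {} z \<and> is_glb {d, a} z)"
  obtain d where d: "d \<in> F" "?P d"
  proof (rule generic_meets[OF F, of ?P])
    show "definable (\<lambda>e. ?P (e 0))"
      by (intro codef codef_subst1[where P = "\<lambda>a. a \<in> S" and P' = "\<lambda>a. a \<in> S", OF def])
  next
    fix b assume b: "b \<epsilon> B" "b \<noteq> zero"
    show "\<exists>d. d \<epsilon> B \<and> ?P d \<and> d \<noteq> zero \<and> d \<preceq> b"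
    proof (cases "\<exists>a\<in>S. b \<sqinter> compl a \<noteq> zero")
      case True
      then obtain a where a: "a \<in> S" "b \<sqinter> compl a \<noteq> zero" by blast
      note ai = S_in[OF a(1)]
      let ?d = "b \<sqinter> compl a"
      have di: "?d \<epsilon> B" using b ai compl_in meet_in by blast
      have "?d \<sqinter> a \<sqsubseteq> a \<sqinter> compl a"
        using below_meet meet_below[OF di ai] meet_below[OF b(1) compl_in[OF ai]] below_trans by blast
      then have "?d \<sqinter> a = zero" unfolding meet_compl[OF ai] below_zero .
      then show ?thesis using glb_zero_iff[OF di ai] di a meet_le1[OF b(1) compl_in[OF ai]] by blast
    next
      case False
      then have "\<forall>a\<in>S. b \<preceq> a" using meet_compl_zero S_in b(1) by blast
      then have "b \<preceq> s" using S(1) b(1) unfolding is_glb_def by blast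
      then show ?thesis using b le_refl by blast
    qed
  qed
  have d_in: "d \<epsilon> B" by (rule filter_in[OF F(1) d(1)])
  have "d \<sqinter> a \<noteq> zero" if "a \<in> S" for a
    using filter_meet[OF F(1) d(1)] S(2) that filter_zero[OF F(1)] by (metis subsetD)
  then have "d \<preceq> s" using d(2) glb_zero_iff[OF d_in] S_in by metis
  then show ?thesis using filter_up[OF F(1) d(1)] s d_in unfolding below_def by blast
qed

lemma generic_compl:
  assumes F: "is_filter F" "generic F" and a: "a \<epsilon> B"
  shows "a \<in> F \<or> compl a \<in> F"
proof -
  have "\<exists>x\<in>{a, compl a}. x \<in> F"
  proof (rule generic_lub[OF F])
    show "is_lub {a, compl a} one" using lub_join[OF a compl_in[OF a]] unfolding join_compl[OF a] .
    show "{a, compl a} \<subseteq> elts B" using a compl_in by (auto simp: elts_iff)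
    show "definable (\<lambda>e. e 0 \<in> {a, compl a})" unfolding insert_iff empty_iff by (intro codef)
  qed (rule filter_one[OF F(1)])
  then show ?thesis by blast
qed

lemma generic_mem_iff:
  assumes F: "is_filter F" "generic F" and n: "\<tau> \<in> names" "\<sigma> \<in> names"
  shows "\<lbrakk>\<tau> \<in>\<^sub>B \<sigma>\<rbrakk> \<in> F \<longleftrightarrow> (\<exists>\<eta> b. pair_in \<eta> b \<sigma> \<and> b \<in> F \<and> \<lbrakk>\<tau> =\<^sub>B \<eta>\<rbrakk> \<in> F)"
proof
  let ?S = "{s. \<exists>\<eta> b u. pair_in \<eta> b \<sigma> \<and> eq_rel \<tau> \<eta> u \<and> is_glb {u, b} s}"
  assume "\<lbrakk>\<tau> \<in>\<^sub>B \<sigma>\<rbrakk> \<in> F"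
  moreover have "is_lub ?S \<lbrakk>\<tau> \<in>\<^sub>B \<sigma>\<rbrakk>" using mem_value_lub(2)[OF n] unfolding mem_value_rel_def by simp
  moreover have "?S \<subseteq> elts B" using is_glb_in by (auto simp: elts_iff)
  moreover have "definable (\<lambda>e. e 0 \<in> ?S)" unfolding mem_Collect_eq by (intro codef)
  ultimately obtain s where "s \<in> ?S" and s: "s \<in> F" using generic_lub[OF F] by blast
  then obtain \<eta> b u where *: "pair_in \<eta> b \<sigma>" "eq_rel \<tau> \<eta> u" "is_glb {u, b} s" by blast
  have \<eta>: "\<eta> \<in> names" "b \<epsilon> B" using names_pair[OF n(2) *(1)] by blast+
  then have u: "u = \<lbrakk>\<tau> =\<^sub>B \<eta>\<rbrakk>" "u \<epsilon> B" using *(2) eq_rel_iff[OF n(1) \<eta>(1)] eq_value_in[OF n(1) \<eta>(1)] by simp_all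
  have "s = u \<sqinter> b" using *(3) is_glb_iff[OF u(2) \<eta>(2)] by simp
  then have "u \<in> F" "b \<in> F" using filter_up[OF F(1) s] meet_below[OF u(2) \<eta>(2)] by simp_all
  then show "\<exists>\<eta> b. pair_in \<eta> b \<sigma> \<and> b \<in> F \<and> \<lbrakk>\<tau> =\<^sub>B \<eta>\<rbrakk> \<in> F" using * u by blast
next
  assume "\<exists>\<eta> b. pair_in \<eta> b \<sigma> \<and> b \<in> F \<and> \<lbrakk>\<tau> =\<^sub>B \<eta>\<rbrakk> \<in> F"
  then obtain \<eta> b where *: "pair_in \<eta> b \<sigma>" "b \<in> F" "\<lbrakk>\<tau> =\<^sub>B \<eta>\<rbrakk> \<in> F" by blast
  obtain p where p: "p \<in> F" "p \<sqsubseteq> b" "p \<sqsubseteq> \<lbrakk>\<tau> =\<^sub>B \<eta>\<rbrakk>" using filter_common[OF F(1) *(2,3)] .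
  then show "\<lbrakk>\<tau> \<in>\<^sub>B \<sigma>\<rbrakk> \<in> F" using filter_up[OF F(1) p(1)] mem_value_below[OF n *(1)] by blast
qed

text \<open>The value of an inclusion is an infimum of implications, each of which \<open>F\<close> contains because it decides the
  antecedent.\<close>
lemma generic_eqI:
  assumes F: "is_filter F" "generic F" and n: "\<tau> \<in> names" "\<sigma> \<in> names"
    and 1: "\<And>\<eta> b. pair_in \<eta> b \<tau> \<Longrightarrow> \<lbrakk>\<eta> \<in>\<^sub>B \<tau>\<rbrakk> \<in> F \<Longrightarrow> \<lbrakk>\<eta> \<in>\<^sub>B \<sigma>\<rbrakk> \<in> F"
    and 2: "\<And>\<eta> b. pair_in \<eta> b \<sigma> \<Longrightarrow> \<lbrakk>\<eta> \<in>\<^sub>B \<sigma>\<rbrakk> \<in> F \<Longrightarrow> \<lbrakk>\<eta> \<in>\<^sub>B \<tau>\<rbrakk> \<in> F"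
  shows "\<lbrakk>\<tau> =\<^sub>B \<sigma>\<rbrakk> \<in> F"
proof -
  have sub: "sub_val eq_value \<tau> \<sigma> \<in> F"
    if n: "\<tau> \<in> names" "\<sigma> \<in> names" and *: "\<And>\<eta> b. pair_in \<eta> b \<tau> \<Longrightarrow> \<lbrakk>\<eta> \<in>\<^sub>B \<tau>\<rbrakk> \<in> F \<Longrightarrow> \<lbrakk>\<eta> \<in>\<^sub>B \<sigma>\<rbrakk> \<in> F" for \<tau> \<sigma>
  proof -
    let ?S = "{compl \<lbrakk>\<eta> \<in>\<^sub>B \<tau>\<rbrakk> \<squnion> \<lbrakk>\<eta> \<in>\<^sub>B \<sigma>\<rbrakk> | \<eta>. \<exists>b. pair_in \<eta> b \<tau>}"
    have v: "\<lbrakk>\<eta> \<in>\<^sub>B \<tau>\<rbrakk> \<epsilon> B" "\<lbrakk>\<eta> \<in>\<^sub>B \<sigma>\<rbrakk> \<epsilon> B" "\<eta> \<in> names" if "pair_in \<eta> b \<tau>" for \<eta> b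
      using names_pair[OF n(1) that] mem_value_in n by blast+
    have "s \<in> ?S \<longleftrightarrow> (\<exists>\<eta> b m1 m2 c. pair_in \<eta> b \<tau> \<and> mem_value_rel \<eta> \<tau> m1 \<and> mem_value_rel \<eta> \<sigma> m2 \<and>
       is_compl m1 c \<and> is_lub {c, m2} s)" for s
    proof -
      have "s \<in> ?S \<longleftrightarrow> (\<exists>\<eta> b. pair_in \<eta> b \<tau> \<and> s = compl \<lbrakk>\<eta> \<in>\<^sub>B \<tau>\<rbrakk> \<squnion> \<lbrakk>\<eta> \<in>\<^sub>B \<sigma>\<rbrakk>)" by blast
      also have "\<dots> \<longleftrightarrow> (\<exists>\<eta> b. pair_in \<eta> b \<tau> \<and> (\<exists>m1 m2 c. mem_value_rel \<eta> \<tau> m1 \<and> mem_value_rel \<eta> \<sigma> m2 \<and>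
         is_compl m1 c \<and> is_lub {c, m2} s))"
        by (intro ex_cong1 conj_cong refl)
          (simp add: mem_value_lub(2) v n is_compl_iff is_lub_iff compl_in)
      finally show ?thesis by blast
    qed
    then have "definable (\<lambda>e. e 0 \<in> ?S)" by (simp only:) (intro codef)
    moreover have "compl \<lbrakk>\<eta> \<in>\<^sub>B \<tau>\<rbrakk> \<squnion> \<lbrakk>\<eta> \<in>\<^sub>B \<sigma>\<rbrakk> \<in> F" if \<eta>: "pair_in \<eta> b \<tau>" for \<eta> b
    proof -
      note v = v[OF \<eta>]
      have "compl \<lbrakk>\<eta> \<in>\<^sub>B \<tau>\<rbrakk> \<sqsubseteq> compl \<lbrakk>\<eta> \<in>\<^sub>B \<tau>\<rbrakk> \<squnion> \<lbrakk>\<eta> \<in>\<^sub>B \<sigma>\<rbrakk>" "\<lbrakk>\<eta> \<in>\<^sub>B \<sigma>\<rbrakk> \<sqsubseteq> compl \<lbrakk>\<eta> \<in>\<^sub>B \<tau>\<rbrakk> \<squnion> \<lbrakk>\<eta> \<in>\<^sub>B \<sigma>\<rbrakk>"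
        unfolding below_def using v compl_in join_in join_ge1 join_ge2 by blast+
      then show ?thesis using filter_up[OF F(1)] generic_compl[OF F v(1)] *[OF \<eta>] by blast
    qed
    then have "?S \<subseteq> F" by blast
    ultimately show ?thesis using generic_glb[OF F eq_value_equation(2)[OF n]] by blast
  qed
  show ?thesis unfolding eq_value_equation(1)[OF n]
    by (rule filter_meet[OF F(1) sub[OF n 1] sub[OF n(2,1) 2]])
qed

section \<open>Valuations of names\<close>

lemma pair_in_tranclp: "pair_in \<eta> b \<tau> \<Longrightarrow> (\<epsilon>)\<^sup>+\<^sup>+ \<eta> \<tau>"
proof -
  assume "pair_in \<eta> b \<tau>"
  then obtain u where "\<eta> \<epsilon> u" "u \<epsilon> opair \<eta> b" "opair \<eta> b \<epsilon> \<tau>"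
    unfolding pair_in_iff using pair_components by blast
  then show ?thesis by (meson tranclp.r_into_trancl tranclp.trancl_into_trancl)
qed

text \<open>The truth lemma for equalities, by external well-founded induction on \<open>\<sigma>\<close> for all \<open>\<tau>\<close>. Only pairs from
  \<open>dom \<sigma> \<times> dom \<tau>\<close> are compared: a name \<open>\<eta>\<close> whose membership in \<open>\<sigma>\<close> has its value in \<open>F\<close> is first replaced by some
  \<open>\<xi>\<close> with \<open>\<langle>\<xi>, b\<rangle> \<in> \<sigma>\<close> and \<open>b \<in> F\<close>, using genericity.\<close>
lemma valuation_eq_iff:
  assumes wf: "wfp (\<epsilon>)" and F: "is_filter F" "generic F" and val: "valuation F val R"
    and n: "\<sigma> \<in> names" "\<tau> \<in> names"
  shows "\<lbrakk>\<sigma> =\<^sub>B \<tau>\<rbrakk> \<in> F \<longleftrightarrow> val \<sigma> = val \<tau>"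
proof -
  have R: "R x (val \<tau>) \<longleftrightarrow> (\<exists>\<eta> b. pair_in \<eta> b \<tau> \<and> b \<in> F \<and> x = val \<eta>)"
    if "\<tau> \<in> names" "x \<in> val ` names" for \<tau> x
    using val that unfolding valuation_def by blast
  have ext: "val \<sigma> = val \<tau>" if "\<sigma> \<in> names" "\<tau> \<in> names" "\<And>z. z \<in> val ` names \<Longrightarrow> R z (val \<sigma>) \<longleftrightarrow> R z (val \<tau>)" for \<sigma> \<tau>
    using val that unfolding valuation_def by blast
  have "wfp (\<epsilon>)\<^sup>+\<^sup>+" using wf by (rule wfp_tranclp)
  then have "\<forall>\<tau>. \<sigma> \<in> names \<longrightarrow> \<tau> \<in> names \<longrightarrow> (\<lbrakk>\<sigma> =\<^sub>B \<tau>\<rbrakk> \<in> F \<longleftrightarrow> val \<sigma> = val \<tau>)"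
  proof (induction \<sigma> rule: wfp_induct_rule)
    case (less \<sigma>)
    show ?case
    proof (intro allI impI)
      fix \<tau> assume n: "\<sigma> \<in> names" "\<tau> \<in> names"
      have IH: "\<lbrakk>\<eta> =\<^sub>B \<theta>\<rbrakk> \<in> F \<longleftrightarrow> val \<eta> = val \<theta>" if "pair_in \<eta> b \<sigma>" "\<theta> \<in> names" for \<eta> b \<theta>
        using less[OF pair_in_tranclp[OF that(1)]] names_pair[OF n(1) that(1)] that(2) by blast
      have self: "\<lbrakk>\<eta> \<in>\<^sub>B \<rho>\<rbrakk> \<in> F" if "pair_in \<eta> b \<rho>" "b \<in> F" "\<rho> \<in> names" for \<eta> b \<rho>
        using that generic_mem_iff[OF F _ that(3)] names_pair filter_eq_refl[OF F(1)] by blast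
      have IH': "\<lbrakk>\<theta> =\<^sub>B \<eta>\<rbrakk> \<in> F \<longleftrightarrow> val \<theta> = val \<eta>" if "pair_in \<eta> b \<sigma>" "\<theta> \<in> names" for \<eta> b \<theta>
        using IH[OF that] eq_value_sym[OF that(2)] names_pair[OF n(1) that(1)] by auto
      show "\<lbrakk>\<sigma> =\<^sub>B \<tau>\<rbrakk> \<in> F \<longleftrightarrow> val \<sigma> = val \<tau>"
      proof
        assume eq: "\<lbrakk>\<sigma> =\<^sub>B \<tau>\<rbrakk> \<in> F"
        have sub: "R z (val \<rho>')" if z: "R z (val \<rho>)" "z \<in> val ` names" and e: "\<lbrakk>\<rho> =\<^sub>B \<rho>'\<rbrakk> \<in> F" and \<rho>: "\<rho> \<in> names" "\<rho>' \<in> names"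
          and cmp: "\<And>\<eta> \<theta> b c. pair_in \<eta> b \<rho> \<Longrightarrow> pair_in \<theta> c \<rho>' \<Longrightarrow> \<lbrakk>\<eta> =\<^sub>B \<theta>\<rbrakk> \<in> F \<Longrightarrow> val \<eta> = val \<theta>" for z \<rho> \<rho>'
        proof -
          obtain \<eta> b where \<eta>: "pair_in \<eta> b \<rho>" "b \<in> F" "z = val \<eta>" using z(1) unfolding R[OF \<rho>(1) z(2)] by blast
          have \<eta>n: "\<eta> \<in> names" using names_pair \<rho>(1) \<eta>(1) by blast
          have "\<lbrakk>\<eta> \<in>\<^sub>B \<rho>'\<rbrakk> \<in> F"
            by (rule filter_mem_cong[OF F(1) \<eta>n \<eta>n \<rho>(2,1) filter_eq_refl[OF F(1) \<eta>n] e self[OF \<eta>(1,2) \<rho>(1)]])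
          then obtain \<theta> c where "pair_in \<theta> c \<rho>'" "c \<in> F" "\<lbrakk>\<eta> =\<^sub>B \<theta>\<rbrakk> \<in> F"
            unfolding generic_mem_iff[OF F \<eta>n \<rho>(2)] by blast
          then show ?thesis unfolding R[OF \<rho>(2) z(2)] using cmp[OF \<eta>(1)] \<eta>(3) by blast
        qed
        show "val \<sigma> = val \<tau>"
        proof (rule ext[OF n], rule iffI)
          fix z assume "z \<in> val ` names" "R z (val \<sigma>)"
          then show "R z (val \<tau>)" using sub[OF _ _ eq n] IH names_pair[OF n(2)] by blast
        next
          fix z assume "z \<in> val ` names" "R z (val \<tau>)"
          then show "R z (val \<sigma>)" using sub[OF _ _ filter_eq_sym[OF eq n] n(2,1)] IH' names_pair[OF n(2)] by blast
        qed
      next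
        assume eq: "val \<sigma> = val \<tau>"
        have sub: "\<lbrakk>\<eta> \<in>\<^sub>B \<rho>'\<rbrakk> \<in> F" if \<eta>: "pair_in \<eta> b \<rho>" "\<lbrakk>\<eta> \<in>\<^sub>B \<rho>\<rbrakk> \<in> F" and v: "val \<rho> = val \<rho>'" and \<rho>: "\<rho> \<in> names" "\<rho>' \<in> names"
          and cmp: "\<And>\<xi> \<theta> b c. pair_in \<xi> b \<rho> \<Longrightarrow> pair_in \<theta> c \<rho>' \<Longrightarrow> val \<xi> = val \<theta> \<Longrightarrow> \<lbrakk>\<xi> =\<^sub>B \<theta>\<rbrakk> \<in> F" for \<eta> b \<rho> \<rho>'
        proof -
          have \<eta>n: "\<eta> \<in> names" using names_pair \<rho>(1) \<eta>(1) by blast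
          obtain \<xi> d where \<xi>: "pair_in \<xi> d \<rho>" "d \<in> F" "\<lbrakk>\<eta> =\<^sub>B \<xi>\<rbrakk> \<in> F"
            using \<eta>(2) unfolding generic_mem_iff[OF F \<eta>n \<rho>(1)] by blast
          have \<xi>n: "\<xi> \<in> names" using names_pair \<rho>(1) \<xi>(1) by blast
          have "R (val \<xi>) (val \<rho>')" unfolding v[symmetric] R[OF \<rho>(1) imageI[OF \<xi>n]] using \<xi> by blast
          then obtain \<theta> c where \<theta>: "pair_in \<theta> c \<rho>'" "c \<in> F" "val \<xi> = val \<theta>"
            unfolding R[OF \<rho>(2) imageI[OF \<xi>n]] by blast
          have "\<theta> \<in> names" using names_pair \<rho>(2) \<theta>(1) by blast
          then have "\<lbrakk>\<eta> =\<^sub>B \<theta>\<rbrakk> \<in> F" by (rule filter_eq_trans[OF F(1) \<eta>n \<xi>n _ \<xi>(3) cmp[OF \<xi>(1) \<theta>(1,3)]])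
          then show ?thesis unfolding generic_mem_iff[OF F \<eta>n \<rho>(2)] using \<theta>(1,2) by blast
        qed
        show "\<lbrakk>\<sigma> =\<^sub>B \<tau>\<rbrakk> \<in> F"
        proof (rule generic_eqI[OF F n])
          fix \<eta> b assume "pair_in \<eta> b \<sigma>" "\<lbrakk>\<eta> \<in>\<^sub>B \<sigma>\<rbrakk> \<in> F"
          then show "\<lbrakk>\<eta> \<in>\<^sub>B \<tau>\<rbrakk> \<in> F" using sub[OF _ _ eq n] IH names_pair[OF n(2)] by blast
        next
          fix \<eta> b assume "pair_in \<eta> b \<tau>" "\<lbrakk>\<eta> \<in>\<^sub>B \<tau>\<rbrakk> \<in> F"
          then show "\<lbrakk>\<eta> \<in>\<^sub>B \<sigma>\<rbrakk> \<in> F" using sub[OF _ _ eq[symmetric] n(2,1)] IH' names_pair[OF n(2)] by blast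
        qed
      qed
    qed
  qed
  then show ?thesis using n by blast
qed

lemma valuation_mem_iff:
  assumes wf: "wfp (\<epsilon>)" and F: "is_filter F" "generic F" and val: "valuation F val R"
    and n: "\<sigma> \<in> names" "\<tau> \<in> names"
  shows "\<lbrakk>\<sigma> \<in>\<^sub>B \<tau>\<rbrakk> \<in> F \<longleftrightarrow> R (val \<sigma>) (val \<tau>)"
proof -
  have "R (val \<sigma>) (val \<tau>) \<longleftrightarrow> (\<exists>\<eta> b. pair_in \<eta> b \<tau> \<and> b \<in> F \<and> val \<sigma> = val \<eta>)"
    using val n unfolding valuation_def by blast
  also have "\<dots> \<longleftrightarrow> (\<exists>\<eta> b. pair_in \<eta> b \<tau> \<and> b \<in> F \<and> \<lbrakk>\<sigma> =\<^sub>B \<eta>\<rbrakk> \<in> F)"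
    using valuation_eq_iff[OF wf F val n(1)] names_pair[OF n(2)] by blast
  finally show ?thesis unfolding generic_mem_iff[OF F n] by blast
qed

end

section \<open>Complete Boolean algebras under elementary embeddings\<close>

context internal_algebra begin

text \<open>A first-order form of completeness and of the Boolean laws, without definite descriptions. It
  implies the original form in any structure, because antisymmetry alone makes suprema and infima
  unique; this is how \<open>(j B, j L)\<close> is seen to be a complete Boolean algebra of \<open>W\<close>.\<close>
definition cba_rel :: bool where
  "cba_rel \<longleftrightarrow>
     (\<forall>a. a \<epsilon> B \<longrightarrow> a \<preceq> a) \<and>
     (\<forall>a b. a \<epsilon> B \<and> b \<epsilon> B \<and> a \<preceq> b \<and> b \<preceq> a \<longrightarrow> a = b) \<and>
     (\<forall>a b c. a \<epsilon> B \<and> b \<epsilon> B \<and> c \<epsilon> B \<and> a \<preceq> b \<and> b \<preceq> c \<longrightarrow> a \<preceq> c) \<and>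
     (\<exists>s. is_lub {} s) \<and> (\<exists>s. is_glb {} s) \<and>
     (\<forall>a b. a \<epsilon> B \<and> b \<epsilon> B \<longrightarrow> (\<exists>s. is_lub {a, b} s) \<and> (\<exists>s. is_glb {a, b} s)) \<and>
     (\<forall>a b c d m p q r. a \<epsilon> B \<and> b \<epsilon> B \<and> c \<epsilon> B \<and> is_lub {b, c} d \<and> is_glb {a, d} m \<and>
        is_glb {a, b} p \<and> is_glb {a, c} q \<and> is_lub {p, q} r \<longrightarrow> m = r) \<and>
     (\<forall>a. a \<epsilon> B \<longrightarrow> (\<exists>c. is_compl a c)) \<and>
     (\<forall>X. (\<forall>x. x \<epsilon> X \<longrightarrow> x \<epsilon> B) \<longrightarrow> (\<exists>s. is_lub {x. x \<epsilon> X} s))"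

lemma complete_boolean_algebraI:
  assumes rel: cba_rel shows complete_boolean_algebra
proof -
  have po: "\<forall>a. a \<epsilon> B \<longrightarrow> a \<preceq> a" "\<forall>a b. a \<epsilon> B \<and> b \<epsilon> B \<and> a \<preceq> b \<and> b \<preceq> a \<longrightarrow> a = b"
      "\<forall>a b c. a \<epsilon> B \<and> b \<epsilon> B \<and> c \<epsilon> B \<and> a \<preceq> b \<and> b \<preceq> c \<longrightarrow> a \<preceq> c"
    and ex0: "\<exists>s. is_lub {} s" "\<exists>s. is_glb {} s"
    and ex2: "\<forall>a b. a \<epsilon> B \<and> b \<epsilon> B \<longrightarrow> (\<exists>s. is_lub {a, b} s) \<and> (\<exists>s. is_glb {a, b} s)"
    and dist: "\<forall>a b c d m p q r. a \<epsilon> B \<and> b \<epsilon> B \<and> c \<epsilon> B \<and> is_lub {b, c} d \<and> is_glb {a, d} m \<and>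
        is_glb {a, b} p \<and> is_glb {a, c} q \<and> is_lub {p, q} r \<longrightarrow> m = r"
    and cmp: "\<forall>a. a \<epsilon> B \<longrightarrow> (\<exists>c. is_compl a c)"
    and sups: "\<forall>X. (\<forall>x. x \<epsilon> X \<longrightarrow> x \<epsilon> B) \<longrightarrow> (\<exists>s. is_lub {x. x \<epsilon> X} s)"
    using rel unfolding cba_rel_def by - (elim conjE, assumption)+
  have lub_unique: "s = s'" if "is_lub S s" "is_lub S s'" for S s s'
    using that po(2) unfolding is_lub_def by blast
  have glb_unique: "s = s'" if "is_glb S s" "is_glb S s'" for S s s'
    using that po(2) unfolding is_glb_def by blast
  have bsup: "bsup S = s" if "is_lub S s" for S s
    unfolding bsup_def by (rule the_equality[where a = s]) (use that lub_unique in blast)+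
  have binf: "binf S = s" if "is_glb S s" for S s
    unfolding binf_def by (rule the_equality[where a = s]) (use that glb_unique in blast)+
  have join: "is_lub {a, b} (a \<squnion> b)" and meet: "is_glb {a, b} (a \<sqinter> b)" if "a \<epsilon> B" "b \<epsilon> B" for a b
  proof -
    obtain s t where "is_lub {a, b} s" "is_glb {a, b} t" using ex2 \<open>a \<epsilon> B\<close> \<open>b \<epsilon> B\<close> by blast
    then show "is_lub {a, b} (a \<squnion> b)" "is_glb {a, b} (a \<sqinter> b)"
      unfolding join_def meet_def by (simp_all add: bsup binf)
  qed
  have B: "a \<squnion> b \<epsilon> B" "a \<sqinter> b \<epsilon> B" if "a \<epsilon> B" "b \<epsilon> B" for a b
    using join[OF that] meet[OF that] unfolding is_lub_def is_glb_def by simp_all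
  have d: "a \<sqinter> (b \<squnion> c) = (a \<sqinter> b) \<squnion> (a \<sqinter> c)" if "a \<epsilon> B" "b \<epsilon> B" "c \<epsilon> B" for a b c
    using dist[rule_format, OF conjI[OF that(1) conjI[OF that(2) conjI[OF that(3) conjI[OF join[OF that(2,3)]
        conjI[OF meet[OF that(1) B(1)[OF that(2,3)]] conjI[OF meet[OF that(1,2)] conjI[OF meet[OF that(1,3)]
        join[OF B(2)[OF that(1,2)] B(2)[OF that(1,3)]]]]]]]]]] .
  have c: "\<exists>c\<in>elts B. a \<sqinter> c = zero \<and> a \<squnion> c = one" if a: "a \<epsilon> B" for a
  proof -
    obtain c z u where c: "c \<epsilon> B" "is_lub {} z" "is_glb {a, c} z" "is_glb {} u" "is_lub {a, c} u"
      using cmp a unfolding is_compl_def by blast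
    have "a \<sqinter> c = zero" unfolding meet_def zero_def binf[OF c(3)] bsup[OF c(2)] ..
    moreover have "a \<squnion> c = one" unfolding join_def one_def binf[OF c(4)] bsup[OF c(5)] ..
    moreover have "c \<in> elts B" using c(1) by (simp add: elts_def)
    ultimately show ?thesis by blast
  qed
  have "boolean_algebra"
    unfolding boolean_algebra_def
  proof (intro conjI ballI impI)
    fix a assume "a \<in> elts B" then have a: "a \<epsilon> B" by (simp add: elts_def)
    show "a \<preceq> a" using po(1) a by blast
    show "\<exists>c\<in>elts B. a \<sqinter> c = zero \<and> a \<squnion> c = one" by (rule c[OF a])
    fix b assume "b \<in> elts B" then have b: "b \<epsilon> B" by (simp add: elts_def)
    show "\<exists>s. is_lub {a, b} s" "\<exists>s. is_glb {a, b} s" using ex2 a b by blast+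
    show "a = b" if "a \<preceq> b \<and> b \<preceq> a" using po(2) a b that by blast
    fix c assume "c \<in> elts B" then have c: "c \<epsilon> B" by (simp add: elts_def)
    show "a \<sqinter> (b \<squnion> c) = (a \<sqinter> b) \<squnion> (a \<sqinter> c)" by (rule d[OF a b c])
    show "a \<preceq> c" if "a \<preceq> b \<and> b \<preceq> c" using po(3) a b c that by blast
  qed (fact ex0)+
  moreover have "\<exists>s. is_lub (elts X) s" if "elts X \<subseteq> elts B" for X
    using sups that unfolding elts_def by blast
  ultimately show ?thesis unfolding complete_boolean_algebra_def by blast
qed

end

lemma (in cba_model) cba_rel: cba_rel
  unfolding cba_rel_def
proof (intro conjI allI impI; (elim conjE)?)
  fix a b c d m p q r
  assume *: "a \<epsilon> B" "b \<epsilon> B" "c \<epsilon> B" "is_lub {b, c} d" "is_glb {a, d} m" "is_glb {a, b} p" "is_glb {a, c} q" "is_lub {p, q} r"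
  have eq: "d = b \<squnion> c" "p = a \<sqinter> b" "q = a \<sqinter> c"
    using *(4,6,7) is_lub_iff[OF *(2,3)] is_glb_iff[OF *(1,2)] is_glb_iff[OF *(1,3)] by simp_all
  have "m = a \<sqinter> (b \<squnion> c)" using *(5) is_glb_iff[OF *(1) join_in[OF *(2,3)]] unfolding eq by simp
  moreover have "r = (a \<sqinter> b) \<squnion> (a \<sqinter> c)"
    using *(8) is_lub_iff[OF meet_in[OF *(1,2)] meet_in[OF *(1,3)]] unfolding eq by simp
  ultimately show "m = r" using meet_join_distrib[OF *(1-3)] by simp
next
  fix X assume "\<forall>x. x \<epsilon> X \<longrightarrow> x \<epsilon> B"
  then have "elts X \<subseteq> elts B" by (auto simp: elts_def)
  then show "\<exists>s. is_lub {x. x \<epsilon> X} s"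
    using cba unfolding complete_boolean_algebra_def elts_def by blast
next
  show "\<exists>s. is_lub {} s" using lub_zero by blast
  show "\<exists>s. is_glb {} s" using glb_one by blast
next
  fix a assume "a \<epsilon> B" then show "\<exists>c. is_compl a c" using is_compl_iff by blast
next
  fix a b assume "a \<epsilon> B" "b \<epsilon> B"
  then show "\<exists>s. is_lub {a, b} s" "\<exists>s. is_glb {a, b} s" using lub_join glb_meet by blast+
qed (fact le_refl le_antisym le_trans | (rule le_antisym, assumption+) | (rule le_trans[rotated 3], assumption+))+

lemma codef_cba_rel:
  "codefinable E E' j (\<lambda>_. internal_algebra.cba_rel E B L) (\<lambda>_. internal_algebra.cba_rel E' (j B) (j L))"
  unfolding internal_algebra.cba_rel_def by (intro codef)

section \<open>The embedding and the filter\<close>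

text \<open>Two structures of classes of the same representatives are isomorphic if they identify and relate
  the representatives in the same way. All isomorphisms of the theorem arise from this lemma, with names
  of \<open>V\<close> as representatives.\<close>
lemma quotient_isomorphism:
  assumes "\<And>\<tau> \<sigma>. \<tau> \<in> N \<Longrightarrow> \<sigma> \<in> N \<Longrightarrow> c \<tau> = c \<sigma> \<longleftrightarrow> k \<tau> = k \<sigma>"
    and "\<And>\<tau> \<sigma>. \<tau> \<in> N \<Longrightarrow> \<sigma> \<in> N \<Longrightarrow> R (c \<tau>) (c \<sigma>) \<longleftrightarrow> S (k \<tau>) (k \<sigma>)"
  shows "\<exists>\<pi>. isomorphism (c ` N) R (k ` N) S \<pi> \<and> (\<forall>\<tau>\<in>N. \<pi> (c \<tau>) = k \<tau>)"
proof -
  define \<pi> where "\<pi> x = k (SOME \<tau>. \<tau> \<in> N \<and> c \<tau> = x)" for x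
  have \<pi>: "\<pi> (c \<tau>) = k \<tau>" if "\<tau> \<in> N" for \<tau>
  proof -
    have "(SOME \<sigma>. \<sigma> \<in> N \<and> c \<sigma> = c \<tau>) \<in> N \<and> c (SOME \<sigma>. \<sigma> \<in> N \<and> c \<sigma> = c \<tau>) = c \<tau>"
      by (rule someI[of "\<lambda>\<sigma>. \<sigma> \<in> N \<and> c \<sigma> = c \<tau>" \<tau>]) (simp add: that)
    then show ?thesis unfolding \<pi>_def using assms(1) that by blast
  qed
  have "bij_betw \<pi> (c ` N) (k ` N)"
    unfolding bij_betw_def inj_on_def using \<pi> assms(1) by (auto simp: image_image)
  then show ?thesis unfolding isomorphism_def using \<pi> assms(2) by (intro exI[of _ \<pi>]) auto
qed

text \<open>The hypotheses of the theorem, together with the fact that they make \<open>(j B, j L)\<close> a complete Boolean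
  algebra in a model of ZFC.\<close>
locale generic_embedding = V: cba_model E B L + W: cba_model E' "j B" "j L"
  for E :: "'v \<Rightarrow> 'v \<Rightarrow> bool" and E' :: "'w \<Rightarrow> 'w \<Rightarrow> bool" and j :: "'v \<Rightarrow> 'w" and B L :: 'v +
  fixes F :: "'w set" and U :: "'v set"
  assumes el: "elementary_embedding E E' j"
    and F: "W.is_filter F"
    and ran_generic: "ran_generic E E' j B L F"
    and seed: "UNIV = {W.app (j f) (selected E' j F A) | A f. V.maximal_antichain A \<and> V.is_fun f A}"
    and U_def: "U = {b \<in> V.elts B. j b \<in> F}"
begin

lemmas transfer = codef_closed[OF el]

lemma j_mem: "E x y \<longleftrightarrow> E' (j x) (j y)"
  by (rule transfer) (intro codef)

lemma j_zero: "j V.zero = W.zero"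
proof -
  have "V.is_lub {} V.zero \<longleftrightarrow> W.is_lub {} (j V.zero)" by (rule transfer) (intro codef)
  then show ?thesis using V.lub_zero W.is_zero_iff by simp
qed

lemma j_one: "j V.one = W.one"
proof -
  have "V.is_glb {} V.one \<longleftrightarrow> W.is_glb {} (j V.one)" by (rule transfer) (intro codef)
  then show ?thesis using V.glb_one W.is_one_iff by simp
qed

lemma j_meet:
  assumes "E a B" "E b B" shows "j (V.meet a b) = W.meet (j a) (j b)"
proof -
  have "V.is_glb {a, b} (V.meet a b) \<longleftrightarrow> W.is_glb {j a, j b} (j (V.meet a b))" by (rule transfer) (intro codef)
  then show ?thesis using V.glb_meet[OF assms] W.is_glb_iff assms unfolding j_mem by simp
qed

lemma j_le: "V.le a b \<longleftrightarrow> W.le (j a) (j b)"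
  by (rule transfer) (intro codef)

lemma j_names: "\<tau> \<in> V.names \<longleftrightarrow> j \<tau> \<in> W.names"
  by (rule transfer) (intro codef)

lemma j_eq_value:
  assumes "\<tau> \<in> V.names" "\<sigma> \<in> V.names"
  shows "j (V.eq_value \<tau> \<sigma>) = W.eq_value (j \<tau>) (j \<sigma>)"
proof -
  have "V.eq_rel \<tau> \<sigma> (V.eq_value \<tau> \<sigma>) \<longleftrightarrow> W.eq_rel (j \<tau>) (j \<sigma>) (j (V.eq_value \<tau> \<sigma>))"
    by (rule transfer) (intro codef)
  then show ?thesis using V.eq_rel_iff[OF assms] W.eq_rel_iff assms unfolding j_names by simp
qed

lemma j_mem_value:
  assumes "\<tau> \<in> V.names" "\<sigma> \<in> V.names"
  shows "j (V.mem_value \<tau> \<sigma>) = W.mem_value (j \<tau>) (j \<sigma>)"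
proof -
  have "V.mem_value_rel \<tau> \<sigma> (V.mem_value \<tau> \<sigma>) \<longleftrightarrow> W.mem_value_rel (j \<tau>) (j \<sigma>) (j (V.mem_value \<tau> \<sigma>))"
    by (rule transfer) (intro codef)
  then show ?thesis using V.mem_value_lub(2)[OF assms] W.mem_value_lub(2) assms unfolding j_names by simp
qed

lemma j_check: "j (V.check x) = W.check (j x)"
proof -
  have "V.check_rel x (V.check x) \<longleftrightarrow> W.check_rel (j x) (j (V.check x))" by (rule transfer) (intro codef)
  then show ?thesis using V.check_rel_iff W.check_rel_iff by simp
qed

lemma j_ground_value:
  assumes "\<tau> \<in> V.names" shows "j (V.ground_value \<tau>) = W.ground_value (j \<tau>)"
proof -
  have "V.ground_rel \<tau> (V.ground_value \<tau>) \<longleftrightarrow> W.ground_rel (j \<tau>) (j (V.ground_value \<tau>))"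
    by (rule transfer) (intro codef)
  then show ?thesis using V.ground_value_lub(2)[OF assms] W.ground_value_lub(2) assms unfolding j_names by simp
qed

lemma U_iff: "E b B \<Longrightarrow> b \<in> U \<longleftrightarrow> j b \<in> F"
  by (simp add: U_def V.elts_iff)

lemma U_filter: "V.is_filter U"
  unfolding V.is_filter_def
proof (intro conjI ballI impI)
  show "U \<subseteq> V.elts B" by (auto simp: U_def)
  show "V.one \<in> U" using U_iff[OF V.one_in] j_one W.filter_one[OF F] by simp
  show "V.zero \<notin> U" using U_iff[OF V.zero_in] j_zero W.filter_zero[OF F] by simp
  fix a assume a: "a \<in> U"
  then have aB: "E a B" by (simp add: U_def V.elts_iff)
  {
    fix b assume b: "b \<in> U"
    then have bB: "E b B" by (simp add: U_def V.elts_iff)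
    show "V.meet a b \<in> U"
      using a b U_iff[OF V.meet_in[OF aB bB]] U_iff[OF aB] U_iff[OF bB] j_meet[OF aB bB] W.filter_meet[OF F]
      by simp
  next
    fix b assume b: "b \<in> V.elts B" "V.le a b"
    then have "E b B" by (simp add: V.elts_iff)
    then have "W.below (j a) (j b)" using aB b(2) unfolding W.below_def j_mem j_le by blast
    then show "b \<in> U" using W.filter_up[OF F] a U_iff[OF aB] U_iff[OF \<open>E b B\<close>] by blast
  }
qed

lemma U_eq_iff:
  "\<tau> \<in> V.names \<Longrightarrow> \<sigma> \<in> V.names \<Longrightarrow> V.eq_value \<tau> \<sigma> \<in> U \<longleftrightarrow> W.eq_value (j \<tau>) (j \<sigma>) \<in> F"
  using U_iff[OF V.eq_value_in] j_eq_value by simp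

lemma U_mem_iff:
  "\<tau> \<in> V.names \<Longrightarrow> \<sigma> \<in> V.names \<Longrightarrow> V.mem_value \<tau> \<sigma> \<in> U \<longleftrightarrow> W.mem_value (j \<tau>) (j \<sigma>) \<in> F"
  using U_iff[OF V.mem_value_in] j_mem_value by simp

lemma meets_antichain:
  assumes "V.maximal_antichain A" obtains b where "b \<in> F" "E' b (j A)"
  using ran_generic assms unfolding ran_generic_def W.elts_def by blast

lemma selected_unique:
  assumes A: "V.maximal_antichain A" and b: "b \<in> F" "E' b (j A)" and c: "c \<in> F" "E' c (j A)"
  shows "b = c"
proof (rule ccontr)
  assume "b \<noteq> c"
  have anti: "V.antichain A" using A unfolding V.maximal_antichain_def by blast
  have inB: "E a B" if "E a A" for a
    using anti that unfolding V.antichain_def Ball_def V.elts_iff by blast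
  have "\<forall>a b. E a A \<and> E b A \<and> a \<noteq> b \<longrightarrow> (\<exists>z. V.is_lub {} z \<and> V.is_glb {a, b} z)"
  proof (intro allI impI)
    fix a b assume *: "E a A \<and> E b A \<and> a \<noteq> b"
    then have "V.meet a b = V.zero" using anti unfolding V.antichain_def Ball_def V.elts_iff by blast
    then show "\<exists>z. V.is_lub {} z \<and> V.is_glb {a, b} z" using V.glb_zero_iff inB * by blast
  qed
  moreover have "(\<forall>a b. E a A \<and> E b A \<and> a \<noteq> b \<longrightarrow> (\<exists>z. V.is_lub {} z \<and> V.is_glb {a, b} z)) \<longleftrightarrow>
      (\<forall>a b. E' a (j A) \<and> E' b (j A) \<and> a \<noteq> b \<longrightarrow> (\<exists>z. W.is_lub {} z \<and> W.is_glb {a, b} z))"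
    by (rule transfer) (intro codef)
  ultimately have "\<exists>z. W.is_lub {} z \<and> W.is_glb {b, c} z" using b(2) c(2) \<open>b \<noteq> c\<close> by blast
  then have "W.meet b c = W.zero" using W.glb_zero_iff W.filter_in[OF F] b(1) c(1) by blast
  then show False using W.filter_meet[OF F b(1) c(1)] W.filter_zero[OF F] by simp
qed

text \<open>The hypothesis that every element of \<open>W\<close> is \<open>j(f)(b\<^sub>A)\<close>, with \<open>b\<close> as the selected element.\<close>
lemma representation:
  obtains A f b where "V.maximal_antichain A" "V.is_fun f A" "b \<in> F" "E' b (j A)" "W.pair_in b w (j f)"
    "W.is_fun (j f) (j A)"
proof -
  have "w \<in> {W.app (j f) (selected E' j F A) | A f. V.maximal_antichain A \<and> V.is_fun f A}"
    unfolding seed[symmetric] by simp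
  then obtain A f where A: "V.maximal_antichain A" "V.is_fun f A" and w: "w = W.app (j f) (selected E' j F A)"
    by blast
  obtain b where b: "b \<in> F" "E' b (j A)" using meets_antichain[OF A(1)] .
  have "selected E' j F A = b"
    unfolding selected_def
  proof (rule the_equality)
    show "b \<in> F \<inter> W.elts (j A)" using b by (simp add: W.elts_iff)
    show "c = b" if "c \<in> F \<inter> W.elts (j A)" for c
      using selected_unique[OF A(1) _ _ b] that by (simp add: W.elts_iff)
  qed
  moreover have "V.is_fun f A \<longleftrightarrow> W.is_fun (j f) (j A)" by (rule transfer) (intro codef)
  ultimately show ?thesis using that[OF A b] W.pair_in_app[OF _ b(2)] A(2) w by simp
qed

text \<open>A dense set of \<open>W\<close> need not be in the range of \<open>j\<close>, but it is \<open>j(f)(b\<^sub>A)\<close> for some \<open>f\<close>, and the maximal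
  antichain \<open>A'\<close> of \<open>V\<close> anticipates all possible values \<open>f(a)\<close> below the respective \<open>a\<close>.\<close>
lemma generic: "W.generic F"
  unfolding W.generic_def
proof (intro allI impI)
  fix D assume D: "W.dense D"
  obtain A f b where A: "V.maximal_antichain A" "V.is_fun f A" "b \<in> F" "E' b (j A)" "W.pair_in b D (j f)"
    "W.is_fun (j f) (j A)" using representation[of D] .
  \<comment> \<open>Density of a set, in first-order form. If \<open>f(a)\<close> is not dense, it imposes no restriction below \<open>a\<close>.\<close>
  define dn where "dn X \<longleftrightarrow> (\<forall>b. E b B \<and> \<not> V.is_lub {} b \<longrightarrow> (\<exists>d. E d X \<and> E d B \<and> \<not> V.is_lub {} d \<and> V.le d b))" for X
  define dn' where "dn' X \<longleftrightarrow> (\<forall>b. E' b (j B) \<and> \<not> W.is_lub {} b \<longrightarrow>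
     (\<exists>d. E' d X \<and> E' d (j B) \<and> \<not> W.is_lub {} d \<and> W.le d b))" for X
  have def_dn: "codefinable E E' j (\<lambda>e. dn (e 0)) (\<lambda>e. dn' (e 0))"
    unfolding dn_def dn'_def by (intro codef)
  have def_dn1: "codefinable E E (\<lambda>x. x) (\<lambda>e. dn (e 0)) (\<lambda>e. dn (e 0))"
    unfolding dn_def by (intro codef)
  let ?P = "\<lambda>d. \<exists>a. E a A \<and> V.le d a \<and> (\<exists>X. V.pair_in a X f \<and> (E d X \<or> \<not> dn X))"
  obtain A' where A': "V.maximal_antichain A'" "\<And>a. E a A' \<Longrightarrow> E a B \<and> ?P a"
  proof -
    have anti: "V.antichain A" using A(1) unfolding V.maximal_antichain_def by blast
    have "\<exists>A'. V.maximal_antichain A' \<and> (\<forall>a. E a A' \<longrightarrow> ?P a)"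
    proof (rule V.antichain_below_dense)
      show "codefinable E E (\<lambda>x. x) (\<lambda>e. ?P (e 0)) (\<lambda>e. ?P (e 0))"
        by (intro codef codef_subst1[OF def_dn1])
      fix b assume b: "E b B" "b \<noteq> V.zero"
      then obtain a where a: "E a A" "V.meet a b \<noteq> V.zero" using A(1) unfolding V.maximal_antichain_iff by blast
      have aB: "E a B" using anti a(1) unfolding V.antichain_def Ball_def V.elts_iff by blast
      note m = V.meet_in[OF aB b(1)]
      obtain X where X: "V.pair_in a X f" using A(2) a(1) unfolding V.is_fun_def by blast
      obtain d where d: "E d B" "d \<noteq> V.zero" "V.le d (V.meet a b)" "E d X \<or> \<not> dn X"
      proof (cases "dn X")
        case True
        then show ?thesis using that m a(2) unfolding dn_def V.is_zero_iff by blast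
      qed (use that m a(2) V.le_refl in blast)
      then have "V.le d a" "V.le d b" using V.le_meet_iff[OF aB b(1) d(1)] by blast+
      then show "\<exists>d. E d B \<and> ?P d \<and> d \<noteq> V.zero \<and> V.le d b" using d a(1) X by blast
    qed
    then show ?thesis using that unfolding V.maximal_antichain_def V.antichain_def Ball_def V.elts_iff by blast
  qed
  obtain d where d: "d \<in> F" "E' d (j A')" using meets_antichain[OF A'(1)] .
  have "(\<forall>d. E d A' \<longrightarrow> ?P d) \<longleftrightarrow> (\<forall>d. E' d (j A') \<longrightarrow>
      (\<exists>a. E' a (j A) \<and> W.le d a \<and> (\<exists>X. W.pair_in a X (j f) \<and> (E' d X \<or> \<not> dn' X))))"
    by (rule transfer) (intro codef codef_subst1[OF def_dn])
  then obtain a X where a: "E' a (j A)" "W.le d a" "W.pair_in a X (j f)" "E' d X \<or> \<not> dn' X"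
    using A'(2) d(2) by blast
  have "(\<forall>a. E a A \<longrightarrow> E a B) \<longleftrightarrow> (\<forall>a. E' a (j A) \<longrightarrow> E' a (j B))" by (rule transfer) (intro codef)
  then have "E' a (j B)"
    using A(1) a(1) unfolding V.maximal_antichain_def V.antichain_def Ball_def V.elts_iff by blast
  then have "a \<in> F" using W.filter_up[OF F d(1)] W.filter_in[OF F d(1)] a(2) unfolding W.below_def by blast
  then have "a = b" using selected_unique[OF A(1) _ a(1) A(3,4)] by blast
  then have "X = D" using a(3) A(4,5,6) W.app_eq by metis
  moreover have "dn' D" unfolding dn'_def W.is_zero_iff
    using D unfolding W.dense_def subset_eq Ball_def Bex_def W.elts_iff by blast
  ultimately have "E' d D" using a(4) by blast
  then show "F \<inter> W.elts D \<noteq> {}" using d(1) W.elts_iff by blast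
qed

text \<open>The statement that \<open>\<tau>\<close> mixes the names among the values of \<open>f\<close> along \<open>A\<close> is first-order; in \<open>W\<close>, it
  applies to the name \<open>\<sigma> = j(f)(b)\<close>, where \<open>b \<in> F\<close>.\<close>
lemma name_representation:
  assumes "\<sigma> \<in> W.names" shows "\<exists>\<tau>\<in>V.names. W.eq_value (j \<tau>) \<sigma> \<in> F"
proof -
  obtain A f b where A: "V.maximal_antichain A" "V.is_fun f A" "b \<in> F" "E' b (j A)" "W.pair_in b \<sigma> (j f)"
    using representation[of \<sigma>] by metis
  have "V.antichain A" using A(1) unfolding V.maximal_antichain_def by blast
  from V.mixing[OF this, of f] obtain \<tau> where \<tau>: "\<tau> \<in> V.names"
    and mix: "\<And>a \<sigma>. E a A \<Longrightarrow> V.pair_in a \<sigma> f \<Longrightarrow> \<sigma> \<in> V.names \<Longrightarrow> (\<And>\<sigma>'. V.pair_in a \<sigma>' f \<Longrightarrow> \<sigma>' = \<sigma>) \<Longrightarrow>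
      V.below a (V.eq_value \<tau> \<sigma>)" by blast
  have "\<forall>a \<sigma>. E a A \<and> V.pair_in a \<sigma> f \<and> \<sigma> \<in> V.names \<longrightarrow> (\<exists>v. V.eq_rel \<tau> \<sigma> v \<and> V.le a v)"
  proof (intro allI impI)
    fix a \<sigma> assume *: "E a A \<and> V.pair_in a \<sigma> f \<and> \<sigma> \<in> V.names"
    then have "V.below a (V.eq_value \<tau> \<sigma>)" using mix[of a \<sigma>] A(2) unfolding V.is_fun_def by blast
    then show "\<exists>v. V.eq_rel \<tau> \<sigma> v \<and> V.le a v" using V.eq_rel_iff[OF \<tau>] * unfolding V.below_def by blast
  qed
  moreover have "(\<forall>a \<sigma>. E a A \<and> V.pair_in a \<sigma> f \<and> \<sigma> \<in> V.names \<longrightarrow> (\<exists>v. V.eq_rel \<tau> \<sigma> v \<and> V.le a v)) \<longleftrightarrow>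
    (\<forall>a \<sigma>. E' a (j A) \<and> W.pair_in a \<sigma> (j f) \<and> \<sigma> \<in> W.names \<longrightarrow> (\<exists>v. W.eq_rel (j \<tau>) \<sigma> v \<and> W.le a v))"
    by (rule transfer) (intro codef)
  ultimately obtain v where v: "W.eq_rel (j \<tau>) \<sigma> v" "W.le b v" using A(4,5) assms by blast
  have j\<tau>: "j \<tau> \<in> W.names" using \<tau> unfolding j_names .
  have "v = W.eq_value (j \<tau>) \<sigma>" using v(1) W.eq_rel_iff[OF j\<tau> assms] by simp
  then have "W.below b (W.eq_value (j \<tau>) \<sigma>)"
    using v(2) W.filter_in[OF F A(3)] W.eq_value_in[OF j\<tau> assms] unfolding W.below_def by simp
  then show ?thesis using W.filter_up[OF F A(3)] \<tau> by blast
qed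

lemma extension_iso:
  "isomorphic (W.quotient_model F) (W.mem_class F) (V.quotient_model U) (V.mem_class U)"
proof -
  have 1: "(\<lambda>\<tau>. W.name_class F (j \<tau>)) ` V.names = W.quotient_model F"
  proof (intro equalityI subsetI)
    fix X assume "X \<in> W.quotient_model F"
    then obtain \<sigma> where \<sigma>: "\<sigma> \<in> W.names" "X = W.name_class F \<sigma>" unfolding W.quotient_model_def by blast
    then obtain \<tau> where \<tau>: "\<tau> \<in> V.names" "W.eq_value (j \<tau>) \<sigma> \<in> F" using name_representation by blast
    then have "W.name_class F (j \<tau>) = X" using W.name_class_eq_iff[OF F _ \<sigma>(1)] \<sigma>(2) j_names by blast
    then show "X \<in> (\<lambda>\<tau>. W.name_class F (j \<tau>)) ` V.names" using \<tau>(1) by blast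
  qed (auto simp: W.quotient_model_def j_names)
  have 2: "V.name_class U ` V.names = V.quotient_model U" unfolding V.quotient_model_def by blast
  have "\<exists>\<pi>. isomorphism ((\<lambda>\<tau>. W.name_class F (j \<tau>)) ` V.names) (W.mem_class F)
      (V.name_class U ` V.names) (V.mem_class U) \<pi> \<and> (\<forall>\<tau>\<in>V.names. \<pi> (W.name_class F (j \<tau>)) = V.name_class U \<tau>)"
    by (rule quotient_isomorphism)
      (simp_all add: V.name_class_eq_iff[OF U_filter] W.name_class_eq_iff[OF F] V.mem_class_iff[OF U_filter]
        W.mem_class_iff[OF F] U_eq_iff U_mem_iff j_names[symmetric])
  then show ?thesis unfolding 1 2 isomorphic_def by blast
qed

lemma valuation_iso:
  assumes wf: "wfp E'" and val: "W.valuation F val R"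
  shows "isomorphic (val ` W.names) R (V.quotient_model U) (V.mem_class U)"
proof -
  note veq = W.valuation_eq_iff[OF wf F generic val] and vmem = W.valuation_mem_iff[OF wf F generic val]
  have 1: "(\<lambda>\<tau>. val (j \<tau>)) ` V.names = val ` W.names"
  proof (intro equalityI subsetI)
    fix x assume "x \<in> val ` W.names"
    then obtain \<sigma> where \<sigma>: "\<sigma> \<in> W.names" "x = val \<sigma>" by blast
    then obtain \<tau> where \<tau>: "\<tau> \<in> V.names" "W.eq_value (j \<tau>) \<sigma> \<in> F" using name_representation by blast
    then have "val (j \<tau>) = x" using veq \<sigma> j_names by blast
    then show "x \<in> (\<lambda>\<tau>. val (j \<tau>)) ` V.names" using \<tau>(1) by blast
  qed (auto simp: j_names)
  have 2: "V.name_class U ` V.names = V.quotient_model U" unfolding V.quotient_model_def by blast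
  have "\<exists>\<pi>. isomorphism ((\<lambda>\<tau>. val (j \<tau>)) ` V.names) R
      (V.name_class U ` V.names) (V.mem_class U) \<pi> \<and> (\<forall>\<tau>\<in>V.names. \<pi> (val (j \<tau>)) = V.name_class U \<tau>)"
    by (rule quotient_isomorphism)
      (simp_all add: V.name_class_eq_iff[OF U_filter] V.mem_class_iff[OF U_filter]
        veq[symmetric] vmem[symmetric] U_eq_iff U_mem_iff j_names[symmetric])
  then show ?thesis unfolding 1 2 isomorphic_def by blast
qed

text \<open>A name \<open>\<tau>\<close> of the Boolean ultrapower is sent to the element \<open>k \<tau>\<close> of \<open>W\<close> that the name \<open>j \<tau>\<close> denotes in
  the sense of \<open>F\<close>.\<close>
lemma ultrapower_iso:
  "\<exists>\<pi>. isomorphism (V.boolean_ultrapower U) (V.mem_class U) UNIV E' \<pi> \<and>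
     (\<forall>x. \<pi> (V.ultrapower_map U x) = j x)"
proof -
  define N where "N = {\<tau> \<in> V.names. V.ground_value \<tau> \<in> U}"
  define k where "k \<tau> = (THE x. W.eq_value (j \<tau>) (W.check x) \<in> F)" for \<tau>
  have gv_in: "E (V.ground_value \<tau>) B" if "\<tau> \<in> V.names" for \<tau>
    by (rule V.is_lub_in[OF V.ground_value_lub(1)[OF that]])
  have gv_iff: "V.ground_value \<tau> \<in> U \<longleftrightarrow> W.ground_value (j \<tau>) \<in> F" if "\<tau> \<in> V.names" for \<tau>
    using U_iff[OF gv_in[OF that]] j_ground_value[OF that] by simp
  have check_unique: "x = y" if n: "\<sigma> \<in> W.names" and eq: "W.eq_value \<sigma> (W.check x) \<in> F" "W.eq_value \<sigma> (W.check y) \<in> F" for \<sigma> x y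
  proof (rule ccontr)
    assume "x \<noteq> y"
    have "W.eq_value (W.check x) (W.check y) \<in> F"
      by (rule W.filter_eq_trans[OF F W.check_in_names n W.check_in_names W.filter_eq_sym[OF eq(1) n W.check_in_names] eq(2)])
    then show False using W.eq_value_check_distinct[OF \<open>x \<noteq> y\<close>] W.filter_zero[OF F] by simp
  qed
  have k_eq: "k \<tau> = x" if "\<tau> \<in> V.names" "W.eq_value (j \<tau>) (W.check x) \<in> F" for \<tau> x
    unfolding k_def by (rule the_equality) (use that check_unique j_names in blast)+
  have k: "W.eq_value (j \<tau>) (W.check (k \<tau>)) \<in> F" if \<tau>: "\<tau> \<in> N" for \<tau>
  proof -
    have n: "\<tau> \<in> V.names" "j \<tau> \<in> W.names" and g: "W.ground_value (j \<tau>) \<in> F"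
      using \<tau> gv_iff j_names unfolding N_def by blast+
    let ?S = "{s. \<exists>x z. W.check_rel x z \<and> W.eq_rel (j \<tau>) z s}"
    have S: "?S = {W.eq_value (j \<tau>) (W.check x) | x. True}"
      by (auto simp: W.check_rel_iff W.eq_rel_iff[OF n(2) W.check_in_names])
    have "\<exists>a\<in>?S. a \<in> F"
    proof (rule W.generic_lub[OF F generic _ g])
      show "W.is_lub ?S (W.ground_value (j \<tau>))" unfolding S by (rule W.ground_value_lub(1)[OF n(2)])
      show "?S \<subseteq> W.elts (j B)" unfolding S using W.eq_value_in[OF n(2) W.check_in_names] by (auto simp: W.elts_iff)
      show "codefinable E' E' (\<lambda>x. x) (\<lambda>e. e 0 \<in> ?S) (\<lambda>e. e 0 \<in> ?S)" unfolding mem_Collect_eq by (intro codef)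
    qed
    then obtain x where "W.eq_value (j \<tau>) (W.check x) \<in> F" unfolding S by blast
    then show ?thesis using k_eq[OF n(1)] by simp
  qed
  have jN: "j \<tau> \<in> W.names" if "\<tau> \<in> N" for \<tau> using that j_names unfolding N_def by blast
  have N_names: "\<tau> \<in> V.names" if "\<tau> \<in> N" for \<tau> using that unfolding N_def by blast
  have in_N: "\<tau> \<in> N" if \<tau>: "\<tau> \<in> V.names" "W.eq_value (j \<tau>) (W.check x) \<in> F" for \<tau> x
  proof -
    have n: "j \<tau> \<in> W.names" using \<tau> j_names by blast
    have "W.le (W.eq_value (j \<tau>) (W.check x)) (W.ground_value (j \<tau>))"
      using W.ground_value_lub(1)[OF n] unfolding W.is_lub_def by blast
    then have "W.below (W.eq_value (j \<tau>) (W.check x)) (W.ground_value (j \<tau>))"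
      unfolding W.below_def using W.eq_value_in[OF n W.check_in_names] W.is_lub_in[OF W.ground_value_lub(1)[OF n]] by blast
    then have "W.ground_value (j \<tau>) \<in> F" by (rule W.filter_up[OF F \<tau>(2)])
    then show ?thesis unfolding N_def using \<tau>(1) gv_iff by blast
  qed
  have "k ` N = UNIV"
  proof (intro equalityI subsetI)
    fix x
    obtain \<tau> where \<tau>: "\<tau> \<in> V.names" "W.eq_value (j \<tau>) (W.check x) \<in> F"
      using name_representation[OF W.check_in_names] by blast
    then show "x \<in> k ` N" using k_eq[OF \<tau>] in_N[OF \<tau>] by blast
  qed simp
  moreover have "V.name_class U ` N = V.boolean_ultrapower U"
    unfolding V.boolean_ultrapower_def N_def by blast
  moreover have "\<exists>\<pi>. isomorphism (V.name_class U ` N) (V.mem_class U) (k ` N) E' \<pi> \<and>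
      (\<forall>\<tau>\<in>N. \<pi> (V.name_class U \<tau>) = k \<tau>)"
  proof (rule quotient_isomorphism)
    fix \<tau> \<sigma> assume n: "\<tau> \<in> N" "\<sigma> \<in> N"
    note n' = N_names[OF n(1)] N_names[OF n(2)] and jn = jN[OF n(1)] jN[OF n(2)]
    have "W.eq_value (j \<tau>) (j \<sigma>) \<in> F \<longleftrightarrow> k \<tau> = k \<sigma>"
    proof
      assume "W.eq_value (j \<tau>) (j \<sigma>) \<in> F"
      then have "W.eq_value (j \<tau>) (W.check (k \<sigma>)) \<in> F"
        by (rule W.filter_eq_trans[OF F jn W.check_in_names _ k[OF n(2)]])
      then show "k \<tau> = k \<sigma>" by (rule k_eq[OF n'(1)])
    next
      assume "k \<tau> = k \<sigma>"
      then show "W.eq_value (j \<tau>) (j \<sigma>) \<in> F"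
        using W.filter_eq_trans[OF F jn(1) W.check_in_names jn(2) k[OF n(1)]]
          W.filter_eq_sym[OF k[OF n(2)] jn(2) W.check_in_names] by simp
    qed
    then show "V.name_class U \<tau> = V.name_class U \<sigma> \<longleftrightarrow> k \<tau> = k \<sigma>"
      using V.name_class_eq_iff[OF U_filter n'] U_eq_iff[OF n'] by simp
    have "W.mem_value (j \<tau>) (j \<sigma>) \<in> F \<longleftrightarrow> W.mem_value (W.check (k \<tau>)) (W.check (k \<sigma>)) \<in> F"
      using W.filter_mem_cong[OF F W.check_in_names jn(1) W.check_in_names jn(2)
          W.filter_eq_sym[OF k[OF n(1)] jn(1) W.check_in_names] k[OF n(2)]]
        W.filter_mem_cong[OF F jn(1) W.check_in_names jn(2) W.check_in_names
          k[OF n(1)] W.filter_eq_sym[OF k[OF n(2)] jn(2) W.check_in_names]] by blast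
    also have "\<dots> \<longleftrightarrow> E' (k \<tau>) (k \<sigma>)"
      unfolding W.mem_value_check using W.filter_one[OF F] W.filter_zero[OF F] by simp
    finally show "V.mem_class U (V.name_class U \<tau>) (V.name_class U \<sigma>) \<longleftrightarrow> E' (k \<tau>) (k \<sigma>)"
      using V.mem_class_iff[OF U_filter n'] U_mem_iff[OF n'] by simp
  qed
  moreover have "V.check x \<in> N \<and> k (V.check x) = j x" for x
  proof -
    have "W.eq_value (j (V.check x)) (W.check (j x)) \<in> F"
      unfolding j_check by (rule W.filter_eq_refl[OF F W.check_in_names])
    then show ?thesis using in_N k_eq V.check_in_names by blast
  qed
  ultimately show ?thesis unfolding V.ultrapower_map_def by metis
qed

end

section \<open>Characterization of Boolean ultrapower embeddings\<close>

theorem theorem38: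
  fixes E :: "'v \<Rightarrow> 'v \<Rightarrow> bool"
    and E' :: "'w \<Rightarrow> 'w \<Rightarrow> bool"
    and j :: "'v \<Rightarrow> 'w"
    and B L :: 'v
    and F :: "'w set"
    and U :: "'v set"
  assumes "membership.ZFC E"
    and "internal_algebra.complete_boolean_algebra E B L"
    and "elementary_embedding E E' j"
    and "internal_algebra.is_filter E' (j B) (j L) F"
    and "ran_generic E E' j B L F"
    and "(UNIV :: 'w set) =
      {membership.app E' (j f) (selected E' j F A) | A f.
        internal_algebra.maximal_antichain E B L A \<and> membership.is_fun E f A}"
    and "U = {b \<in> membership.elts E B. j b \<in> F}"
  shows "(\<exists>\<pi>. isomorphism
              (internal_algebra.boolean_ultrapower E B L U) (internal_algebra.mem_class E B L U)
              (UNIV :: 'w set) E' \<pi> \<and>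
            (\<forall>x. \<pi> (internal_algebra.ultrapower_map E B L U x) = j x))
    \<and> internal_algebra.generic E' (j B) (j L) F
    \<and> isomorphic
        (internal_algebra.quotient_model E' (j B) (j L) F) (internal_algebra.mem_class E' (j B) (j L) F)
        (internal_algebra.quotient_model E B L U) (internal_algebra.mem_class E B L U)
    \<and> (wfp E' \<longrightarrow> (\<forall>(val :: 'w \<Rightarrow> 'x) R.
        internal_algebra.valuation E' (j B) F val R \<longrightarrow>
        isomorphic
          (val ` internal_algebra.names E' (j B)) R
          (internal_algebra.quotient_model E B L U) (internal_algebra.mem_class E B L U)))"
proof -
  have V: "cba_model E B L"
    using assms(1,2) by (simp add: cba_model_def zfc_model_def cba_model_axioms_def)
  have "internal_algebra.cba_rel E' (j B) (j L)"
    using cba_model.cba_rel[OF V] codef_closed[OF assms(3) codef_cba_rel] by blast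
  then have "internal_algebra.complete_boolean_algebra E' (j B) (j L)"
    by (rule internal_algebra.complete_boolean_algebraI)
  then have W: "cba_model E' (j B) (j L)"
    using ZFC_transfer[OF assms(3,1)] by (simp add: cba_model_def zfc_model_def cba_model_axioms_def)
  interpret generic_embedding E E' j B L F U
    using V W assms(3-7) by (simp add: generic_embedding_def generic_embedding_axioms_def)
  show ?thesis
    using ultrapower_iso generic extension_iso valuation_iso by blast
qed

end
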